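(* For any compactly supported smooth radial function $f$ on $N_{n,2}$, for any $t\ge 0$ and $g\in N_{n,2}$: (i) (Positive curvature property) $\Gamma_2(f,f)\ge 0$. (ii) (LSI, i.e. logarithmic Sobolev, inequality) $$P_t(f\log f)(g)-P_t(f)(g)\,\log P_t(f)(g)\le t\,P_t\!\left(\frac{\Gamma(f,f)}{f}\right)(g).$$ (iii) (Isoperimetric inequality) $$P_t\big(|f-P_t(f)(g)|\big)(g)\le 4\sqrt{t}\,P_t\big(\Gamma(f)^{1/2}\big)(g),$$ where $\Gamma(f)=\Gamma(f,f)$.
   Context: $N_{n,2}$ is the simply connected nilpotent Lie group of rank (step) two with $n$ generators, identified with $\mathbb{R}^{n}\times\mathbb{R}^{n(n-1)/2}$ with coordinates $(\vec x,\vec y)=\big((x_i)_{1\le i\le n},(y_{ij})_{1\le i<j\le n}\big)$. Write $\partial_i=\partial/\partial x_i$, and $\hat\partial_{ij}=\partial/\partial y_{ij}$ for $i<j$. The vector fields $$X_i=\partial_i+\tfrac12\Big(\sum_{k<i}x_k\hat\partial_{ki}-\sum_{k>i}x_k\hat\partial_{ik}\Big),\quad 1\le i\le n,\qquad Y_{ij}=\hat\partial_{ij}=[X_i,X_j],\quad i<j,$$ are left invariant for the group law $(\vec x,\vec y)\circ(\vec x',\vec y')=\big(\vec x+\vec x',\,(y_{ij}+y'_{ij}+\tfrac12(x_ix'_j-x_jx'_i))_{i<j}\big)$. The sub-Laplacian is $\Delta=\sum_{i=1}^n X_i^2$, and $P_t=e^{t\Delta}$, $t\ge 0$, is the associated heat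 semigroup. For functions $f,h$ on $N_{n,2}$: $\Gamma(f,h)=\frac12(\Delta(fh)-f\Delta h-h\Delta f)=\sum_{i=1}^n X_if\,X_ih$ and $\Gamma_2(f,f)=\frac12\big(\Delta\Gamma(f,f)-2\Gamma(f,\Delta f)\big)$. For $1\le i<j\le n$ define the rotation vector fields $$\theta_{ij}=x_j\partial_i-x_i\partial_j+\sum_{1\le k<i}(y_{kj}\hat\partial_{ki}-y_{ki}\hat\partial_{kj})+\sum_{i<k<j}(y_{ik}\hat\partial_{kj}-y_{kj}\hat\partial_{ik})+\sum_{j<k\le n}(y_{jk}\hat\partial_{ik}-y_{ik}\hat\partial_{jk}).$$ A $C^2$ function $f:N_{n,2}\to\mathbb{R}$ is called radial if $\theta_{ij}f=0$ for all $1\le i<j\le n$. *)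

theory Defs
  imports "HOL-Probability.Probability"
begin

section \<open>The group $N_{n,2}$\<close>

text \<open>
  The type \<open>'n\<close> (finite, linearly ordered) plays the role of $\{1,\dots,n\}$. The $n(n+1)/2$
  coordinates of $N_{n,2}$ are indexed by the pairs $i \le j$: the pair $(i,i)$ is the index of
  $x_i$ and a pair $(i,j)$ with $i < j$ is the index of $y_{ij}$.
\<close>

typedef (overloaded) ('n::linorder) idx = "{(i::'n, j). i \<le> j}"
  by (rule exI[of _ "(undefined, undefined)"]) simp

instance idx :: ("{finite,linorder}") finite
proof
  show "finite (UNIV :: 'a idx set)"
    by (rule finite_imageD[where f = Rep_idx])
      (simp_all add: inj_on_def Rep_idx_inject)
qed

definition ix :: "'n::linorder \<Rightarrow> 'n idx" where
  "ix i = Abs_idx (i, i)"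

text \<open>Only used for \<open>i < j\<close>.\<close>

definition iy :: "'n::linorder \<Rightarrow> 'n \<Rightarrow> 'n idx" where
  "iy i j = Abs_idx (i, j)"

type_synonym 'n N2 = "real ^ 'n idx"

definition N2_mult :: "('n::{finite,linorder}) N2 \<Rightarrow> 'n N2 \<Rightarrow> 'n N2" where
  "N2_mult g h = (\<chi> a. case Rep_idx a of (i, j) \<Rightarrow>
     if i = j then g $ ix i + h $ ix i
     else g $ iy i j + h $ iy i j + (g $ ix i * h $ ix j - g $ ix j * h $ ix i) / 2)"


section \<open>Smooth functions and the vector fields\<close>

definition partial :: "'a::finite \<Rightarrow> (real ^ 'a \<Rightarrow> real) \<Rightarrow> real ^ 'a \<Rightarrow> real" where
  "partial a f p = deriv (\<lambda>s. f (p + s *\<^sub>R axis a 1)) 0"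

primrec C_k :: "nat \<Rightarrow> (real ^ 'a::finite \<Rightarrow> real) \<Rightarrow> bool" where
  "C_k 0 f \<longleftrightarrow> continuous_on UNIV f"
| "C_k (Suc k) f \<longleftrightarrow> (\<forall>p. f differentiable (at p)) \<and> (\<forall>a. C_k k (partial a f))"

definition smooth :: "(real ^ 'a::finite \<Rightarrow> real) \<Rightarrow> bool" where
  "smooth f \<longleftrightarrow> (\<forall>k. C_k k f)"

definition compactly_supported :: "(real ^ 'a::finite \<Rightarrow> real) \<Rightarrow> bool" where
  "compactly_supported f \<longleftrightarrow> compact (closure {p. f p \<noteq> 0})"

abbreviation dx :: "'n::{finite,linorder} \<Rightarrow> ('n N2 \<Rightarrow> real) \<Rightarrow> 'n N2 \<Rightarrow> real" where
  "dx i \<equiv> partial (ix i)"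

abbreviation dy :: "'n::{finite,linorder} \<Rightarrow> 'n \<Rightarrow> ('n N2 \<Rightarrow> real) \<Rightarrow> 'n N2 \<Rightarrow> real" where
  "dy i j \<equiv> partial (iy i j)"

definition X :: "'n::{finite,linorder} \<Rightarrow> ('n N2 \<Rightarrow> real) \<Rightarrow> 'n N2 \<Rightarrow> real" where
  "X i f p = dx i f p +
     ((\<Sum>k\<in>{..<i}. p $ ix k * dy k i f p) - (\<Sum>k\<in>{i<..}. p $ ix k * dy i k f p)) / 2"

definition sublaplacian :: "(('n::{finite,linorder}) N2 \<Rightarrow> real) \<Rightarrow> 'n N2 \<Rightarrow> real" where
  "sublaplacian f p = (\<Sum>i\<in>UNIV. X i (X i f) p)"

definition carre_du_champ ::
  "(('n::{finite,linorder}) N2 \<Rightarrow> real) \<Rightarrow> ('n N2 \<Rightarrow> real) \<Rightarrow> 'n N2 \<Rightarrow> real" where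
  "carre_du_champ f h p =
     (sublaplacian (\<lambda>q. f q * h q) p - f p * sublaplacian h p - h p * sublaplacian f p) / 2"

text \<open>The diagonal value $\Gamma_2(f,f)$.\<close>

definition Gamma_two :: "(('n::{finite,linorder}) N2 \<Rightarrow> real) \<Rightarrow> 'n N2 \<Rightarrow> real" where
  "Gamma_two f p =
     (sublaplacian (carre_du_champ f f) p - 2 * carre_du_champ f (sublaplacian f) p) / 2"

text \<open>Only used for \<open>i < j\<close>.\<close>

definition rotation ::
  "'n::{finite,linorder} \<Rightarrow> 'n \<Rightarrow> ('n N2 \<Rightarrow> real) \<Rightarrow> 'n N2 \<Rightarrow> real" where
  "rotation i j f p =
     p $ ix j * dx i f p - p $ ix i * dx j f p
     + (\<Sum>k\<in>{..<i}. p $ iy k j * dy k i f p - p $ iy k i * dy k j f p)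
     + (\<Sum>k\<in>{i<..<j}. p $ iy i k * dy k j f p - p $ iy k j * dy i k f p)
     + (\<Sum>k\<in>{j<..}. p $ iy j k * dy i k f p - p $ iy i k * dy j k f p)"

definition radial :: "(('n::{finite,linorder}) N2 \<Rightarrow> real) \<Rightarrow> bool" where
  "radial f \<longleftrightarrow> C_k 2 f \<and> (\<forall>i j p. i < j \<longrightarrow> rotation i j f p = 0)"


section \<open>The heat semigroup\<close>

text \<open>A convolution semigroup of probability measures, indexed by \<open>t \<ge> 0\<close> and started at the
  Dirac mass at the neutral element \<open>0\<close>.\<close>

definition convolution_semigroup :: "(real \<Rightarrow> ('n::{finite,linorder}) N2 measure) \<Rightarrow> bool" where
  "convolution_semigroup \<mu> \<longleftrightarrow>
     (\<forall>t\<ge>0. prob_space (\<mu> t) \<and> sets (\<mu> t) = sets borel) \<and>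
     \<mu> 0 = return borel 0 \<and>
     (\<forall>s\<ge>0. \<forall>t\<ge>0. \<mu> (s + t) = distr (\<mu> s \<Otimes>\<^sub>M \<mu> t) borel (\<lambda>(g, h). N2_mult g h))"

text \<open>
  $(P_t)_{t\ge 0}$ is $e^{t\Delta}$: the left invariant Markov semigroup whose generator, with
  respect to uniform convergence, is $\Delta$ on compactly supported smooth functions. Since these
  functions are a core for $\Delta$, this determines $P_t$ for $t \ge 0$. It is an integral
  operator, so that \<open>P t f\<close> also makes sense for bounded Borel functions \<open>f\<close> such as
  $\Gamma(f,f)/f$, which need not be continuous.
\<close>

definition heat_semigroup ::
  "(real \<Rightarrow> (('n::{finite,linorder}) N2 \<Rightarrow> real) \<Rightarrow> 'n N2 \<Rightarrow> real) \<Rightarrow> bool" where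
  "heat_semigroup P \<longleftrightarrow>
     (\<exists>\<mu>. convolution_semigroup \<mu> \<and>
        (\<forall>t\<ge>0. \<forall>f g. P t f g = (\<integral>h. f (N2_mult g h) \<partial>\<mu> t))) \<and>
     (\<forall>f. smooth f \<longrightarrow> compactly_supported f \<longrightarrow>
        uniform_limit UNIV (\<lambda>t g. (P t f g - f g) / t) (sublaplacian f) (at_right 0))"

end

theory Submission
  imports Defs
begin

text \<open>
  Besides the left invariant fields $X_i$ there are the right invariant fields $\widehat X_i$, which
  commute with every $X_j$ and, as $P_t$ is a convolution, with $P_t$. For a radial function $f$ the
  relations $\theta_{ij} f = 0$ give $\Gamma(f,f) = \sum_i (\widehat X_i f)^2$. Since $\Delta f$ is
  radial as well, $\Gamma_2(f,f) = \sum_i \Gamma(\widehat X_i f, \widehat X_i f) \ge 0$. Moreover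
  $P_t f$ is radial, because $\theta_{ij} P_t f$ solves the heat equation with initial value $0$; hence
  $\Gamma(P_t f, P_t f) = \sum_i (P_t \widehat X_i f)^2$, which makes the gradient bounds for $P_t f$
  consequences of the Cauchy-Schwarz inequality.

  Both functional inequalities, as well as the reverse Poincare inequality
  $2 t\, \Gamma(P_t \varphi, P_t \varphi) \le 1$ for radial $|\varphi| \le 1$, then follow from the
  parabolic maximum principle applied to the difference of their two sides as a function of time and
  position. For the isoperimetric inequality, $|f - c|$ with $c = P_t f(g)$ is written as
  $\varphi \cdot (f - c)$ where $\varphi$ is a smooth approximation of the sign of $f - c$, so
  that the covariance of $\varphi$ and $f$ under $P_t$ has to be bounded.
\<close>

section \<open>Calculus of smooth functions\<close>

text \<open>The generator is known on compactly supported smooth functions only, and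
  \<open>P t f\<close> need not be one. The usual interpolation \<open>P s (F (P (t - s) f))\<close>
  would apply \<open>P s\<close> to functions outside this class. The comparison functions used here
  combine values \<open>P s h\<close>, for fixed test functions \<open>h\<close>, with nonlinear
  expressions in such values. Their derivatives in space and time are therefore explicit, and the
  nonlinearity leaves a single \<Gamma> term for a gradient bound to absorb. The price is a maximum
  principle on a noncompact space, with growth controlled by \<open>1 + p \<bullet> p\<close>. For
  \<Delta> to commute with \<open>P t\<close>, the generator is still needed on \<open>P t h\<close>
  itself; a cutoff around one point suffices there.

  The constant in the isoperimetric inequality: reverse Poincare bounds the horizontal gradient of
  \<open>P s \<phi>\<close> by \<open>1 / sqrt (2 * s)\<close>, and twice this integrates over
  \<open>[0, t]\<close> to \<open>2 * sqrt 2 * sqrt t\<close>, which is below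
  \<open>4 * sqrt t\<close>.

  Logarithm and square root are singular at \<open>0\<close>, where a compactly supported function
  and its gradient do vanish. Both inequalities are first proved with a shift \<epsilon>, chosen so
  that all functions stay smooth and compactly supported up to constants.\<close>

lemma partial_eq:
  fixes f :: "real ^ 'a::finite \<Rightarrow> real"
  assumes "(f has_derivative f') (at p)"
  shows "partial a f p = f' (axis a 1)"
proof -
  interpret bounded_linear f' using assms by (rule has_derivative_bounded_linear)
  have "((\<lambda>s. f (p + s *\<^sub>R axis a 1)) has_derivative (\<lambda>s. f' (s *\<^sub>R axis a 1))) (at 0)"
    by (rule has_derivative_compose[of "\<lambda>s. p + s *\<^sub>R axis a 1" "\<lambda>s. s *\<^sub>R axis a 1" 0 UNIV f f'])
      (auto intro!: derivative_eq_intros assms)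
  moreover have "(\<lambda>s. f' (s *\<^sub>R axis a 1)) = (*) (f' (axis a 1))"
    by (auto simp: scaleR fun_eq_iff)
  ultimately show ?thesis
    unfolding partial_def by (intro DERIV_imp_deriv) (simp add: has_field_derivative_def)
qed

text \<open>Built from the partial derivatives, hence linear in \<open>v\<close> at every point;
  where \<open>f\<close> is differentiable it is the Frechet derivative.\<close>

definition grad :: "(real ^ 'a::finite \<Rightarrow> real) \<Rightarrow> real ^ 'a \<Rightarrow> real ^ 'a \<Rightarrow> real" where
  "grad f p v = (\<Sum>a\<in>UNIV. v $ a * partial a f p)"

lemma linear_grad: "linear (grad f p)"
  by (rule linearI) (simp_all add: grad_def algebra_simps sum.distrib sum_distrib_left)

lemma bounded_linear_grad: "bounded_linear (grad f p)"
  using linear_grad linear_conv_bounded_linear by blast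

lemma grad_axis [simp]: "grad f p (axis a 1) = partial a f p"
  by (simp add: grad_def axis_def if_distrib[of "\<lambda>x. x * _"] cong: if_cong)

lemma grad_unique:
  assumes "(f has_derivative f') (at p)"
  shows "f' v = grad f p v"
proof -
  interpret bounded_linear f' using assms by (rule has_derivative_bounded_linear)
  have "f' v = f' (\<Sum>a\<in>UNIV. v $ a *\<^sub>R axis a 1)"
    using basis_expansion[of v] by (simp add: scalar_mult_eq_scaleR)
  also have "\<dots> = grad f p v"
    by (simp add: sum scaleR grad_def partial_eq[OF assms])
  finally show ?thesis .
qed

lemma has_derivative_grad:
  "f differentiable at p \<Longrightarrow> (f has_derivative grad f p) (at p)"
  by (metis (no_types, lifting) ext differentiable_def grad_unique)

section \<open>Algebra of \<open>C_k\<close> and smooth functions\<close>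

lemma C_k_Suc_imp: "C_k (Suc k) f \<Longrightarrow> C_k k f"
proof (induction k arbitrary: f)
  case 0
  then show ?case
    by (auto simp: continuous_on_eq_continuous_at differentiable_imp_continuous_within)
qed simp

lemma C_k_continuous: "C_k k f \<Longrightarrow> continuous_on UNIV f"
  by (induction k) (auto dest: C_k_Suc_imp simp del: C_k.simps(2))

lemma partial_const [simp]: "partial a (\<lambda>_. c) p = 0"
  by (rule partial_eq[where f' = "\<lambda>_. 0", simplified]) simp

lemma C_k_const: "C_k k (\<lambda>_. c)"
proof -
  have "partial a (\<lambda>_. d) = (\<lambda>_. 0)" for a :: 'a and d
    by (simp add: fun_eq_iff)
  then show ?thesis by (induction k arbitrary: c) auto
qed

lemma C_k_linear: "bounded_linear f \<Longrightarrow> C_k k f"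
proof (cases k)
  case (Suc m)
  assume f: "bounded_linear f"
  then have "(f has_derivative f) (at p)" for p
    by (simp add: bounded_linear_imp_has_derivative)
  then have "f differentiable at p" "partial a f = (\<lambda>_. f (axis a 1))" for p a
    using partial_eq differentiable_def by blast+
  then show ?thesis using Suc by (simp add: C_k_const)
qed (simp add: linear_continuous_on)

lemma partial_add:
  assumes "f differentiable at p" "g differentiable at p"
  shows "partial a (\<lambda>q. f q + g q) p = partial a f p + partial a g p"
  using partial_eq[OF has_derivative_add[OF assms[THEN has_derivative_grad]]] by simp

lemma partial_mult:
  assumes "f differentiable at p" "g differentiable at p"
  shows "partial a (\<lambda>q. f q * g q) p = f p * partial a g p + partial a f p * g p"
  using partial_eq[OF has_derivative_mult[OF assms[THEN has_derivative_grad]]] by simp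

lemma grad_add:
  assumes "f differentiable at p" "g differentiable at p"
  shows "grad (\<lambda>q. f q + g q) p v = grad f p v + grad g p v"
  using grad_unique[OF has_derivative_add[OF assms[THEN has_derivative_grad]]] by simp

lemma grad_mult:
  assumes "f differentiable at p" "g differentiable at p"
  shows "grad (\<lambda>q. f q * g q) p v = f p * grad g p v + grad f p v * g p"
  using grad_unique[OF has_derivative_mult[OF assms[THEN has_derivative_grad]]] by simp

lemma grad_chain:
  assumes "f differentiable at p" "(\<phi> has_real_derivative d) (at (f p))"
  shows "(\<lambda>q. \<phi> (f q)) differentiable at p" "grad (\<lambda>q. \<phi> (f q)) p v = d * grad f p v"
proof -
  have *: "((\<lambda>q. \<phi> (f q)) has_derivative (\<lambda>v. d * grad f p v)) (at p)"
    by (rule has_derivative_compose[OF has_derivative_grad[OF assms(1)],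
          OF assms(2)[unfolded has_field_derivative_def]])
  show "(\<lambda>q. \<phi> (f q)) differentiable at p" using * differentiable_def by blast
  show "grad (\<lambda>q. \<phi> (f q)) p v = d * grad f p v"
    using grad_unique[OF *] by simp
qed

lemma partial_chain:
  assumes "f differentiable at p" "(\<phi> has_real_derivative d) (at (f p))"
  shows "partial a (\<lambda>q. \<phi> (f q)) p = d * partial a f p"
  using grad_chain(2)[OF assms, of "axis a 1"] by simp

lemma C_k_add: "C_k k f \<Longrightarrow> C_k k g \<Longrightarrow> C_k k (\<lambda>q. f q + g q)"
proof (induction k arbitrary: f g)
  case (Suc k)
  have "partial a (\<lambda>q. f q + g q) = (\<lambda>q. partial a f q + partial a g q)" for a
    using Suc.prems by (auto simp: partial_add)
  with Suc show ?case by (auto intro: differentiable_add)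
qed (auto intro: continuous_intros)

lemma C_k_mult: "C_k k f \<Longrightarrow> C_k k g \<Longrightarrow> C_k k (\<lambda>q. f q * g q)"
proof (induction k arbitrary: f g)
  case (Suc k)
  have "partial a (\<lambda>q. f q * g q) = (\<lambda>q. f q * partial a g q + partial a f q * g q)" for a
    using Suc.prems by (auto simp: partial_mult)
  moreover have "C_k k f" "C_k k g"
    using Suc.prems C_k_Suc_imp by blast+
  ultimately show ?case
    using Suc by (auto intro: C_k_add differentiable_mult)
qed (auto intro: continuous_intros)

lemma C_k_sum: "(\<And>i. C_k k (f i)) \<Longrightarrow> C_k k (\<lambda>p. \<Sum>i\<in>I. f i p)"
  by (induction I rule: infinite_finite_induct) (auto intro: C_k_add C_k_const)

lemma smooth_partial: "smooth f \<Longrightarrow> smooth (partial a f)"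
  unfolding smooth_def using C_k.simps(2) by blast

lemma smooth_differentiable: "smooth f \<Longrightarrow> f differentiable at p"
  unfolding smooth_def using C_k.simps(2) by blast

lemma smooth_continuous: "smooth f \<Longrightarrow> continuous_on UNIV f"
  unfolding smooth_def using C_k_continuous by blast

lemma smooth_measurable: "smooth f \<Longrightarrow> f \<in> borel_measurable borel"
  by (simp add: borel_measurable_continuous_onI smooth_continuous)

lemma smooth_has_derivative: "smooth f \<Longrightarrow> (f has_derivative grad f p) (at p)"
  by (intro has_derivative_grad smooth_differentiable)

lemma smooth_const [intro!]: "smooth (\<lambda>_. c)"
  by (simp add: smooth_def C_k_const)

lemma smooth_linear: "bounded_linear f \<Longrightarrow> smooth f"
  by (simp add: smooth_def C_k_linear)

lemma smooth_add [intro]: "smooth f \<Longrightarrow> smooth g \<Longrightarrow> smooth (\<lambda>q. f q + g q)"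
  by (simp add: smooth_def C_k_add)

lemma smooth_mult [intro]: "smooth f \<Longrightarrow> smooth g \<Longrightarrow> smooth (\<lambda>q. f q * g q)"
  by (simp add: smooth_def C_k_mult)

lemma smooth_minus [intro]: "smooth f \<Longrightarrow> smooth (\<lambda>q. - f q)"
  using smooth_mult[of "\<lambda>_. -1" f] by auto

lemma smooth_diff [intro]: "smooth f \<Longrightarrow> smooth g \<Longrightarrow> smooth (\<lambda>q. f q - g q)"
  using smooth_add[of f "\<lambda>q. - g q"] by auto

lemma smooth_power [intro]: "smooth f \<Longrightarrow> smooth (\<lambda>q. f q ^ n)"
  by (induction n) auto

lemma smooth_sum [intro]: "(\<And>i. i \<in> I \<Longrightarrow> smooth (f i)) \<Longrightarrow> smooth (\<lambda>q. \<Sum>i\<in>I. f i q)"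
  by (induction I rule: infinite_finite_induct) auto

lemma smooth_nth [intro]: "smooth (\<lambda>p. p $ a)"
  by (auto intro!: smooth_linear bounded_linear_vec_nth)

lemma smooth_grad:
  assumes "smooth f" "\<And>a. smooth (\<lambda>p. v p $ a)"
  shows "smooth (\<lambda>p. grad f p (v p))"
  unfolding grad_def by (intro smooth_sum smooth_mult smooth_partial assms)

text \<open>A whole family \<open>\<phi> m\<close> is treated at once, because the derivative of \<open>flat m\<close> involves
  \<open>flat (m + 1)\<close> and \<open>flat (m + 2)\<close>.\<close>

lemma smooth_compose:
  assumes u: "smooth u"
    and \<phi>: "\<And>m p. (\<phi> m has_real_derivative \<phi>' m (u p)) (at (u p))"
    and \<phi>': "\<And>m k. (\<And>m. C_k k (\<lambda>p. \<phi> m (u p))) \<Longrightarrow> C_k k (\<lambda>p. \<phi>' m (u p))"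
  shows "smooth (\<lambda>p. \<phi> m (u p))"
proof -
  have *: "(\<lambda>p. \<phi> m (u p)) differentiable at p"
     "partial a (\<lambda>p. \<phi> m (u p)) p = \<phi>' m (u p) * partial a u p" for m a p
    using grad_chain(1)[OF smooth_differentiable[OF u] \<phi>]
      partial_chain[OF smooth_differentiable[OF u] \<phi>] by auto
  have "C_k k (\<lambda>p. \<phi> m (u p))" for k m
  proof (induction k arbitrary: m)
    case 0
    then show ?case
      using * by (auto simp: continuous_on_eq_continuous_at differentiable_imp_continuous_within)
  next
    case (Suc k)
    have "C_k k (\<lambda>p. \<phi>' m (u p) * partial a u p)" for a
      using \<phi>'[OF Suc] smooth_partial[OF u] by (intro C_k_mult) (auto simp: smooth_def)
    then show ?case using * by (simp add: *(2)[abs_def])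
  qed
  then show ?thesis by (simp add: smooth_def)
qed

text \<open>The derivative is written as a polynomial in \<open>inverse\<close> itself, so the
  induction in \<open>smooth_compose\<close> closes.\<close>

lemma smooth_inverse:
  assumes "smooth u" "\<And>p. u p \<noteq> 0"
  shows "smooth (\<lambda>p. inverse (u p))"
proof (rule smooth_compose[where \<phi> = "\<lambda>_::unit. inverse" and \<phi>' = "\<lambda>_ x. - (inverse x * inverse x)" and m = "()"])
  fix k
  assume "\<And>m::unit. C_k k (\<lambda>p. inverse (u p))"
  then have "C_k k (\<lambda>p. (-1) * (inverse (u p) * inverse (u p)))"
    by (intro C_k_mult C_k_const) auto
  then show "C_k k (\<lambda>p. - (inverse (u p) * inverse (u p)))" by simp
qed (use assms in \<open>auto intro!: derivative_eq_intros simp: power2_eq_square\<close>)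

lemma smooth_divide:
  "smooth f \<Longrightarrow> smooth u \<Longrightarrow> (\<And>p. u p \<noteq> 0) \<Longrightarrow> smooth (\<lambda>p. f p / u p)"
  unfolding divide_inverse by (intro smooth_mult smooth_inverse)

lemma smooth_ln:
  assumes "smooth u" "\<And>p. u p > 0"
  shows "smooth (\<lambda>p. ln (u p))"
proof (rule smooth_compose[where \<phi> = "\<lambda>_::unit. ln" and \<phi>' = "\<lambda>_. inverse" and m = "()"])
  show "C_k k (\<lambda>p. inverse (u p))" for k
    using smooth_inverse[OF assms(1)] assms(2) by (metis smooth_def less_irrefl)
qed (use assms in \<open>auto intro!: derivative_eq_intros simp: inverse_eq_divide\<close>)

text \<open>The derivative is taken as \<open>sqrt x * (inverse x / 2)\<close>, that is
  \<open>sqrt\<close> itself times a function already known to be smooth, which is the form that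
  \<open>smooth_compose\<close> can use.\<close>

lemma smooth_sqrt:
  assumes "smooth u" "\<And>p. u p > 0"
  shows "smooth (\<lambda>p. sqrt (u p))"
proof (rule smooth_compose[where \<phi> = "\<lambda>_::unit. sqrt" and \<phi>' = "\<lambda>_ x. sqrt x * (inverse x / 2)" and m = "()"])
  fix k assume "\<And>m::unit. C_k k (\<lambda>p. sqrt (u p))"
  moreover have "smooth (\<lambda>p. inverse (u p) / 2)"
    using smooth_mult[OF smooth_inverse[OF assms(1)] smooth_const[of "1/2"]] assms(2)
    by (simp add: less_imp_neq[THEN not_sym])
  ultimately show "C_k k (\<lambda>p. sqrt (u p) * (inverse (u p) / 2))"
    by (intro C_k_mult) (auto simp: smooth_def)
next
  fix p
  have "u p > 0" by (rule assms)
  then have "inverse (sqrt (u p)) / 2 = sqrt (u p) * (inverse (u p) / 2)"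
    by (simp add: field_simps flip: power2_eq_square)
  then show "(sqrt has_real_derivative sqrt (u p) * (inverse (u p) / 2)) (at (u p))"
    using DERIV_real_sqrt[OF \<open>u p > 0\<close>] by simp
qed (use assms in auto)

section \<open>A smooth function vanishing on a half-line\<close>

text \<open>The classical \<open>exp (- 1 / x)\<close> divided by powers of \<open>x\<close>:
  derivatives of members are linear combinations of members. \<open>flat 0\<close> is the profile of
  the cutoff in \<open>generator_at\<close>.\<close>

definition flat :: "nat \<Rightarrow> real \<Rightarrow> real" where
  "flat m x = (if x \<le> 0 then 0 else exp (- 1 / x) / x ^ m)"

lemma has_real_derivative_flat:
  "(flat m has_real_derivative (- real m * flat (Suc m) x + flat (m + 2) x)) (at x)"
proof (cases x "0 :: real" rule: linorder_cases)
  case greater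
  have pow: "real m * x ^ (m - Suc 0) = real m * x ^ m / x"
    using greater by (cases m) auto
  have "((\<lambda>x. exp (- 1 / x) / x ^ m) has_real_derivative
      (exp (- 1 / x) * (1 / x\<^sup>2) * x ^ m - exp (- 1 / x) * (real m * x ^ (m - Suc 0))) / (x ^ m * x ^ m)) (at x)"
    using greater by (auto intro!: derivative_eq_intros simp: power2_eq_square)
  moreover have "(exp (- 1 / x) * (1 / x\<^sup>2) * x ^ m - exp (- 1 / x) * (real m * x ^ (m - Suc 0))) / (x ^ m * x ^ m)
      = - real m * flat (Suc m) x + flat (m + 2) x"
    unfolding pow using greater by (simp add: flat_def field_simps power2_eq_square)
  ultimately have "((\<lambda>x. exp (- 1 / x) / x ^ m) has_real_derivative
      (- real m * flat (Suc m) x + flat (m + 2) x)) (at x)"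
    by simp
  moreover have "\<forall>\<^sub>F y in nhds x. flat m y = exp (- 1 / y) / y ^ m"
    using eventually_nhds_in_open[of "{0<..}" x] greater
    by (auto simp: flat_def elim!: eventually_mono)
  ultimately show ?thesis
    by (subst DERIV_cong_ev[OF refl _ refl]) auto
next
  case less
  have "\<forall>\<^sub>F y in nhds x. flat m y = 0"
    using eventually_nhds_in_open[of "{..<0}" x] less
    by (auto simp: flat_def elim!: eventually_mono)
  moreover have "((\<lambda>_. 0) has_real_derivative (- real m * flat (Suc m) x + flat (m + 2) x)) (at x)"
    using less by (simp add: flat_def)
  ultimately show ?thesis
    by (subst DERIV_cong_ev[OF refl _ refl]) auto
next
  case equal
  \<comment> \<open>At \<open>0\<close> only the right-hand difference quotient is nontrivial; with
    \<open>y = 1 / h\<close> it becomes \<open>y ^ Suc m / exp y\<close> as \<open>y\<close> tends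
    to infinity.\<close>
  have lim: "((\<lambda>h. exp (- 1 / h) / h ^ Suc m) \<longlongrightarrow> 0) (at_right (0::real))"
  proof -
    have "((\<lambda>y::real. y ^ Suc m / exp y) \<longlongrightarrow> 0) at_top"
      by (rule tendsto_power_div_exp_0)
    then have "((\<lambda>h::real. inverse h ^ Suc m / exp (inverse h)) \<longlongrightarrow> 0) (at_right 0)"
      using filterlim_inverse_at_top_right by (rule filterlim_compose)
    then show ?thesis
      by (simp add: field_simps exp_minus inverse_eq_divide)
  qed
  have "((\<lambda>h. flat m h / h) \<longlongrightarrow> 0) (at_right 0)"
    by (rule Lim_transform_eventually[OF lim])
      (auto simp: flat_def eventually_at_filter)
  moreover have "((\<lambda>h. flat m h / h) \<longlongrightarrow> 0) (at_left 0)"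
    by (rule Lim_transform_eventually[OF tendsto_const])
      (auto simp: flat_def eventually_at_filter)
  ultimately have "((\<lambda>h. flat m h / h) \<longlongrightarrow> 0) (at 0)"
    by (simp add: filterlim_split_at)
  then show ?thesis using equal by (simp add: DERIV_def flat_def)
qed

lemma smooth_flat:
  assumes "smooth u"
  shows "smooth (\<lambda>p. flat m (u p))"
proof (rule smooth_compose[where \<phi> = flat and m = m, OF assms has_real_derivative_flat])
  fix k m assume "\<And>m. C_k k (\<lambda>p. flat m (u p))"
  then show "C_k k (\<lambda>p. - real m * flat (Suc m) (u p) + flat (m + 2) (u p))"
    by (intro C_k_add C_k_mult C_k_const) auto
qed

section \<open>Derivatives along lines and symmetry of second derivatives\<close>

lemma DERIV_along:
  assumes "f differentiable at (p + s *\<^sub>R v)"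
  shows "((\<lambda>s. f (p + s *\<^sub>R v)) has_real_derivative grad f (p + s *\<^sub>R v) v) (at s)"
proof -
  interpret bounded_linear "grad f (p + s *\<^sub>R v)" by (rule bounded_linear_grad)
  have "((\<lambda>s. f (p + s *\<^sub>R v)) has_derivative (\<lambda>t. grad f (p + s *\<^sub>R v) (t *\<^sub>R v))) (at s)"
    by (rule has_derivative_compose[of "\<lambda>s. p + s *\<^sub>R v" "\<lambda>t. t *\<^sub>R v" s UNIV])
      (auto intro!: derivative_eq_intros has_derivative_grad assms)
  then show ?thesis by (simp add: has_field_derivative_def scaleR mult.commute[of _ "grad _ _ _"])
qed

text \<open>The mean value theorem, first in direction \<open>a\<close> for the increment of
  \<open>f\<close> over \<open>h\<close> in direction \<open>b\<close>, then in direction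
  \<open>b\<close>. The left-hand side is symmetric in \<open>a\<close> and \<open>b\<close>, the
  right-hand side is not yet known to be.\<close>

lemma second_difference:
  assumes f: "smooth f" and h: "h > 0"
  shows "\<exists>\<xi>\<in>{0..h}. \<exists>\<eta>\<in>{0..h}.
    f (p + h *\<^sub>R axis a 1 + h *\<^sub>R axis b 1) - f (p + h *\<^sub>R axis a 1) - f (p + h *\<^sub>R axis b 1) + f p
      = h * h * partial b (partial a f) (p + \<xi> *\<^sub>R axis a 1 + \<eta> *\<^sub>R axis b 1)"
proof -
  let ?g = "\<lambda>s. f ((p + h *\<^sub>R axis b 1) + s *\<^sub>R axis a 1) - f (p + s *\<^sub>R axis a 1)"
  have "\<exists>\<xi>>0. \<xi> < h \<and> ?g h - ?g 0 = (h - 0) *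
      (partial a f ((p + h *\<^sub>R axis b 1) + \<xi> *\<^sub>R axis a 1) - partial a f (p + \<xi> *\<^sub>R axis a 1))"
    using h
    by (intro MVT2)
      (auto intro!: derivative_eq_intros DERIV_along[THEN DERIV_cong] smooth_differentiable f)
  then obtain \<xi> where \<xi>: "0 < \<xi>" "\<xi> < h" and 1: "?g h - ?g 0 = h *
      (partial a f ((p + h *\<^sub>R axis b 1) + \<xi> *\<^sub>R axis a 1) - partial a f (p + \<xi> *\<^sub>R axis a 1))"
    by auto
  let ?k = "\<lambda>s. partial a f ((p + \<xi> *\<^sub>R axis a 1) + s *\<^sub>R axis b 1)"
  have "\<exists>\<eta>>0. \<eta> < h \<and> ?k h - ?k 0 = (h - 0) *
      partial b (partial a f) ((p + \<xi> *\<^sub>R axis a 1) + \<eta> *\<^sub>R axis b 1)"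
    using h
    by (intro MVT2)
      (auto intro!: DERIV_along[THEN DERIV_cong] smooth_differentiable smooth_partial f)
  then obtain \<eta> where "0 < \<eta>" "\<eta> < h" "?k h - ?k 0 = h *
      partial b (partial a f) ((p + \<xi> *\<^sub>R axis a 1) + \<eta> *\<^sub>R axis b 1)"
    by auto
  with \<xi> 1 show ?thesis
    by (intro bexI[of _ \<xi>] bexI[of _ \<eta>]) (auto simp: algebra_simps)
qed

text \<open>Schwarz's theorem: the same second difference over \<open>h * h\<close> equals either
  mixed derivative at points that tend to \<open>p\<close> with \<open>h\<close>.\<close>

lemma partial_commute:
  assumes f: "smooth f"
  shows "partial a (partial b f) p = partial b (partial a f) p"
proof -
  define h where "h n = inverse (real (Suc n))" for n
  have h: "h n > 0" "h \<longlonglongrightarrow> 0" for n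
    unfolding h_def[abs_def] by (simp, rule LIMSEQ_inverse_real_of_nat)
  have *: "\<exists>\<xi> \<eta>. (\<forall>n. \<xi> n \<in> {0..h n} \<and> \<eta> n \<in> {0..h n} \<and>
      f (p + h n *\<^sub>R axis a 1 + h n *\<^sub>R axis b 1) - f (p + h n *\<^sub>R axis a 1) - f (p + h n *\<^sub>R axis b 1) + f p
      = h n * h n * partial b (partial a f) (p + \<xi> n *\<^sub>R axis a 1 + \<eta> n *\<^sub>R axis b 1))" for a b
    using second_difference[OF f h(1), where p = p and a = a and b = b] by metis
  obtain \<xi> \<eta> where 1: "\<And>n. \<xi> n \<in> {0..h n}" "\<And>n. \<eta> n \<in> {0..h n}"
     "\<And>n. f (p + h n *\<^sub>R axis a 1 + h n *\<^sub>R axis b 1) - f (p + h n *\<^sub>R axis a 1) - f (p + h n *\<^sub>R axis b 1) + f p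
      = h n * h n * partial b (partial a f) (p + \<xi> n *\<^sub>R axis a 1 + \<eta> n *\<^sub>R axis b 1)"
    using *[of a b] by metis
  obtain \<xi>' \<eta>' where 2: "\<And>n. \<xi>' n \<in> {0..h n}" "\<And>n. \<eta>' n \<in> {0..h n}"
     "\<And>n. f (p + h n *\<^sub>R axis b 1 + h n *\<^sub>R axis a 1) - f (p + h n *\<^sub>R axis b 1) - f (p + h n *\<^sub>R axis a 1) + f p
      = h n * h n * partial a (partial b f) (p + \<xi>' n *\<^sub>R axis b 1 + \<eta>' n *\<^sub>R axis a 1)"
    using *[of b a] by metis
  have lim: "s \<longlonglongrightarrow> 0" if "\<And>n. s n \<in> {0..h n}" for s :: "nat \<Rightarrow> real"
    by (rule tendsto_sandwich[OF _ _ tendsto_const h(2)]) (use that in auto)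
  have eq: "partial a (partial b f) (p + \<xi>' n *\<^sub>R axis b 1 + \<eta>' n *\<^sub>R axis a 1)
      = partial b (partial a f) (p + \<xi> n *\<^sub>R axis a 1 + \<eta> n *\<^sub>R axis b 1)" for n
  proof -
    have "h n * h n * partial a (partial b f) (p + \<xi>' n *\<^sub>R axis b 1 + \<eta>' n *\<^sub>R axis a 1)
      = h n * h n * partial b (partial a f) (p + \<xi> n *\<^sub>R axis a 1 + \<eta> n *\<^sub>R axis b 1)"
      using 1(3)[of n] 2(3)[of n, unfolded add.assoc add.commute[of "h n *\<^sub>R axis b 1" "h n *\<^sub>R axis a 1"]]
      unfolding add.assoc by linarith
    then show ?thesis using h(1)[of n] by simp
  qed
  have c: "isCont (partial a (partial b f)) p" for a b
    using smooth_continuous[OF smooth_partial[OF smooth_partial[OF f]]]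
    by (simp add: continuous_on_eq_continuous_at)
  have "(\<lambda>n. p + \<xi>' n *\<^sub>R axis b 1 + \<eta>' n *\<^sub>R axis a 1) \<longlonglongrightarrow> p + 0 *\<^sub>R axis b 1 + 0 *\<^sub>R axis a 1"
    by (intro tendsto_intros lim 2)
  then have A: "(\<lambda>n. partial a (partial b f) (p + \<xi>' n *\<^sub>R axis b 1 + \<eta>' n *\<^sub>R axis a 1))
      \<longlonglongrightarrow> partial a (partial b f) p"
    using isCont_tendsto_compose[OF c] by simp
  have "(\<lambda>n. p + \<xi> n *\<^sub>R axis a 1 + \<eta> n *\<^sub>R axis b 1) \<longlonglongrightarrow> p + 0 *\<^sub>R axis a 1 + 0 *\<^sub>R axis b 1"
    by (intro tendsto_intros lim 1)
  then have B: "(\<lambda>n. partial b (partial a f) (p + \<xi> n *\<^sub>R axis a 1 + \<eta> n *\<^sub>R axis b 1))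
      \<longlonglongrightarrow> partial b (partial a f) p"
    using isCont_tendsto_compose[OF c] by simp
  show ?thesis using LIMSEQ_unique[OF A[unfolded eq] B] .
qed

text \<open>Differentiation under the integral. The bound on \<open>F'\<close> makes every
  \<open>F _ k\<close> Lipschitz on the ball with constant \<open>B\<close>, so the remainder
  quotient is at most \<open>2 * \<bar>B\<bar>\<close> uniformly in \<open>k\<close>, and dominated
  convergence applies along sequences.\<close>

lemma has_derivative_integral_bounded:
  fixes F :: "'a::euclidean_space \<Rightarrow> 'b \<Rightarrow> real"
  assumes M: "finite_measure M"
    and der: "\<And>q k. q \<in> ball p 1 \<Longrightarrow> ((\<lambda>q. F q k) has_derivative F' q k) (at q)"
    and bnd: "\<And>q k v. q \<in> ball p 1 \<Longrightarrow> \<bar>F' q k v\<bar> \<le> B * norm v"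
    and int: "\<And>q. q \<in> ball p 1 \<Longrightarrow> integrable M (F q)"
    and meas: "\<And>v. (\<lambda>k. F' p k v) \<in> borel_measurable M"
  shows "((\<lambda>q. \<integral>k. F q k \<partial>M) has_derivative (\<lambda>v. \<integral>k. F' p k v \<partial>M)) (at p)"
proof -
  interpret finite_measure M by fact
  have lin: "bounded_linear (F' p k)" for k
    using der[of p k] by (simp add: has_derivative_bounded_linear)
  have int': "integrable M (\<lambda>k. F' p k v)" for v
    by (rule integrable_const_bound[of _ "B * norm v"]) (use bnd meas in auto)
  have [measurable]: "(\<lambda>k. F' p k v) \<in> borel_measurable M" for v by (rule meas)
  have blin: "bounded_linear (\<lambda>v. \<integral>k. F' p k v \<partial>M)"
  proof (rule bounded_linear_intro[where K = "B * measure M (space M)"])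
    fix v w :: 'a and r :: real
    show "(\<integral>k. F' p k (v + w) \<partial>M) = (\<integral>k. F' p k v \<partial>M) + (\<integral>k. F' p k w \<partial>M)"
      by (simp add: linear_simps[OF lin] int' Bochner_Integration.integral_add)
    show "(\<integral>k. F' p k (r *\<^sub>R v) \<partial>M) = r *\<^sub>R (\<integral>k. F' p k v \<partial>M)"
      by (simp add: linear_simps[OF lin])
    have "norm (\<integral>k. F' p k v \<partial>M) \<le> (\<integral>k. B * norm v \<partial>M)"
      using int' bnd[of p] by (intro order_trans[OF integral_norm_bound] integral_mono) auto
    then show "norm (\<integral>k. F' p k v \<partial>M) \<le> norm v * (B * measure M (space M))"
      by (simp add: algebra_simps)
  qed
  have lip: "\<bar>F y k - F p k\<bar> \<le> B * norm (y - p)" if "y \<in> ball p 1" for y k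
  proof -
    have "norm (F y k - F p k) \<le> B * norm (y - p)"
    proof (rule differentiable_bound[of "ball p 1" "\<lambda>q. F q k" "\<lambda>q. F' q k" B])
      show "((\<lambda>q. F q k) has_derivative F' x k) (at x within ball p 1)" if "x \<in> ball p 1" for x
        using der[OF that] by (rule has_derivative_at_withinI)
      show "onorm (F' x k) \<le> B" if "x \<in> ball p 1" for x
        using bnd[OF that] by (intro onorm_le) auto
    qed (use that in auto)
    then show ?thesis by simp
  qed
  let ?Q = "\<lambda>y k. (F y k - F p k - F' p k (y - p)) / norm (y - p)"
  have "((\<lambda>y. \<integral>k. ?Q y k \<partial>M) \<longlongrightarrow> 0) (at p within ball p 1)"
    unfolding tendsto_at_iff_sequentially
  proof (intro allI impI)
    fix X :: "nat \<Rightarrow> 'a" assume X: "\<forall>i. X i \<in> ball p 1 - {p}" "X \<longlonglongrightarrow> p"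
    have [measurable]: "F (X i) \<in> borel_measurable M" "F p \<in> borel_measurable M" for i
      using int X(1) by (auto intro: borel_measurable_integrable)
    have "(\<lambda>i. \<integral>k. ?Q (X i) k \<partial>M) \<longlonglongrightarrow> (\<integral>k. 0 \<partial>M)"
    proof (rule integral_dominated_convergence[where w = "\<lambda>_. 2 * \<bar>B\<bar>"])
      show "AE k in M. (\<lambda>i. ?Q (X i) k) \<longlonglongrightarrow> 0"
      proof (rule AE_I2)
        fix k
        have "((\<lambda>y. norm (F y k - F p k - F' p k (y - p)) / norm (y - p)) \<longlongrightarrow> 0) (at p)"
          using der[of p k] by (simp add: has_derivative_iff_norm)
        moreover have "filterlim X (at p) sequentially"
          using X by (auto simp: filterlim_at)
        ultimately have "((\<lambda>i. norm (F (X i) k - F p k - F' p k (X i - p)) / norm (X i - p)) \<longlonglongrightarrow> 0)"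
          by (rule filterlim_compose)
        then show "(\<lambda>i. ?Q (X i) k) \<longlonglongrightarrow> 0"
          by (intro tendsto_norm_zero_cancel[of "\<lambda>i. ?Q (X i) k"]) simp
      qed
      show "AE k in M. norm (?Q (X i) k) \<le> 2 * \<bar>B\<bar>" for i
      proof (rule AE_I2)
        fix k
        have "\<bar>F (X i) k - F p k\<bar> \<le> B * norm (X i - p)" "\<bar>F' p k (X i - p)\<bar> \<le> B * norm (X i - p)"
          using lip[of "X i" k] bnd[of p k] X(1) by auto
        moreover have "B * norm (X i - p) \<le> \<bar>B\<bar> * norm (X i - p)"
          by (simp add: mult_right_mono)
        ultimately have "\<bar>F (X i) k - F p k - F' p k (X i - p)\<bar> \<le> 2 * \<bar>B\<bar> * norm (X i - p)"
          by linarith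
        then show "norm (?Q (X i) k) \<le> 2 * \<bar>B\<bar>"
          using X(1) by (auto simp: divide_simps)
      qed
    qed (auto intro!: borel_measurable_diff borel_measurable_divide)
    then show "((\<lambda>y. \<integral>k. ?Q y k \<partial>M) \<circ> X) \<longlonglongrightarrow> 0" by (simp add: o_def)
  qed
  then have *: "((\<lambda>y. \<integral>k. ?Q y k \<partial>M) \<longlongrightarrow> 0) (at p)"
    by (simp add: at_within_open[of p "ball p 1"])
  have ev: "\<forall>\<^sub>F y in at p. (\<integral>k. ?Q y k \<partial>M) =
      ((\<integral>k. F y k \<partial>M) - (\<integral>k. F p k \<partial>M) - (\<integral>k. F' p k (y - p) \<partial>M)) / norm (y - p)"
  proof -
    have "\<forall>\<^sub>F y in at p. y \<in> ball p 1" by (rule eventually_at_in_open') auto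
    then show ?thesis
      by (rule eventually_mono) (use int int' in \<open>auto simp: Bochner_Integration.integral_diff\<close>)
  qed
  show ?thesis
    unfolding has_derivative_iff_norm
    using tendsto_norm[OF Lim_transform_eventually[OF * ev]] blin by simp
qed

section \<open>Test functions\<close>

definition test_fun :: "(real ^ 'a::finite \<Rightarrow> real) \<Rightarrow> bool" where
  "test_fun f \<longleftrightarrow> smooth f \<and> compactly_supported f"

lemma compactly_supported_iff: "compactly_supported f \<longleftrightarrow> (\<exists>R. \<forall>p. norm p > R \<longrightarrow> f p = 0)"
proof -
  have "compactly_supported f \<longleftrightarrow> bounded {p. f p \<noteq> 0}"
    by (simp add: compactly_supported_def)
  also have "\<dots> \<longleftrightarrow> (\<exists>R. \<forall>p. norm p > R \<longrightarrow> f p = 0)"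
    by (auto simp: bounded_iff) (meson linorder_not_less)+
  finally show ?thesis .
qed

lemma test_fun_smooth: "test_fun f \<Longrightarrow> smooth f"
  by (simp add: test_fun_def)

lemma test_fun_add [intro]: "test_fun f \<Longrightarrow> test_fun g \<Longrightarrow> test_fun (\<lambda>p. f p + g p)"
  unfolding test_fun_def compactly_supported_iff
proof (elim conjE exE, intro conjI smooth_add)
  fix R S assume "\<forall>p. R < norm p \<longrightarrow> f p = 0" "\<forall>p. S < norm p \<longrightarrow> g p = 0"
  then show "\<exists>R. \<forall>p. R < norm p \<longrightarrow> f p + g p = 0" by (intro exI[of _ "max R S"]) auto
qed

lemma test_fun_mult_left [intro]: "smooth f \<Longrightarrow> test_fun g \<Longrightarrow> test_fun (\<lambda>p. f p * g p)"
  unfolding test_fun_def compactly_supported_iff by (auto intro: exI[of _ R for R])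

lemma test_fun_mult_right [intro]: "test_fun f \<Longrightarrow> smooth g \<Longrightarrow> test_fun (\<lambda>p. f p * g p)"
  using test_fun_mult_left[of g f] by (simp add: mult.commute)

lemma test_fun_minus: "test_fun f \<Longrightarrow> test_fun (\<lambda>p. - f p)"
  using test_fun_mult_left[of "\<lambda>_. -1" f] by auto

lemma test_fun_zero: "test_fun (\<lambda>_. 0)"
  by (auto simp: test_fun_def compactly_supported_iff)

lemma test_fun_sum [intro]: "(\<And>i. i \<in> I \<Longrightarrow> test_fun (f i)) \<Longrightarrow> test_fun (\<lambda>q. \<Sum>i\<in>I. f i q)"
  by (induction I rule: infinite_finite_induct) (auto intro: test_fun_zero)

lemma partial_cong_open:
  assumes "open S" "p \<in> S" "\<And>q. q \<in> S \<Longrightarrow> f q = g q"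
  shows "partial a f p = partial a g p"
proof -
  have "isCont (\<lambda>s. p + s *\<^sub>R axis a (1::real)) 0" by (intro continuous_intros)
  then have "\<forall>\<^sub>F s in nhds 0. p + s *\<^sub>R axis a (1::real) \<in> S"
    using assms(1,2) topological_tendstoD[of "\<lambda>s. p + s *\<^sub>R axis a (1::real)" p "nhds 0" S]
    by (simp add: isCont_def tendsto_nhds_iff)
  then have "\<forall>\<^sub>F s in nhds 0. f (p + s *\<^sub>R axis a 1) = g (p + s *\<^sub>R axis a 1)"
    by (rule eventually_mono) (use assms in auto)
  then show ?thesis
    unfolding partial_def by (rule deriv_cong_ev) simp
qed

lemma test_fun_partial:
  assumes "test_fun f" shows "test_fun (partial a f)"
proof -
  obtain R where R: "\<And>p. norm p > R \<Longrightarrow> f p = 0"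
    using assms by (auto simp: test_fun_def compactly_supported_iff)
  have "partial a f p = 0" if "norm p > R" for p
  proof -
    have "open {p :: real ^ 'a. norm p > R}"
      by (intro open_Collect_less continuous_intros)
    then have "partial a f p = partial a (\<lambda>_. 0) p"
      by (rule partial_cong_open) (use that R in auto)
    then show ?thesis by simp
  qed
  then show ?thesis
    using assms by (auto simp: test_fun_def compactly_supported_iff smooth_partial)
qed

lemma test_fun_grad:
  assumes "test_fun f" "\<And>a. smooth (\<lambda>p. v p $ a)"
  shows "test_fun (\<lambda>p. grad f p (v p))"
  unfolding grad_def by (intro test_fun_sum test_fun_mult_left test_fun_partial assms)

lemma test_fun_bounded:
  assumes "test_fun f"
  obtains M where "M \<ge> 0" "\<And>p. \<bar>f p\<bar> \<le> M"
proof -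
  obtain R where R: "\<And>p. norm p > R \<Longrightarrow> f p = 0"
    using assms by (auto simp: test_fun_def compactly_supported_iff)
  have "continuous_on (cball 0 R) f"
    using smooth_continuous[OF test_fun_smooth[OF assms]] continuous_on_subset by blast
  then have "bounded (f ` cball 0 R)"
    by (intro compact_imp_bounded compact_continuous_image) auto
  then obtain M where M: "\<forall>x\<in>f ` cball 0 R. norm x \<le> M"
    unfolding bounded_iff by blast
  then have "\<bar>f p\<bar> \<le> max 0 M" for p
  proof (cases "norm p > R")
    case False
    then have "f p \<in> f ` cball 0 R" by simp
    then have "norm (f p) \<le> M" using M by blast
    then show ?thesis by simp
  qed (simp add: R)
  then show ?thesis using that[of "max 0 M"] by auto
qed

lemma test_fun_bounded_family:
  assumes "\<And>i. test_fun (a i)"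
  shows "\<exists>A. \<forall>i. A i \<ge> 0 \<and> (\<forall>p. \<bar>a i p\<bar> \<le> A i)"
proof (rule choice, rule allI)
  fix i
  show "\<exists>M\<ge>0. \<forall>p. \<bar>a i p\<bar> \<le> M" by (rule test_fun_bounded[OF assms[of i]]) blast
qed

section \<open>The group law and the invariant vector fields\<close>

lemma Rep_ix [simp]: "Rep_idx (ix i) = (i, i)"
  by (simp add: ix_def Abs_idx_inverse)

lemma Rep_iy: "i \<le> j \<Longrightarrow> Rep_idx (iy i j) = (i, j)"
  by (simp add: iy_def Abs_idx_inverse)

lemma ix_eq [simp]: "ix i = ix j \<longleftrightarrow> i = j"
  by (metis Rep_ix prod.inject)

lemma iy_eq [simp]: "i < j \<Longrightarrow> k < l \<Longrightarrow> iy i j = iy k l \<longleftrightarrow> i = k \<and> j = l"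
  by (metis Rep_iy less_imp_le prod.inject)

lemma ix_neq_iy [simp]: "k < l \<Longrightarrow> ix i \<noteq> iy k l" "k < l \<Longrightarrow> iy k l \<noteq> ix i"
  by (metis Rep_ix Rep_iy less_imp_le less_irrefl prod.inject)+

lemma idx_cases:
  obtains (x) i where "a = ix i" | (y) i j where "i < j" "a = iy i j"
proof -
  obtain i j where ij: "Rep_idx a = (i, j)" by (cases "Rep_idx a")
  then have "i \<le> j" using Rep_idx[of a] by auto
  moreover have "a = Abs_idx (i, j)" using ij by (metis Rep_idx_inverse)
  ultimately show ?thesis using x[of i] y[of i j] by (cases "i = j") (auto simp: ix_def iy_def)
qed

definition e_x :: "'n::{finite,linorder} \<Rightarrow> 'n N2" where
  "e_x i = axis (ix i) 1"

text \<open>The basis vectors of the centre, extended antisymmetrically to all pairs of indices; all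
  sums over pairs below then run over the whole index type.\<close>

definition e_y :: "'n::{finite,linorder} \<Rightarrow> 'n \<Rightarrow> 'n N2" where
  "e_y k l = (if k < l then axis (iy k l) 1 else if l < k then - axis (iy l k) 1 else 0)"

text \<open>Half the Lie bracket, so that the group law \<open>p + q + comm_form p q\<close> is the
  Baker-Campbell-Hausdorff formula in step two.\<close>

definition comm_form :: "('n::{finite,linorder}) N2 \<Rightarrow> 'n N2 \<Rightarrow> 'n N2" where
  "comm_form p q = (1/2) *\<^sub>R (\<Sum>k\<in>UNIV. \<Sum>l\<in>UNIV. (p $ ix k * q $ ix l) *\<^sub>R e_y k l)"

lemma e_x_nth [simp]: "e_x i $ ix k = (if k = i then 1 else 0)"
  by (simp add: e_x_def axis_def)

lemma e_y_nth_ix [simp]: "e_y k l $ ix m = 0"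
  by (auto simp: e_y_def axis_def)

lemma axis_iy_nth:
  assumes "i < j" "k < l"
  shows "axis (iy k l) 1 $ iy i j = (if k = i \<and> l = j then 1 else (0::real))"
  using assms unfolding axis_def vec_lambda_beta iy_eq by simp

lemma e_y_nth_iy:
  assumes "i < j"
  shows "e_y k l $ iy i j = (if k = i \<and> l = j then 1 else 0) - (if k = j \<and> l = i then 1 else 0)"
proof (cases k l rule: linorder_cases)
  case less
  then have "\<not> (k = j \<and> l = i)" using assms by (metis less_asym)
  then show ?thesis using less by (simp only: e_y_def axis_iy_nth[OF assms] if_True if_False diff_0_right)
next
  case greater
  then have "\<not> (k = i \<and> l = j)" "\<not> k < l" using assms by (metis less_asym)+
  then show ?thesis using greater
    by (simp only: e_y_def axis_iy_nth[OF assms] if_True if_False vector_uminus_component diff_0 conj_commute)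
next
  case equal
  then have "\<not> (k = i \<and> l = j)" "\<not> (k = j \<and> l = i)" using assms by (metis less_irrefl)+
  with equal show ?thesis by (simp add: e_y_def)
qed

lemma e_y_anti: "e_y l k = - e_y k l"
  by (cases k l rule: linorder_cases) (simp_all add: e_y_def less_not_sym)

lemma comm_form_nth_ix [simp]: "comm_form p q $ ix i = 0"
  by (simp add: comm_form_def)

lemma sum_sum_delta:
  fixes c :: "'a::finite \<Rightarrow> 'a \<Rightarrow> real"
  shows "(\<Sum>k\<in>UNIV. \<Sum>l\<in>UNIV. c k l * (if k = i \<and> l = j then 1 else 0)) = c i j"
proof -
  have "(\<Sum>l\<in>UNIV. c k l * (if k = i \<and> l = j then 1 else 0)) = (if k = i then c k j else 0)" for k
    by (cases "k = i") (simp_all add: if_distrib[of "\<lambda>x. _ * x"] cong: if_cong)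
  then show ?thesis by simp
qed

lemma comm_form_nth_iy:
  assumes "i < j"
  shows "comm_form p q $ iy i j = (p $ ix i * q $ ix j - p $ ix j * q $ ix i) / 2"
proof -
  have "comm_form p q $ iy i j = (1/2) *
     ((\<Sum>k\<in>UNIV. \<Sum>l\<in>UNIV. (p $ ix k * q $ ix l) * (if k = i \<and> l = j then 1 else 0))
    - (\<Sum>k\<in>UNIV. \<Sum>l\<in>UNIV. (p $ ix k * q $ ix l) * (if k = j \<and> l = i then 1 else 0)))"
    using assms by (simp only: comm_form_def e_y_nth_iy vector_scaleR_component sum_component
        real_scaleR_def right_diff_distrib sum_subtractf)
  then show ?thesis by (simp only: sum_sum_delta)
qed

lemma N2_mult_eq: "N2_mult p q = p + q + comm_form p q"
proof (rule vec_eq_iff[THEN iffD2], rule allI)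
  fix a :: "'a idx"
  show "N2_mult p q $ a = (p + q + comm_form p q) $ a"
  proof (cases a rule: idx_cases)
    case (y i j)
    then have "Rep_idx a = (i, j)" "i \<noteq> j" by (simp_all add: Rep_iy less_imp_le)
    then have "N2_mult p q $ a = p $ iy i j + q $ iy i j + (p $ ix i * q $ ix j - p $ ix j * q $ ix i) / 2"
      by (simp only: N2_mult_def vec_lambda_beta prod.case if_False)
    then show ?thesis
      by (simp only: y vector_add_component comm_form_nth_iy[OF y(1)])
  qed (simp add: N2_mult_def)
qed

lemma bilinear_comm_form: "bilinear comm_form"
  unfolding bilinear_def comm_form_def
  by (auto intro!: linearI simp: algebra_simps add_divide_distrib sum.distrib scaleR_sum_right)

interpretation comm_form: bounded_bilinear comm_form
  using bilinear_comm_form bilinear_conv_bounded_bilinear by blast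

lemma comm_form_anti: "comm_form q p = - comm_form p q"
proof -
  have "comm_form q p = (1/2) *\<^sub>R (\<Sum>k\<in>UNIV. \<Sum>l\<in>UNIV. (q $ ix l * p $ ix k) *\<^sub>R e_y l k)"
    unfolding comm_form_def by (subst sum.swap) simp
  moreover have "(q $ ix l * p $ ix k) *\<^sub>R e_y l k = - ((p $ ix k * q $ ix l) *\<^sub>R e_y k l)" for k l
    by (subst e_y_anti) (simp add: mult.commute)
  then have "(1/2) *\<^sub>R (\<Sum>k\<in>UNIV. \<Sum>l\<in>UNIV. (q $ ix l * p $ ix k) *\<^sub>R e_y l k) = - comm_form p q"
    by (simp only: comm_form_def sum_negf scaleR_minus_right)
  ultimately show ?thesis by simp
qed

lemma comm_form_self [simp]: "comm_form p p = 0"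
proof -
  have "2 *\<^sub>R comm_form p p = 0" using comm_form_anti[of p p] by (simp add: scaleR_2)
  then show ?thesis by simp
qed

text \<open>Nilpotency of step two: a bracket has no horizontal component, and
  \<open>comm_form\<close> sees only the horizontal components of its arguments.\<close>

lemma comm_form_nested [simp]: "comm_form (comm_form p q) r = 0" "comm_form r (comm_form p q) = 0"
  by (simp_all add: comm_form_def[of "comm_form p q"] comm_form_def[of _ "comm_form p q"])

lemma comm_form_e_x: "comm_form p (e_x i) = (1/2) *\<^sub>R (\<Sum>k\<in>UNIV. p $ ix k *\<^sub>R e_y k i)"
  by (simp add: comm_form_def if_distrib[of "\<lambda>x. _ * x"] if_distrib[of "\<lambda>x. x *\<^sub>R _"] cong: if_cong)

lemma N2_mult_assoc: "N2_mult (N2_mult p q) r = N2_mult p (N2_mult q r)"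
  by (simp add: N2_mult_eq comm_form.add_left comm_form.add_right)

lemma N2_mult_0 [simp]: "N2_mult p 0 = p" "N2_mult 0 p = p"
  by (simp_all add: N2_mult_eq comm_form.zero_left comm_form.zero_right)

lemma N2_mult_inverse: "N2_mult p (N2_mult (- p) q) = q"
  by (simp add: N2_mult_eq comm_form.add_right comm_form.minus_left comm_form.minus_right comm_form.diff_right)

section \<open>Invariant vector fields and rotations as directional derivatives\<close>

definition left_field :: "'n::{finite,linorder} \<Rightarrow> 'n N2 \<Rightarrow> 'n N2" where
  "left_field i p = e_x i + comm_form p (e_x i)"

definition right_field :: "('n::{finite,linorder}) N2 \<Rightarrow> 'n N2 \<Rightarrow> 'n N2" where
  "right_field v p = v + comm_form v p"

lemma grad_e_y: "grad f p (e_y k l) = (if k < l then dy k l f p else if l < k then - dy l k f p else 0)"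
  by (simp add: e_y_def linear_neg[OF linear_grad] linear_0[OF linear_grad])

lemmas grad_linear_simps = linear_add[OF linear_grad] linear_diff[OF linear_grad]
  linear_cmul[OF linear_grad] linear_sum[OF linear_grad] linear_0[OF linear_grad] linear_neg[OF linear_grad]

lemma sum_split2:
  fixes i :: "'n::{finite,linorder}" and A B :: "'n \<Rightarrow> real"
  shows "(\<Sum>k\<in>UNIV. if k < i then A k else if i < k then B k else 0) = (\<Sum>k\<in>{..<i}. A k) + (\<Sum>k\<in>{i<..}. B k)"
proof -
  have "(\<Sum>k\<in>UNIV. if k < i then A k else if i < k then B k else 0)
    = (\<Sum>k\<in>UNIV. (if k < i then A k else 0) + (if i < k then B k else 0))"
    by (intro sum.cong) auto
  then show ?thesis
    by (simp add: sum.distrib sum.If_cases lessThan_def greaterThan_def)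
qed

lemma X_eq_grad: "X i f p = grad f p (left_field i p)"
proof -
  have "grad f p (comm_form p (e_x i)) = (\<Sum>k\<in>UNIV. if k < i then p $ ix k * dy k i f p
      else if i < k then - (p $ ix k * dy i k f p) else 0) / 2"
    by (simp add: comm_form_e_x grad_linear_simps grad_e_y if_distrib[of "\<lambda>x. _ * x"] cong: if_cong)
  then show ?thesis
    unfolding sum_split2 X_def left_field_def
    by (simp add: grad_linear_simps e_x_def sum_negf)
qed

definition RX :: "('n::{finite,linorder}) N2 \<Rightarrow> ('n N2 \<Rightarrow> real) \<Rightarrow> 'n N2 \<Rightarrow> real" where
  "RX v f p = grad f p (right_field v p)"

text \<open>With \<open>e_y\<close> antisymmetric, the three ranges of \<open>k\<close> in
  \<open>rotation\<close> merge into one sum; its terms for \<open>k = i\<close> and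
  \<open>k = j\<close> vanish.\<close>

definition rot_field :: "'n::{finite,linorder} \<Rightarrow> 'n \<Rightarrow> 'n N2 \<Rightarrow> 'n N2" where
  "rot_field i j p = p $ ix j *\<^sub>R e_x i - p $ ix i *\<^sub>R e_x j
     + (\<Sum>k\<in>UNIV. (p \<bullet> e_y k j) *\<^sub>R e_y k i - (p \<bullet> e_y k i) *\<^sub>R e_y k j)"

lemma inner_e_y: "p \<bullet> e_y k l = (if k < l then p $ iy k l else if l < k then - p $ iy l k else 0)"
  by (simp add: e_y_def inner_axis)

lemma rotation_eq_grad:
  fixes i j :: "'n::{finite,linorder}"
  assumes "i < j"
  shows "rotation i j f p = grad f p (rot_field i j p)"
proof -
  define s where "s k = (p \<bullet> e_y k j) * grad f p (e_y k i) - (p \<bullet> e_y k i) * grad f p (e_y k j)" for k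
  have *: "UNIV = {..<i} \<union> {i<..<j} \<union> {j<..} \<union> {i, j}"
    by (rule set_eqI, simp, metis linorder_less_linear)
  have disj: "({..<i} \<union> {i<..<j} \<union> {j<..}) \<inter> {i, j} = {}"
      "({..<i} \<union> {i<..<j}) \<inter> {j<..} = {}" "{..<i} \<inter> {i<..<j} = {}"
    using assms by auto
  have "sum s UNIV = sum s ({..<i} \<union> {i<..<j} \<union> {j<..} \<union> {i, j})" by (rule arg_cong[OF *])
  also have "\<dots> = sum s {..<i} + sum s {i<..<j} + sum s {j<..} + (s i + s j)"
    using assms by (simp only: sum.union_disjoint[OF _ _ disj(1)] sum.union_disjoint[OF _ _ disj(2)]
        sum.union_disjoint[OF _ _ disj(3)] finite) simp
  also have "s i + s j = 0" using assms by (auto simp: s_def grad_e_y inner_e_y)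
  also have "sum s {..<i} = (\<Sum>k\<in>{..<i}. p $ iy k j * dy k i f p - p $ iy k i * dy k j f p)"
    using assms by (intro sum.cong) (auto simp: s_def grad_e_y inner_e_y)
  also have "sum s {i<..<j} = (\<Sum>k\<in>{i<..<j}. p $ iy i k * dy k j f p - p $ iy k j * dy i k f p)"
    using assms by (intro sum.cong) (auto simp: s_def grad_e_y inner_e_y)
  also have "sum s {j<..} = (\<Sum>k\<in>{j<..}. p $ iy j k * dy i k f p - p $ iy i k * dy j k f p)"
    using assms by (intro sum.cong) (auto simp: s_def grad_e_y inner_e_y)
  finally show ?thesis
    by (simp add: rotation_def rot_field_def grad_linear_simps e_x_def s_def[abs_def])
qed

lemma grad_field:
  assumes f: "smooth f" and W: "(W has_derivative W') (at p)"
  shows "grad (\<lambda>q. grad f q (W q)) p v = grad f p (W' v)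
    + (\<Sum>a\<in>UNIV. \<Sum>b\<in>UNIV. W p $ a * v $ b * partial b (partial a f) p)"
proof -
  have Wa: "((\<lambda>q. W q $ a) has_derivative (\<lambda>v. W' v $ a)) (at p)" for a
    by (rule bounded_linear.has_derivative[OF bounded_linear_vec_nth W])
  have "((\<lambda>q. \<Sum>a\<in>UNIV. W q $ a * partial a f q) has_derivative
      (\<lambda>v. \<Sum>a\<in>UNIV. W p $ a * grad (partial a f) p v + W' v $ a * partial a f p)) (at p)"
    by (intro has_derivative_sum has_derivative_mult Wa smooth_has_derivative smooth_partial f)
  then have "grad (\<lambda>q. grad f q (W q)) p v =
      (\<Sum>a\<in>UNIV. W p $ a * grad (partial a f) p v + W' v $ a * partial a f p)"
    unfolding grad_def[of f, symmetric] by (rule grad_unique[symmetric])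
  then show ?thesis
    by (simp add: sum.distrib grad_def sum_distrib_left mult.assoc)
qed

text \<open>The Hessian contributions cancel by symmetry, which leaves the derivative along the Lie
  bracket of the two vector fields.\<close>

lemma grad_field_commute:
  assumes f: "smooth f" and W: "(W has_derivative W') (at p)" and Z: "(Z has_derivative Z') (at p)"
  shows "grad (\<lambda>q. grad f q (W q)) p (Z p) - grad (\<lambda>q. grad f q (Z q)) p (W p)
    = grad f p (W' (Z p) - Z' (W p))"
proof -
  have "(\<Sum>a\<in>UNIV. \<Sum>b\<in>UNIV. W p $ a * Z p $ b * partial b (partial a f) p)
    = (\<Sum>a\<in>UNIV. \<Sum>b\<in>UNIV. Z p $ a * W p $ b * partial b (partial a f) p)"
    by (subst sum.swap) (simp add: partial_commute[OF f] mult_ac)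
  then show ?thesis
    by (simp add: grad_field[OF f W] grad_field[OF f Z] grad_linear_simps)
qed

lemma has_derivative_left_field:
  "(left_field i has_derivative (\<lambda>v. comm_form v (e_x i))) (at p)"
  unfolding left_field_def
  by (auto intro!: derivative_eq_intros comm_form.FDERIV simp: comm_form.zero_right)

lemma has_derivative_right_field:
  "(right_field w has_derivative comm_form w) (at p)"
  unfolding right_field_def
  by (auto intro!: derivative_eq_intros comm_form.FDERIV simp: comm_form.zero_left)

lemma bounded_linear_rot_field: "bounded_linear (rot_field i j)"
proof -
  have "linear (rot_field i j)"
    by (rule linearI)
      (simp_all add: rot_field_def inner_add_left algebra_simps sum.distrib sum_subtractf scaleR_sum_right)
  then show ?thesis using linear_conv_bounded_linear by blast
qed

lemma smooth_left_field: "smooth (\<lambda>p. left_field i p $ a)"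
  unfolding left_field_def vector_add_component
  by (intro smooth_add smooth_const smooth_linear
      bounded_linear_compose[OF bounded_linear_vec_nth comm_form.bounded_linear_left])

lemma smooth_right_field: "smooth (\<lambda>p. right_field w p $ a)"
  unfolding right_field_def vector_add_component
  by (intro smooth_add smooth_const smooth_linear
      bounded_linear_compose[OF bounded_linear_vec_nth comm_form.bounded_linear_right])

lemma smooth_rot_field: "smooth (\<lambda>p. rot_field i j p $ a)"
  by (intro smooth_linear bounded_linear_compose[OF bounded_linear_vec_nth bounded_linear_rot_field])

definition rot :: "'n::{finite,linorder} \<Rightarrow> 'n \<Rightarrow> ('n N2 \<Rightarrow> real) \<Rightarrow> 'n N2 \<Rightarrow> real" where
  "rot i j f p = grad f p (rot_field i j p)"

lemma X_eq: "X i f = (\<lambda>p. grad f p (left_field i p))"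
  by (simp add: X_eq_grad fun_eq_iff)

lemma RX_eq: "RX i f = (\<lambda>p. grad f p (right_field i p))"
  by (simp add: RX_def fun_eq_iff)

lemma rot_eq: "rot i j f = (\<lambda>p. grad f p (rot_field i j p))"
  by (simp add: rot_def fun_eq_iff)

lemma smooth_X: "smooth f \<Longrightarrow> smooth (X i f)"
  unfolding X_eq by (intro smooth_grad smooth_left_field)

lemma smooth_RX: "smooth f \<Longrightarrow> smooth (RX i f)"
  unfolding RX_eq by (intro smooth_grad smooth_right_field)

lemma test_fun_X: "test_fun f \<Longrightarrow> test_fun (X i f)"
  unfolding X_eq by (intro test_fun_grad smooth_left_field)

lemma test_fun_RX: "test_fun f \<Longrightarrow> test_fun (RX i f)"
  unfolding RX_eq by (intro test_fun_grad smooth_right_field)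

lemma smooth_sublaplacian: "smooth f \<Longrightarrow> smooth (sublaplacian f)"
  unfolding sublaplacian_def[abs_def] by (intro smooth_sum smooth_X)

lemma test_fun_sublaplacian: "test_fun f \<Longrightarrow> test_fun (sublaplacian f)"
  unfolding sublaplacian_def[abs_def] by (intro test_fun_sum test_fun_X)

section \<open>Commutation relations\<close>

text \<open>Infinitesimal form of associativity. In the bracket both terms reduce to
  \<open>comm_form j (e_x i)\<close>, since nested brackets vanish.\<close>

lemma X_RX_commute:
  assumes "smooth f"
  shows "X i (RX j f) p = RX j (X i f) p"
proof -
  have "comm_form j (left_field i p) - comm_form (right_field j p) (e_x i) = 0"
    by (simp add: left_field_def right_field_def comm_form.add_left comm_form.add_right)
  then have "X i (RX j f) p - RX j (X i f) p = 0"
    unfolding X_eq_grad[of i "RX j f"] RX_eq X_eq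
    by (simp add: grad_field_commute[OF assms has_derivative_right_field has_derivative_left_field] grad_linear_simps)
  then show ?thesis by simp
qed

lemma rot_field_e_x:
  "rot_field i j (e_x k) = (if j = k then e_x i else 0) - (if i = k then e_x j else 0)"
proof -
  have "e_x k \<bullet> e_y l m = 0" for l m
    by (simp add: e_x_def inner_commute[of _ "e_y l m"] inner_axis)
  then show ?thesis by (simp add: rot_field_def)
qed

lemma inner_e_y_e_y: "e_y m k \<bullet> e_y l j =
   (if m = l \<and> k = j then 1 else 0) - (if m = j \<and> k = l then 1 else 0)"
proof (cases l j rule: linorder_cases)
  case less
  then show ?thesis by (simp add: inner_e_y e_y_nth_iy)
next
  case greater
  then have "\<not> l < j" by (metis less_asym)
  then show ?thesis using greater by (simp add: inner_e_y e_y_nth_iy)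
qed (simp add: inner_e_y)

lemma sum_if_eq_scaleR:
  fixes v :: "'a::finite \<Rightarrow> 'b::real_vector"
  shows "(\<Sum>l\<in>UNIV. ((if l = m then r else 0) - (if l = k then s else 0)) *\<^sub>R v l) = r *\<^sub>R v m - s *\<^sub>R v k"
  by (simp add: scaleR_diff_left sum_subtractf if_distrib[of "\<lambda>x. x *\<^sub>R _"] cong: if_cong)

text \<open>\<open>e_y m k\<close> transforms like the bivector of \<open>e_x m\<close> and
  \<open>e_x k\<close>: the four terms are the product rule for the action
  \<open>rot_field_e_x\<close> on the two factors.\<close>

lemma rot_field_e_y:
  "rot_field i j (e_y m k) =
     of_bool (k = j) *\<^sub>R e_y m i - of_bool (m = j) *\<^sub>R e_y k i
   - of_bool (k = i) *\<^sub>R e_y m j + of_bool (m = i) *\<^sub>R e_y k j"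
proof -
  have inn: "e_y m k \<bullet> e_y l j = ((if l = m then of_bool (k = j) else 0) - (if l = k then of_bool (m = j) else 0))" for l j
    by (auto simp: inner_e_y_e_y)
  have "rot_field i j (e_y m k) =
     (\<Sum>l\<in>UNIV. (e_y m k \<bullet> e_y l j) *\<^sub>R e_y l i) - (\<Sum>l\<in>UNIV. (e_y m k \<bullet> e_y l i) *\<^sub>R e_y l j)"
    by (simp add: rot_field_def sum_subtractf)
  also have "\<dots> = of_bool (k = j) *\<^sub>R e_y m i - of_bool (m = j) *\<^sub>R e_y k i
      - (of_bool (k = i) *\<^sub>R e_y m j - of_bool (m = i) *\<^sub>R e_y k j)"
    unfolding inn sum_if_eq_scaleR ..
  finally show ?thesis by simp
qed

lemma rot_field_nth_ix: "rot_field i j p $ ix m = p $ ix j * (if m = i then 1 else 0) - p $ ix i * (if m = j then 1 else 0)"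
  by (simp add: rot_field_def)

text \<open>The rotations are derivations of the Lie algebra.\<close>

lemma rot_field_left_field:
  assumes "i \<noteq> j"
  shows "comm_form (rot_field i j p) (e_x k) - rot_field i j (left_field k p) =
    (if i = k then left_field j p else 0) - (if j = k then left_field i p else 0)"
proof -
  interpret rf: bounded_linear "rot_field i j" by (rule bounded_linear_rot_field)
  have "2 *\<^sub>R comm_form (rot_field i j p) (e_x k) = p $ ix j *\<^sub>R e_y i k - p $ ix i *\<^sub>R e_y j k"
    by (simp add: comm_form_e_x rot_field_nth_ix scaleR_diff_left sum_subtractf
        if_distrib[of "\<lambda>x. _ * x"] if_distrib[of "\<lambda>x. x *\<^sub>R _"] cong: if_cong)
  moreover have "2 *\<^sub>R rot_field i j (comm_form p (e_x k)) =
      (\<Sum>m\<in>UNIV. p $ ix m *\<^sub>R (of_bool (k = j) *\<^sub>R e_y m i - of_bool (m = j) *\<^sub>R e_y k i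
        - of_bool (k = i) *\<^sub>R e_y m j + of_bool (m = i) *\<^sub>R e_y k j))"
    by (simp only: comm_form_e_x rf.scaleR rf.sum rot_field_e_y) simp
  moreover have "\<dots> = of_bool (k = j) *\<^sub>R (\<Sum>m\<in>UNIV. p $ ix m *\<^sub>R e_y m i) - p $ ix j *\<^sub>R e_y k i
     - of_bool (k = i) *\<^sub>R (\<Sum>m\<in>UNIV. p $ ix m *\<^sub>R e_y m j) + p $ ix i *\<^sub>R e_y k j"
  proof -
    have "(\<Sum>m\<in>UNIV. p $ ix m *\<^sub>R (of_bool (m = l) *\<^sub>R v)) = p $ ix l *\<^sub>R v" for l :: 'a and v :: "'a N2"
    proof -
      have "p $ ix m *\<^sub>R (of_bool (m = l) *\<^sub>R v) = (if m = l then p $ ix l *\<^sub>R v else 0)" for m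
        by simp
      then show ?thesis by simp
    qed
    then show ?thesis
      by (simp only: scaleR_diff_right scaleR_add_right sum.distrib sum_subtractf
          scaleR_left_commute[of "p $ _"] flip: scaleR_sum_right)
  qed
  moreover have "(\<Sum>m\<in>UNIV. p $ ix m *\<^sub>R e_y m l) = 2 *\<^sub>R comm_form p (e_x l)" for l
    by (simp add: comm_form_e_x)
  ultimately have "2 *\<^sub>R (comm_form (rot_field i j p) (e_x k) - rot_field i j (comm_form p (e_x k))) =
     2 *\<^sub>R (of_bool (k = i) *\<^sub>R comm_form p (e_x j) - of_bool (k = j) *\<^sub>R comm_form p (e_x i))"
    using e_y_anti[of i k] e_y_anti[of j k] by (simp add: scaleR_diff_right)
  then have "comm_form (rot_field i j p) (e_x k) - rot_field i j (comm_form p (e_x k)) =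
     of_bool (k = i) *\<^sub>R comm_form p (e_x j) - of_bool (k = j) *\<^sub>R comm_form p (e_x i)"
    by (simp only: scaleR_cancel_left) simp
  then show ?thesis using assms
    by (auto simp: left_field_def rf.add rot_field_e_x algebra_simps)
qed

lemma rot_X:
  assumes f: "smooth f" and "i \<noteq> j"
  shows "rot i j (X k f) p = X k (rot i j f) p + (if i = k then X j f p else 0) - (if j = k then X i f p else 0)"
proof -
  have "rot i j (X k f) p - X k (rot i j f) p
     = grad f p (comm_form (rot_field i j p) (e_x k) - rot_field i j (left_field k p))"
    unfolding rot_eq X_eq
    by (rule grad_field_commute[OF f has_derivative_left_field
          bounded_linear_imp_has_derivative[OF bounded_linear_rot_field]])
  also have "\<dots> = (if i = k then X j f p else 0) - (if j = k then X i f p else 0)"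
    unfolding rot_field_left_field[OF assms(2)] by (simp add: grad_linear_simps X_eq_grad)
  finally show ?thesis by simp
qed

lemma smooth_rot: "smooth f \<Longrightarrow> smooth (rot i j f)"
  unfolding rot_eq by (intro smooth_grad smooth_rot_field)

lemma X_add: "smooth f \<Longrightarrow> smooth g \<Longrightarrow> X i (\<lambda>p. f p + g p) p = X i f p + X i g p"
  by (simp add: X_eq_grad grad_add smooth_differentiable)

lemma X_mult: "smooth f \<Longrightarrow> smooth g \<Longrightarrow> X i (\<lambda>p. f p * g p) p = f p * X i g p + g p * X i f p"
  by (simp add: X_eq_grad grad_mult smooth_differentiable)

lemma X_const [simp]: "X i (\<lambda>_. c) p = 0"
  by (simp add: X_eq_grad grad_def)

lemma X_cmult: "smooth f \<Longrightarrow> X i (\<lambda>p. c * f p) p = c * X i f p"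
  by (subst X_mult) auto

lemma X_minus: "smooth f \<Longrightarrow> X i (\<lambda>p. - f p) p = - X i f p"
  using X_cmult[of f i "-1" p] by simp

lemma X_diff: "smooth f \<Longrightarrow> smooth g \<Longrightarrow> X i (\<lambda>p. f p - g p) p = X i f p - X i g p"
  using X_add[of f "\<lambda>p. - g p" i p] by (auto simp: X_minus)

lemma RX_add: "smooth f \<Longrightarrow> smooth g \<Longrightarrow> RX i (\<lambda>p. f p + g p) p = RX i f p + RX i g p"
  by (simp add: RX_def grad_add smooth_differentiable)

lemma RX_const [simp]: "RX i (\<lambda>_. c) p = 0"
  by (simp add: RX_def grad_def)

lemma RX_sum: "(\<And>k. k \<in> I \<Longrightarrow> smooth (f k)) \<Longrightarrow> RX i (\<lambda>p. \<Sum>k\<in>I. f k p) p = (\<Sum>k\<in>I. RX i (f k) p)"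
  by (induction I rule: infinite_finite_induct) (auto simp: RX_add smooth_sum)

lemma rot_add: "smooth f \<Longrightarrow> smooth g \<Longrightarrow> rot i j (\<lambda>p. f p + g p) p = rot i j f p + rot i j g p"
  by (simp add: rot_def grad_add smooth_differentiable)

lemma rot_const [simp]: "rot i j (\<lambda>_. c) p = 0"
  by (simp add: rot_def grad_def)

lemma rot_minus: "smooth f \<Longrightarrow> rot i j (\<lambda>p. - f p) p = - rot i j f p"
  using grad_mult[of "\<lambda>_. -1" p f] by (simp add: rot_def smooth_differentiable grad_def)

lemma rot_sum: "(\<And>k. k \<in> I \<Longrightarrow> smooth (f k)) \<Longrightarrow> rot i j (\<lambda>p. \<Sum>k\<in>I. f k p) p = (\<Sum>k\<in>I. rot i j (f k) p)"
  by (induction I rule: infinite_finite_induct) (auto simp: rot_add smooth_sum)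

text \<open>Commuting the rotation past the two factors of \<open>X k (X k f)\<close> produces
  \<open>X i (X j f)\<close> and \<open>X j (X i f)\<close>, each once with either sign; they cancel
  after summation over \<open>k\<close>.\<close>

lemma rot_sublaplacian:
  assumes f: "smooth f" and "i \<noteq> j"
  shows "rot i j (sublaplacian f) p = sublaplacian (rot i j f) p"
proof -
  have XX: "X k (rot i j (X k f)) p = X k (X k (rot i j f)) p
      + (if i = k then X k (X j f) p else 0) - (if j = k then X k (X i f) p else 0)" for k
  proof -
    have "rot i j (X k f) = (\<lambda>p. X k (rot i j f) p + ((if i = k then X j f p else 0) - (if j = k then X i f p else 0)))"
      by (simp add: rot_X[OF assms] fun_eq_iff)
    moreover have "smooth (\<lambda>p. (if i = k then X j f p else 0))" "smooth (\<lambda>p. (if j = k then X i f p else 0))"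
      using f by (cases "i = k"; cases "j = k"; simp add: smooth_X smooth_const)+
    ultimately show ?thesis
      using f by (cases "i = k"; cases "j = k") (simp_all add: X_add X_diff X_minus smooth_X smooth_rot smooth_diff)
  qed
  have "rot i j (sublaplacian f) p = (\<Sum>k\<in>UNIV. rot i j (X k (X k f)) p)"
    unfolding sublaplacian_def[abs_def] by (intro rot_sum smooth_X f)
  also have "\<dots> = (\<Sum>k\<in>UNIV. X k (X k (rot i j f)) p
      + (if i = k then X k (X j f) p else 0) - (if j = k then X k (X i f) p else 0)
      + (if i = k then X j (X k f) p else 0) - (if j = k then X i (X k f) p else 0))"
    by (simp add: rot_X[OF smooth_X[OF f] assms(2)] XX)
  also have "\<dots> = sublaplacian (rot i j f) p"
    by (simp add: sublaplacian_def sum.distrib sum_subtractf)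
  finally show ?thesis .
qed

lemma RX_sublaplacian:
  assumes f: "smooth f"
  shows "RX i (sublaplacian f) p = sublaplacian (RX i f) p"
proof -
  have "RX i (sublaplacian f) p = (\<Sum>k\<in>UNIV. RX i (X k (X k f)) p)"
    unfolding sublaplacian_def[abs_def] by (intro RX_sum smooth_X f)
  also have "\<dots> = (\<Sum>k\<in>UNIV. X k (X k (RX i f)) p)"
  proof -
    have "RX i (X k g) = X k (RX i g)" if "smooth g" for g k
      using X_RX_commute[OF that] by (simp add: fun_eq_iff)
    then show ?thesis using f by (simp add: smooth_X)
  qed
  finally show ?thesis by (simp add: sublaplacian_def)
qed

section \<open>The carre du champ and the diffusion property\<close>

definition Gam :: "(('n::{finite,linorder}) N2 \<Rightarrow> real) \<Rightarrow> ('n N2 \<Rightarrow> real) \<Rightarrow> 'n N2 \<Rightarrow> real" where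
  "Gam f h p = (\<Sum>i\<in>UNIV. X i f p * X i h p)"

lemma smooth_Gam: "smooth f \<Longrightarrow> smooth h \<Longrightarrow> smooth (Gam f h)"
  unfolding Gam_def[abs_def] by (intro smooth_sum smooth_mult smooth_X)

lemma test_fun_Gam: "test_fun f \<Longrightarrow> smooth h \<Longrightarrow> test_fun (Gam f h)"
  unfolding Gam_def[abs_def] by (intro test_fun_sum test_fun_mult_right smooth_X test_fun_X)

lemma Gam_nonneg: "Gam f f p \<ge> 0"
  by (simp add: Gam_def sum_nonneg)

lemma sublaplacian_const [simp]: "sublaplacian (\<lambda>_. c) p = 0"
proof -
  have "X i (\<lambda>_. c) = (\<lambda>_. 0)" for i :: 'a by (simp add: fun_eq_iff)
  then show ?thesis by (simp add: sublaplacian_def)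
qed

lemma sublaplacian_add:
  assumes "smooth f" "smooth h"
  shows "sublaplacian (\<lambda>p. f p + h p) p = sublaplacian f p + sublaplacian h p"
proof -
  have "X i (\<lambda>p. f p + h p) = (\<lambda>p. X i f p + X i h p)" for i
    using assms by (simp add: fun_eq_iff X_add)
  then show ?thesis
    using assms by (simp add: sublaplacian_def X_add smooth_X sum.distrib)
qed

lemma sublaplacian_mult:
  assumes "smooth f" "smooth h"
  shows "sublaplacian (\<lambda>p. f p * h p) p = f p * sublaplacian h p + h p * sublaplacian f p + 2 * Gam f h p"
proof -
  have "X i (\<lambda>p. f p * h p) = (\<lambda>p. f p * X i h p + h p * X i f p)" for i
    using assms by (simp add: fun_eq_iff X_mult)
  then show ?thesis
    using assms by (simp add: sublaplacian_def X_add X_mult smooth_X smooth_mult Gam_def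
        sum.distrib sum_distrib_left algebra_simps)
qed

lemma sublaplacian_cmult: "smooth f \<Longrightarrow> sublaplacian (\<lambda>p. c * f p) p = c * sublaplacian f p"
  by (subst sublaplacian_mult) (auto simp: Gam_def)

lemma sublaplacian_minus: "smooth f \<Longrightarrow> sublaplacian (\<lambda>p. - f p) p = - sublaplacian f p"
  using sublaplacian_cmult[of f "-1" p] by simp

lemma sublaplacian_diff:
  "smooth f \<Longrightarrow> smooth h \<Longrightarrow> sublaplacian (\<lambda>p. f p - h p) p = sublaplacian f p - sublaplacian h p"
  using sublaplacian_add[of f "\<lambda>p. - h p" p] by (auto simp: sublaplacian_minus)

lemma sublaplacian_sum:
  "(\<And>i. i \<in> I \<Longrightarrow> smooth (f i)) \<Longrightarrow> sublaplacian (\<lambda>p. \<Sum>i\<in>I. f i p) p = (\<Sum>i\<in>I. sublaplacian (f i) p)"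
  by (induction I rule: infinite_finite_induct) (auto simp: sublaplacian_add smooth_sum)

lemma carre_du_champ_eq: "smooth f \<Longrightarrow> smooth h \<Longrightarrow> carre_du_champ f h = Gam f h"
  by (simp add: carre_du_champ_def fun_eq_iff sublaplacian_mult)

lemma X_chain:
  assumes "smooth f" "(\<phi> has_real_derivative d) (at (f p))"
  shows "X i (\<lambda>q. \<phi> (f q)) p = d * X i f p"
  using grad_chain(2)[OF smooth_differentiable[OF assms(1)] assms(2)] by (simp add: X_eq_grad)

text \<open>The derivatives of \<phi> are required only at values of \<open>f\<close>, so that
  \<phi> may involve a logarithm when \<open>f\<close> stays in its domain.\<close>

lemma sublaplacian_chain:
  assumes f: "smooth f"
    and 1: "\<And>q. (\<phi> has_real_derivative \<phi>1 (f q)) (at (f q))"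
    and 2: "\<And>q. (\<phi>1 has_real_derivative \<phi>2 (f q)) (at (f q))"
  shows "sublaplacian (\<lambda>q. \<phi> (f q)) p = \<phi>1 (f p) * sublaplacian f p + \<phi>2 (f p) * Gam f f p"
proof -
  have X1: "X i (\<lambda>q. \<phi> (f q)) = (\<lambda>q. \<phi>1 (f q) * X i f q)" for i
    using X_chain[OF f 1] by (simp add: fun_eq_iff)
  have "X i (\<lambda>q. \<phi>1 (f q) * X i f q) p = \<phi>1 (f p) * X i (X i f) p + \<phi>2 (f p) * (X i f p * X i f p)" for i
  proof -
    note d = grad_chain[OF smooth_differentiable[OF f] 2]
    have "grad (\<lambda>q. \<phi>1 (f q) * X i f q) p (left_field i p) =
      \<phi>1 (f p) * grad (X i f) p (left_field i p) + grad (\<lambda>q. \<phi>1 (f q)) p (left_field i p) * X i f p"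
      by (rule grad_mult[OF d(1) smooth_differentiable[OF smooth_X[OF f]]])
    then show ?thesis
      unfolding X_eq_grad[of i "\<lambda>q. \<phi>1 (f q) * X i f q"]
      by (simp add: d(2) X_eq_grad)
  qed
  then show ?thesis
    by (simp add: sublaplacian_def X1 Gam_def sum.distrib sum_distrib_left)
qed

section \<open>Radial functions\<close>

definition rot_invariant :: "(('n::{finite,linorder}) N2 \<Rightarrow> real) \<Rightarrow> bool" where
  "rot_invariant f \<longleftrightarrow> (\<forall>i j p. i < j \<longrightarrow> rot i j f p = 0)"

lemma radial_imp_rot_invariant: "radial f \<Longrightarrow> rot_invariant f"
  by (simp add: radial_def rot_invariant_def rot_def rotation_eq_grad)

lemma rot_field_swap: "rot_field j i p = - rot_field i j p"
  by (simp add: rot_field_def sum_subtractf)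

lemma rot_field_same: "rot_field i i p = 0"
  by (simp add: rot_field_def)

text \<open>Contracting the rotational invariance relation with the antisymmetric matrix
  \<open>g (e_y j i)\<close> kills the central terms and leaves the scalar product of the
  horizontal gradient with the difference of the left and right invariant fields.\<close>

lemma rot_invariant_orthogonal:
  fixes g :: "('n::{finite,linorder}) N2 \<Rightarrow> real"
  assumes g: "linear g" and inv: "\<And>i j. i < j \<Longrightarrow> g (rot_field i j p) = 0"
  shows "(\<Sum>i\<in>UNIV. g (e_x i) * g (comm_form p (e_x i))) = 0"
proof -
  interpret linear g by (rule g)
  define x a where "x i = p $ ix i" and "a i = g (e_x i)" for i
  define y A where "y i j = p \<bullet> e_y i j" and "A i j = g (e_y i j)" for i j
  have anti: "y j i = - y i j" "A j i = - A i j" for i j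
    using e_y_anti[of j i] by (simp_all add: y_def A_def neg)
  have inv': "g (rot_field i j p) = 0" for i j
    using inv[of i j] inv[of j i] rot_field_swap[of j i p]
    by (cases i j rule: linorder_cases) (simp_all add: neg rot_field_same)
  have R: "x j * a i - x i * a j + (\<Sum>k\<in>UNIV. y k j * A k i - y k i * A k j) = 0" for i j
    using inv'[of i j] by (simp add: rot_field_def add diff sum scale x_def a_def y_def A_def)
  define S where "S = (\<Sum>i\<in>UNIV. \<Sum>j\<in>UNIV. x j * A j i * a i)"
  \<comment> \<open>Exchanging \<open>j\<close> and \<open>k\<close> changes the sign:
    \<open>y k j\<close> is antisymmetric in these indices, while \<open>A j i * A k i\<close> is
    symmetric.\<close>
  have sym: "(\<Sum>i\<in>UNIV. \<Sum>j\<in>UNIV. \<Sum>k\<in>UNIV. A j i * (y k j * A k i)) = 0" (is "?T = 0")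
  proof -
    have "?T = (\<Sum>i\<in>UNIV. \<Sum>k\<in>UNIV. \<Sum>j\<in>UNIV. A j i * (y k j * A k i))"
      by (intro sum.cong refl sum.swap)
    also have "\<dots> = (\<Sum>i\<in>UNIV. \<Sum>k\<in>UNIV. \<Sum>j\<in>UNIV. - (A k i * (y j k * A j i)))"
      by (intro sum.cong refl) (subst anti(1), simp)
    also have "\<dots> = - ?T" by (simp add: sum_negf)
    finally show ?thesis by simp
  qed
  have sym': "(\<Sum>i\<in>UNIV. \<Sum>j\<in>UNIV. \<Sum>k\<in>UNIV. A j i * (y k i * A k j)) = 0"
  proof -
    have "(\<Sum>i\<in>UNIV. \<Sum>j\<in>UNIV. \<Sum>k\<in>UNIV. A j i * (y k i * A k j))
        = (\<Sum>j\<in>UNIV. \<Sum>i\<in>UNIV. \<Sum>k\<in>UNIV. A j i * (y k i * A k j))" by (rule sum.swap)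
    also have "\<dots> = (\<Sum>i\<in>UNIV. \<Sum>j\<in>UNIV. \<Sum>k\<in>UNIV. - (A j i * (y k j * A k i)))"
      by (intro sum.cong refl) (subst anti(2), simp)
    finally show ?thesis using sym by (simp add: sum_negf)
  qed
  have S': "(\<Sum>i\<in>UNIV. \<Sum>j\<in>UNIV. A j i * (x i * a j)) = - S"
  proof -
    have "(\<Sum>i\<in>UNIV. \<Sum>j\<in>UNIV. A j i * (x i * a j)) = (\<Sum>j\<in>UNIV. \<Sum>i\<in>UNIV. A j i * (x i * a j))"
      by (rule sum.swap)
    also have "\<dots> = (\<Sum>i\<in>UNIV. \<Sum>j\<in>UNIV. - (x j * A j i * a i))"
      by (intro sum.cong refl) (subst anti(2), simp)
    finally show ?thesis by (simp add: S_def sum_negf)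
  qed
  have "0 = (\<Sum>i\<in>UNIV. \<Sum>j\<in>UNIV. A j i *
      (x j * a i - x i * a j + (\<Sum>k\<in>UNIV. y k j * A k i - y k i * A k j)))"
    by (simp add: R)
  also have "\<dots> = S - (\<Sum>i\<in>UNIV. \<Sum>j\<in>UNIV. A j i * (x i * a j))
      + ((\<Sum>i\<in>UNIV. \<Sum>j\<in>UNIV. \<Sum>k\<in>UNIV. A j i * (y k j * A k i))
       - (\<Sum>i\<in>UNIV. \<Sum>j\<in>UNIV. \<Sum>k\<in>UNIV. A j i * (y k i * A k j)))"
    by (simp add: S_def distrib_left right_diff_distrib sum_distrib_left sum.distrib sum_subtractf mult_ac)
  also have "\<dots> = 2 * S" by (simp add: sym sym' S')
  finally have "S = 0" by simp
  moreover have "(\<Sum>i\<in>UNIV. g (e_x i) * g (comm_form p (e_x i))) = S / 2"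
    by (simp add: comm_form_e_x scale sum S_def x_def a_def A_def sum_distrib_left sum_divide_distrib mult_ac)
  ultimately show ?thesis by simp
qed

text \<open>The left and right fields at \<open>p\<close> are \<open>e_x i\<close> plus and minus
  \<open>comm_form p (e_x i)\<close>. The difference of the two sums of squares is therefore four
  times the scalar product in \<open>rot_invariant_orthogonal\<close>.\<close>

lemma Gam_rot_invariant_diag:
  assumes "rot_invariant f"
  shows "Gam f f p = (\<Sum>i\<in>UNIV. RX (e_x i) f p * RX (e_x i) f p)"
proof -
  have "(\<Sum>i\<in>UNIV. grad f p (e_x i) * grad f p (comm_form p (e_x i))) = 0"
    using assms by (intro rot_invariant_orthogonal linear_grad) (simp add: rot_invariant_def rot_def)
  then have "Gam f f p - (\<Sum>i\<in>UNIV. RX (e_x i) f p * RX (e_x i) f p) = 4 * 0"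
    by (simp add: Gam_def X_eq_grad RX_def left_field_def right_field_def grad_linear_simps comm_form_anti[of "e_x _" p]
       algebra_simps sum.distrib sum_subtractf flip: sum_distrib_left)
  then show ?thesis by simp
qed

text \<open>Polarisation: the diagonal identity for the rotation invariant function
  \<open>f + h\<close>.\<close>

lemma Gam_rot_invariant:
  assumes "smooth f" "smooth h" "rot_invariant f" "rot_invariant h"
  shows "Gam f h p = (\<Sum>i\<in>UNIV. RX (e_x i) f p * RX (e_x i) h p)"
proof -
  have "rot_invariant (\<lambda>p. f p + h p)"
    using assms by (simp add: rot_invariant_def rot_add)
  from Gam_rot_invariant_diag[OF this, of p] have
    "Gam f f p + 2 * Gam f h p + Gam h h p =
      (\<Sum>i\<in>UNIV. RX (e_x i) f p * RX (e_x i) f p) + 2 * (\<Sum>i\<in>UNIV. RX (e_x i) f p * RX (e_x i) h p) + (\<Sum>i\<in>UNIV. RX (e_x i) h p * RX (e_x i) h p)"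
    using assms(1,2) by (simp add: Gam_def X_add RX_add algebra_simps sum.distrib flip: sum_distrib_left)
  then show ?thesis using Gam_rot_invariant_diag[OF assms(3)] Gam_rot_invariant_diag[OF assms(4)] by simp
qed

lemma rot_invariant_sublaplacian:
  "smooth f \<Longrightarrow> rot_invariant f \<Longrightarrow> rot_invariant (sublaplacian f)"
  unfolding rot_invariant_def
proof (intro allI impI)
  fix i j :: 'a and p
  assume "smooth f" "\<forall>i j p. i < j \<longrightarrow> rot i j f p = 0" "i < j"
  moreover from this have "rot i j f = (\<lambda>_. 0)" "i \<noteq> j" by auto
  ultimately show "rot i j (sublaplacian f) p = 0" by (simp add: rot_sublaplacian)
qed

text \<open>Each square \<open>u * u\<close> with \<open>u = RX (e_x i) f\<close> contributes
  \<open>2 * u * \<Delta> u + 2 * Gam u u\<close> to \<Delta> of \<Gamma>. The first terms are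
  exactly \<open>2 * Gam f (\<Delta> f)\<close>, as \<open>\<Delta> f\<close> is again rotation
  invariant and \<open>RX\<close> commutes with \<Delta>.\<close>

lemma Gamma_two_eq:
  assumes f: "smooth f" and inv: "rot_invariant f"
  shows "Gamma_two f p = (\<Sum>i\<in>UNIV. Gam (RX (e_x i) f) (RX (e_x i) f) p)"
proof -
  note sm = smooth_RX[OF f] smooth_sublaplacian[OF f]
  have "carre_du_champ f f = (\<lambda>q. \<Sum>i\<in>UNIV. RX (e_x i) f q * RX (e_x i) f q)"
    using carre_du_champ_eq[OF f f] Gam_rot_invariant_diag[OF inv] by (simp add: fun_eq_iff)
  then have "sublaplacian (carre_du_champ f f) p =
     (\<Sum>i\<in>UNIV. 2 * (RX (e_x i) f p * sublaplacian (RX (e_x i) f) p) + 2 * Gam (RX (e_x i) f) (RX (e_x i) f) p)"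
    by (simp add: sublaplacian_sum smooth_mult sm sublaplacian_mult)
  moreover have "carre_du_champ f (sublaplacian f) p = (\<Sum>i\<in>UNIV. RX (e_x i) f p * sublaplacian (RX (e_x i) f) p)"
    using Gam_rot_invariant[OF f sm(2) inv rot_invariant_sublaplacian[OF f inv], of p]
    by (simp add: carre_du_champ_eq[OF f sm(2)] RX_sublaplacian[OF f])
  ultimately show ?thesis
    by (simp add: Gamma_two_def sum.distrib flip: sum_distrib_left)
qed

lemma Gamma_two_nonneg: "smooth f \<Longrightarrow> rot_invariant f \<Longrightarrow> Gamma_two f p \<ge> 0"
  by (simp add: Gamma_two_eq sum_nonneg Gam_nonneg)

section \<open>The maximum principle\<close>

text \<open>The integral curves of \<open>X i\<close> are straight lines, again because nested
  brackets vanish; calculus along \<open>X i\<close> is thus one-dimensional calculus on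
  lines.\<close>

lemma left_field_line: "left_field i (p + s *\<^sub>R left_field i p) = left_field i p"
  by (simp add: left_field_def comm_form.add_left comm_form.scaleR_left)

lemma DERIV_left_line:
  assumes "smooth f"
  shows "((\<lambda>s. f (p + s *\<^sub>R left_field i p)) has_real_derivative X i f (p + s *\<^sub>R left_field i p)) (at s)"
  using DERIV_along[OF smooth_differentiable[OF assms], where p = p and s = s and v = "left_field i p"]
  by (simp add: X_eq_grad left_field_line)

lemma second_derivative_at_max:
  fixes h :: "real \<Rightarrow> real"
  assumes h: "\<And>s. (h has_real_derivative h' s) (at s)" and h': "(h' has_real_derivative d) (at 0)"
    and max: "\<And>s. h s \<le> h 0"
  shows "d \<le> 0"
proof (rule ccontr)
  assume "\<not> d \<le> 0"
  then obtain e where e: "e > 0" "\<And>s. s > 0 \<Longrightarrow> s < e \<Longrightarrow> h' 0 < h' (0 + s)"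
    using DERIV_pos_inc_right[OF h'] by auto
  have "h' 0 = 0" by (rule DERIV_local_max[OF h, of 1]) (auto simp: max)
  obtain z where z: "z > 0" "z < e / 2" "h (e / 2) - h 0 = (e / 2 - 0) * h' z"
    using MVT2[of 0 "e / 2" h h'] h e(1) by auto
  then have "h' z > 0" using e(2)[of z] \<open>h' 0 = 0\<close> by simp
  then have "h (e / 2) - h 0 > 0" unfolding z(3) using e(1) by simp
  then show False using max[of "e / 2"] by simp
qed

lemma sublaplacian_at_max:
  assumes f: "smooth f" and max: "\<And>q. f q \<le> f p"
  shows "sublaplacian f p \<le> 0"
  unfolding sublaplacian_def
proof (rule sum_nonpos)
  fix i
  show "X i (X i f) p \<le> 0"
    by (rule second_derivative_at_max[OF DERIV_left_line[OF f]])
      (use DERIV_left_line[OF smooth_X[OF f], of i p i 0] max in auto)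
qed

section \<open>Growth control and the parabolic maximum principle\<close>

text \<open>The fields \<open>left_field i\<close> grow at most linearly, hence \<Delta> of
  \<open>weight\<close> squared is at most a multiple of itself. Comparison functions may grow like
  \<open>weight\<close>, and its square beats them at infinity.\<close>

definition weight :: "('n::{finite,linorder}) N2 \<Rightarrow> real" where
  "weight p = 1 + p \<bullet> p"

lemma smooth_weight: "smooth weight"
proof -
  have "p \<bullet> p = (\<Sum>a\<in>UNIV. p $ a * p $ a)" for p :: "'a N2" by (simp add: inner_vec_def)
  then show ?thesis unfolding weight_def[abs_def] by (auto intro!: smooth_add smooth_sum smooth_mult smooth_nth)
qed

lemma weight_ge_1: "weight p \<ge> 1"
  by (simp add: weight_def)

lemma X_weight: "X i weight p = 2 * (p \<bullet> left_field i p)"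
proof -
  have "(weight has_derivative (\<lambda>v. 2 * (p \<bullet> v))) (at p)"
    unfolding weight_def[abs_def] by (auto intro!: derivative_eq_intros simp: inner_commute)
  then show ?thesis unfolding X_eq_grad by (rule grad_unique[symmetric])
qed

lemma XX_weight: "X i (X i weight) p = 2 * (left_field i p \<bullet> left_field i p)"
proof -
  have "((\<lambda>s. X i weight (p + s *\<^sub>R left_field i p)) has_real_derivative X i (X i weight) p) (at 0)"
    using DERIV_left_line[OF smooth_X[OF smooth_weight], of i p i 0] by simp
  moreover have "((\<lambda>s. X i weight (p + s *\<^sub>R left_field i p)) has_real_derivative
      2 * (left_field i p \<bullet> left_field i p)) (at 0)"
  proof -
    have "X i weight (p + s *\<^sub>R left_field i p) =
        2 * (p \<bullet> left_field i p + s * (left_field i p \<bullet> left_field i p))" for s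
      by (simp add: X_weight left_field_line inner_add_left)
    then show ?thesis by (auto intro!: derivative_eq_intros)
  qed
  ultimately show ?thesis by (rule DERIV_unique)
qed

lemma left_field_bound:
  obtains C where "C \<ge> 0"
    "\<And>i p. left_field i (p :: ('n::{finite,linorder}) N2) \<bullet> left_field i p \<le> C * weight p"
proof -
  obtain K where K: "K > 0" "\<And>p q :: 'n N2. norm (comm_form p q) \<le> norm p * norm q * K"
    using comm_form.pos_bounded by blast
  have "left_field i p \<bullet> left_field i p \<le> (2 + 2 * K\<^sup>2) * weight p" for i and p :: "'n N2"
  proof -
    have n: "norm (e_x i) = 1" by (simp add: e_x_def)
    have "norm (left_field i p) \<le> 1 + K * norm p"
      unfolding left_field_def using norm_triangle_ineq[of "e_x i" "comm_form p (e_x i)"] K(2)[of p "e_x i"] n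
      by (simp add: mult.commute)
    then have "(norm (left_field i p))\<^sup>2 \<le> (1 + K * norm p)\<^sup>2" by (simp add: power_mono)
    also have "\<dots> \<le> 2 + 2 * K\<^sup>2 * (norm p)\<^sup>2"
      using sum_squares_bound[of 1 "K * norm p"] by (simp add: power2_sum power_mult_distrib)
    also have "\<dots> \<le> (2 + 2 * K\<^sup>2) * weight p"
      unfolding weight_def power2_norm_eq_inner[symmetric] by (simp add: distrib_left distrib_right)
    finally show ?thesis by (simp add: power2_norm_eq_inner)
  qed
  then show ?thesis using that[of "2 + 2 * K\<^sup>2"] by (simp add: add_nonneg_nonneg)
qed

lemma sublaplacian_weight_bound:
  obtains C where "C > 0"
    "\<And>p. sublaplacian (\<lambda>q. weight q * weight q) (p :: ('n::{finite,linorder}) N2) \<le> C * (weight p * weight p)"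
proof -
  obtain C where C: "C \<ge> 0" "\<And>i p. left_field i (p :: 'n N2) \<bullet> left_field i p \<le> C * weight p"
    using left_field_bound by blast
  define N where "N = real CARD('n)"
  \<comment> \<open>The \<open>12\<close> is \<open>2 * 2\<close> from
    \<open>weight * \<Delta> weight\<close> plus \<open>2 * 4\<close> from
    \<open>Gam weight weight\<close>; adding \<open>1\<close> makes the constant positive even if
    \<open>C = 0\<close>.\<close>
  have "sublaplacian (\<lambda>q. weight q * weight q) p \<le> (12 * N * C + 1) * (weight p * weight p)" for p :: "'n N2"
  proof -
    have "sublaplacian weight p \<le> N * (2 * C * weight p)"
      unfolding sublaplacian_def XX_weight N_def
      by (rule sum_bounded_above) (use C(2)[of _ p] in \<open>simp add: mult.assoc\<close>)
    then have "weight p * sublaplacian weight p \<le> weight p * (N * (2 * C * weight p))"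
      using weight_ge_1[of p] by (intro mult_left_mono) auto
    then have 1: "weight p * sublaplacian weight p \<le> 2 * (N * C * (weight p * weight p))"
      by (simp only: mult_ac)
    have "X i weight p * X i weight p \<le> 4 * C * (weight p * weight p)" for i
    proof -
      have "X i weight p * X i weight p = 4 * (p \<bullet> left_field i p)\<^sup>2"
        by (simp add: X_weight power2_eq_square)
      also have "\<dots> \<le> 4 * ((p \<bullet> p) * (left_field i p \<bullet> left_field i p))"
        by (simp add: Cauchy_Schwarz_ineq)
      also have "\<dots> \<le> 4 * (weight p * (C * weight p))"
        using C(2) by (intro mult_left_mono mult_mono) (auto simp: weight_def)
      finally show ?thesis by (simp add: mult_ac)
    qed
    then have "Gam weight weight p \<le> N * (4 * C * (weight p * weight p))"
      unfolding Gam_def N_def by (intro sum_bounded_above)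
    then have 2: "Gam weight weight p \<le> 4 * (N * C * (weight p * weight p))"
      by (simp only: mult_ac)
    have "0 \<le> weight p * weight p" by simp
    moreover have "sublaplacian (\<lambda>q. weight q * weight q) p = 2 * (weight p * sublaplacian weight p) + 2 * Gam weight weight p"
      by (simp add: sublaplacian_mult[OF smooth_weight smooth_weight])
    moreover have "(12 * N * C + 1) * (weight p * weight p) = 12 * (N * C * (weight p * weight p)) + weight p * weight p"
      by (simp add: distrib_right)
    ultimately show ?thesis using 1 2 by linarith
  qed
  moreover have "12 * N * C + 1 > 0" using C(1) by (simp add: N_def add_nonneg_pos)
  ultimately show ?thesis using that by blast
qed

text \<open>A function violating the bound would, after subtracting a small multiple of the supersolution
  \<open>exp ((C + 1) t) * (weight p)\<^sup>2\<close>, attain a positive maximum.\<close>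

lemma maximum_principle:
  fixes W D :: "real \<Rightarrow> ('n::{finite,linorder}) N2 \<Rightarrow> real"
  assumes cont: "continuous_on ({0..T} \<times> UNIV) (\<lambda>(t, p). W t p)"
    and growth: "\<And>t p. 0 \<le> t \<Longrightarrow> t \<le> T \<Longrightarrow> W t p \<le> B * weight p"
    and init: "\<And>p. W 0 p \<le> 0"
    and sm: "\<And>t. 0 < t \<Longrightarrow> t \<le> T \<Longrightarrow> smooth (W t)"
    and deriv: "\<And>t p. 0 < t \<Longrightarrow> t \<le> T \<Longrightarrow> ((\<lambda>s. W s p) has_real_derivative D t p) (at t)"
    and ineq: "\<And>t p. 0 < t \<Longrightarrow> t \<le> T \<Longrightarrow> D t p \<le> sublaplacian (W t) p"
    and t: "0 \<le> t" "t \<le> T"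
  shows "W t p \<le> 0"
proof (rule ccontr)
  assume "\<not> W t p \<le> 0"
  then have pos: "W t p > 0" by simp
  obtain C where C: "C > 0"
    "\<And>p. sublaplacian (\<lambda>q. weight q * weight q) (p :: 'n N2) \<le> C * (weight p * weight p)"
    using sublaplacian_weight_bound by blast
  define w where "w q = weight q * weight q" for q :: "'n N2"
  have w: "smooth w" "w q > 0" for q
    using weight_ge_1[of q] by (auto simp: w_def[abs_def] smooth_weight)
  \<comment> \<open>Chosen so that the subtracted supersolution equals half of \<open>W t p\<close>
    at \<open>(t, p)\<close>, which keeps \<open>V t p\<close> positive.\<close>
  define \<delta> where "\<delta> = W t p / (2 * exp ((C + 1) * t) * w p)"
  have \<delta>: "\<delta> > 0" using pos w(2)[of p] by (simp add: \<delta>_def)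
  define V where "V s q = W s q - \<delta> * exp ((C + 1) * s) * w q" for s q
  have "V t p = W t p / 2" using w(2)[of p] by (simp add: V_def \<delta>_def field_simps)
  then have Vpos: "V t p > 0" using pos by simp
  \<comment> \<open>Outside this radius \<open>\<delta> * weight q\<close> exceeds
    \<open>\<bar>B\<bar>\<close>, so the supersolution dominates the permitted growth and
    \<open>V\<close> is negative.\<close>
  define R where "R = \<bar>B\<bar> / \<delta> + 1"
  have far: "V s q < 0" if s: "0 \<le> s" "s \<le> T" and q: "norm q > R" for s q
  proof -
    have "R \<ge> 1" using \<delta> by (simp add: R_def)
    then have "norm q * norm q \<ge> R * 1" using q by (intro mult_mono) auto
    then have "weight q > \<bar>B\<bar> / \<delta>"
      by (simp add: weight_def R_def dot_square_norm power2_eq_square)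
    then have "\<bar>B\<bar> < \<delta> * weight q" using \<delta> by (simp add: field_simps)
    then have "\<bar>B\<bar> * weight q < \<delta> * w q"
      using weight_ge_1[of q] by (simp add: w_def flip: mult.assoc)
    moreover have "B * weight q \<le> \<bar>B\<bar> * weight q" using weight_ge_1[of q] by (intro mult_right_mono) auto
    moreover have "\<delta> * w q * 1 \<le> \<delta> * w q * exp ((C + 1) * s)"
      using \<delta> w(2)[of q] C(1) s by (intro mult_left_mono) auto
    ultimately show ?thesis using growth[OF s, of q] by (simp add: V_def mult_ac)
  qed
  have "continuous_on ({0..T} \<times> cball 0 R) (\<lambda>(s, q). V s q)"
  proof -
    have "continuous_on ({0..T} \<times> cball 0 R) (\<lambda>x. w (snd x))"
      by (rule continuous_on_compose2[OF smooth_continuous[OF w(1)]]) (auto intro: continuous_intros)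
    moreover have "continuous_on ({0..T} \<times> cball 0 R) (\<lambda>x. W (fst x) (snd x))"
      by (rule continuous_on_subset[OF cont[unfolded case_prod_beta']]) auto
    ultimately show ?thesis
      unfolding V_def case_prod_beta' by (intro continuous_intros)
  qed
  moreover have "compact ({0..T} \<times> cball (0 :: 'n N2) R)" by (intro compact_Times) auto
  moreover
  have tp: "(t, p) \<in> {0..T} \<times> cball 0 R"
    using far[OF t, of p] Vpos t by (auto simp: not_less[symmetric])
  ultimately have "\<exists>x\<in>{0..T} \<times> cball 0 R. \<forall>y\<in>{0..T} \<times> cball 0 R.
      (\<lambda>(s, q). V s q) y \<le> (\<lambda>(s, q). V s q) x"
    by (intro continuous_attains_sup) blast+
  then obtain x where x: "x \<in> {0..T} \<times> cball 0 R"
      "\<And>y. y \<in> {0..T} \<times> cball 0 R \<Longrightarrow> (\<lambda>(s, q). V s q) y \<le> (\<lambda>(s, q). V s q) x"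
    by blast
  obtain t0 p0 where [simp]: "x = (t0, p0)" by (cases x)
  have t0: "0 \<le> t0" "t0 \<le> T" using x(1) by auto
  have V0: "V t0 p0 > 0" using x(2)[OF tp] Vpos by simp
  have max: "V s q \<le> V t0 p0" if "0 \<le> s" "s \<le> T" for s q
    using x(2)[of "(s, q)"] far[OF that, of q] V0 that by (cases "norm q > R") auto
  have "V 0 p0 < 0" using init[of p0] \<delta> w(2)[of p0] unfolding V_def
    by (smt (verit) exp_zero mult_pos_pos mult_zero_right mult.right_neutral)
  then have t0': "0 < t0" using V0 t0 by (cases "t0 = 0") auto
  let ?E = "\<delta> * exp ((C + 1) * t0)"
  have E: "?E > 0" using \<delta> by simp
  have "((\<lambda>s. V s p0) has_real_derivative D t0 p0 - (C + 1) * (?E * w p0)) (at t0)"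
    unfolding V_def by (auto intro!: derivative_eq_intros deriv t0' t0)
  moreover have "D t0 p0 - (C + 1) * (?E * w p0) < 0"
  proof -
    have "sublaplacian (V t0) p0 \<le> 0"
      using max[OF t0] by (intro sublaplacian_at_max)
        (auto simp: V_def[abs_def] intro!: smooth_diff smooth_mult sm w t0' t0)
    moreover have "sublaplacian (V t0) p0 = sublaplacian (W t0) p0 - ?E * sublaplacian w p0"
      unfolding V_def[abs_def]
      by (subst sublaplacian_diff) (auto intro!: sm t0' t0 w smooth_mult simp: sublaplacian_cmult w)
    moreover have "?E * sublaplacian w p0 \<le> ?E * (C * w p0)"
      using C(2)[of p0] E by (intro mult_left_mono) (auto simp: w_def[abs_def])
    \<comment> \<open>The growth rate \<open>C + 1\<close> instead of \<open>C\<close> is what makes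
      this inequality strict.\<close>
    moreover have "?E * (C * w p0) < (C + 1) * (?E * w p0)"
      using mult_pos_pos[OF E w(2)[of p0]] by (simp only: distrib_right mult.left_commute[of _ C] mult_1_left)
    ultimately show ?thesis using ineq[OF t0' t0(2), of p0] by linarith
  qed
  \<comment> \<open>Only earlier times are compared with the maximum, as \<open>t0\<close> may be
    the endpoint \<open>T\<close>.\<close>
  ultimately obtain d where d: "d > 0" "\<And>h. h > 0 \<Longrightarrow> h < d \<Longrightarrow> V t0 p0 < V (t0 - h) p0"
    using DERIV_neg_dec_left[of "\<lambda>s. V s p0"] by blast
  define h where "h = min (d / 2) t0"
  have "h > 0" "h < d" "h \<le> t0" using d(1) t0' by (auto simp: h_def)
  then show False using d(2)[of h] max[of "t0 - h" p0] t0 by auto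
qed

section \<open>The heat semigroup\<close>

text \<open>A class on which the integrals defining \<open>P t\<close> exist, which makes
  \<open>P t\<close> linear and monotone there, and which \<open>P t\<close> preserves.\<close>

definition bounded_borel :: "(real ^ 'a::finite \<Rightarrow> real) \<Rightarrow> bool" where
  "bounded_borel f \<longleftrightarrow> f \<in> borel_measurable borel \<and> (\<exists>M. \<forall>p. \<bar>f p\<bar> \<le> M)"

lemma bounded_borelI: "f \<in> borel_measurable borel \<Longrightarrow> (\<And>p. \<bar>f p\<bar> \<le> M) \<Longrightarrow> bounded_borel f"
  by (auto simp: bounded_borel_def)

lemma bounded_borel_measurable: "bounded_borel f \<Longrightarrow> f \<in> borel_measurable borel"
  by (simp add: bounded_borel_def)

lemma bounded_borel_test_fun: "test_fun f \<Longrightarrow> bounded_borel f"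
  using test_fun_bounded[of f] smooth_measurable[OF test_fun_smooth, of f] bounded_borelI by metis

lemma bounded_borel_const [intro]: "bounded_borel (\<lambda>_. c)"
  by (rule bounded_borelI[of _ "\<bar>c\<bar>"]) auto

lemma bounded_borel_add [intro]:
  assumes "bounded_borel f" "bounded_borel g"
  shows "bounded_borel (\<lambda>p. f p + g p)"
proof -
  note [measurable] = assms[THEN bounded_borel_measurable]
  obtain M N where MN: "\<And>p. \<bar>f p\<bar> \<le> M" "\<And>p. \<bar>g p\<bar> \<le> N"
    using assms by (auto simp: bounded_borel_def)
  show ?thesis
  proof (rule bounded_borelI[of _ "M + N"])
    fix p show "\<bar>f p + g p\<bar> \<le> M + N" using MN(1)[of p] MN(2)[of p] by linarith
  qed measurable
qed

lemma bounded_borel_mult [intro]: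
  assumes "bounded_borel f" "bounded_borel g"
  shows "bounded_borel (\<lambda>p. f p * g p)"
proof -
  note [measurable] = assms[THEN bounded_borel_measurable]
  obtain M N where MN: "\<And>p. \<bar>f p\<bar> \<le> M" "\<And>p. \<bar>g p\<bar> \<le> N"
    using assms by (auto simp: bounded_borel_def)
  show ?thesis
  proof (rule bounded_borelI[of _ "M * N"])
    fix p show "\<bar>f p * g p\<bar> \<le> M * N" unfolding abs_mult by (rule mult_mono') (use MN in auto)
  qed measurable
qed

lemma bounded_borel_minus [intro]: "bounded_borel f \<Longrightarrow> bounded_borel (\<lambda>p. - f p)"
  using bounded_borel_mult[of "\<lambda>_. -1" f] by auto

lemma bounded_borel_diff [intro]: "bounded_borel f \<Longrightarrow> bounded_borel g \<Longrightarrow> bounded_borel (\<lambda>p. f p - g p)"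
  using bounded_borel_add[of f "\<lambda>p. - g p"] by auto

lemma bounded_borel_abs [intro]: "bounded_borel f \<Longrightarrow> bounded_borel (\<lambda>p. \<bar>f p\<bar>)"
  by (auto simp: bounded_borel_def intro: borel_measurable_abs)

lemma continuous_N2_mult: "continuous_on UNIV (\<lambda>(p, q). N2_mult p q)"
  unfolding N2_mult_eq case_prod_beta'
  by (intro continuous_intros comm_form.continuous_on)

lemma measurable_N2_mult [measurable]: "(\<lambda>(p, q). N2_mult p q) \<in> borel \<Otimes>\<^sub>M borel \<rightarrow>\<^sub>M borel"
  using borel_measurable_continuous_onI[OF continuous_N2_mult] by (simp add: borel_prod)

lemma measurable_N2_mult' [measurable]: "N2_mult p \<in> borel \<rightarrow>\<^sub>M borel"
  unfolding N2_mult_eq[abs_def]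
  by (intro borel_measurable_continuous_onI continuous_intros comm_form.continuous_on)

text \<open>Fixes the measures whose existence is part of \<open>heat_semigroup\<close>.\<close>

locale heat =
  fixes P :: "real \<Rightarrow> (('n::{finite,linorder}) N2 \<Rightarrow> real) \<Rightarrow> 'n N2 \<Rightarrow> real"
    and \<mu> :: "real \<Rightarrow> 'n N2 measure"
  assumes conv: "convolution_semigroup \<mu>"
    and P_eq: "\<And>t f g. t \<ge> 0 \<Longrightarrow> P t f g = (\<integral>h. f (N2_mult g h) \<partial>\<mu> t)"
    and gen: "\<And>f. smooth f \<Longrightarrow> compactly_supported f \<Longrightarrow>
        uniform_limit UNIV (\<lambda>t g. (P t f g - f g) / t) (sublaplacian f) (at_right 0)"
begin

lemma prob: "t \<ge> 0 \<Longrightarrow> prob_space (\<mu> t)"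
  and sets_mu: "t \<ge> 0 \<Longrightarrow> sets (\<mu> t) = sets borel"
  and mu_0: "\<mu> 0 = return borel 0"
  and mu_add: "s \<ge> 0 \<Longrightarrow> t \<ge> 0 \<Longrightarrow> \<mu> (s + t) = distr (\<mu> s \<Otimes>\<^sub>M \<mu> t) borel (\<lambda>(g, h). N2_mult g h)"
  using conv by (auto simp: convolution_semigroup_def)

lemma measurable_mu: "t \<ge> 0 \<Longrightarrow> measurable (\<mu> t) M = measurable borel M"
  by (rule measurable_cong_sets) (simp_all add: sets_mu)

lemma measurable_shift: "t \<ge> 0 \<Longrightarrow> f \<in> borel_measurable borel \<Longrightarrow> (\<lambda>h. f (N2_mult g h)) \<in> borel_measurable (\<mu> t)"
  by (simp add: measurable_mu)

lemma integrable_shift: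
  assumes t: "t \<ge> 0" and f: "bounded_borel f"
  shows "integrable (\<mu> t) (\<lambda>h. f (N2_mult g h))"
proof -
  interpret prob_space "\<mu> t" using t by (rule prob)
  obtain M where "\<And>p. \<bar>f p\<bar> \<le> M" using f by (auto simp: bounded_borel_def)
  then show ?thesis
    using measurable_shift[OF t bounded_borel_measurable[OF f]]
    by (intro integrable_const_bound[of _ M]) auto
qed

lemma P_const: "t \<ge> 0 \<Longrightarrow> P t (\<lambda>_. c) g = c"
  using prob_space.prob_space[OF prob] by (simp add: P_eq)

lemma P_add: "t \<ge> 0 \<Longrightarrow> bounded_borel f \<Longrightarrow> bounded_borel h \<Longrightarrow> P t (\<lambda>p. f p + h p) g = P t f g + P t h g"
  by (simp add: P_eq integrable_shift)

lemma P_diff: "t \<ge> 0 \<Longrightarrow> bounded_borel f \<Longrightarrow> bounded_borel h \<Longrightarrow> P t (\<lambda>p. f p - h p) g = P t f g - P t h g"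
  by (simp add: P_eq integrable_shift)

lemma P_cmult: "t \<ge> 0 \<Longrightarrow> P t (\<lambda>p. c * f p) g = c * P t f g"
  by (simp add: P_eq)

lemma P_sum: "t \<ge> 0 \<Longrightarrow> (\<And>i. i \<in> I \<Longrightarrow> bounded_borel (f i)) \<Longrightarrow> P t (\<lambda>p. \<Sum>i\<in>I. f i p) g = (\<Sum>i\<in>I. P t (f i) g)"
  by (simp add: P_eq integrable_shift)

lemma P_mono: "t \<ge> 0 \<Longrightarrow> bounded_borel f \<Longrightarrow> bounded_borel h \<Longrightarrow> (\<And>p. f p \<le> h p) \<Longrightarrow> P t f g \<le> P t h g"
  by (simp add: P_eq integrable_shift integral_mono)

lemma P_bound:
  assumes "t \<ge> 0" "bounded_borel f" "\<And>p. \<bar>f p\<bar> \<le> M"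
  shows "\<bar>P t f g\<bar> \<le> M"
  using P_mono[OF assms(1,2) bounded_borel_const[of M], of g] P_mono[OF assms(1) bounded_borel_const[of "- M"] assms(2), of g]
    P_const[OF assms(1)] assms(3) by (auto simp: abs_le_iff) (metis abs_le_D2 minus_le_iff)+

lemma P_0:
  assumes "f \<in> borel_measurable borel"
  shows "P 0 f g = f g"
proof -
  have "(\<lambda>h. f (N2_mult g h)) \<in> borel_measurable borel" using assms by measurable
  then show ?thesis by (simp add: P_eq mu_0 integral_return)
qed

lemma bounded_borel_P:
  assumes t: "t \<ge> 0" and f: "bounded_borel f"
  shows "bounded_borel (P t f)"
proof -
  interpret prob_space "\<mu> t" using t by (rule prob)
  note [measurable] = bounded_borel_measurable[OF f] and [measurable_cong] = sets_mu[OF t]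
  have "(\<lambda>(g, h). f (N2_mult g h)) = (\<lambda>x. f ((\<lambda>(g, h). N2_mult g h) x))" by auto
  then have "(\<lambda>(g, h). f (N2_mult g h)) \<in> borel_measurable (borel \<Otimes>\<^sub>M \<mu> t)" by simp
  then have "(\<lambda>g. \<integral>h. f (N2_mult g h) \<partial>\<mu> t) \<in> borel_measurable borel"
    by (rule borel_measurable_lebesgue_integral)
  moreover obtain M where "\<And>p. \<bar>f p\<bar> \<le> M" using f by (auto simp: bounded_borel_def)
  ultimately show ?thesis
    using P_bound[OF t f] by (intro bounded_borelI[of _ M]) (auto simp: P_eq[OF t, abs_def])
qed

lemma P_add_time:
  assumes s: "s \<ge> 0" and t: "t \<ge> 0" and f: "bounded_borel f"
  shows "P (s + t) f g = P s (P t f) g"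
proof -
  interpret S: prob_space "\<mu> s" using s by (rule prob)
  interpret T: prob_space "\<mu> t" using t by (rule prob)
  interpret ST: pair_prob_space "\<mu> s" "\<mu> t" ..
  note [measurable] = bounded_borel_measurable[OF f] and [measurable_cong] = sets_mu[OF t] sets_mu[OF s]
  have m: "(\<lambda>x. f (N2_mult g ((\<lambda>(g, h). N2_mult g h) x))) \<in> borel_measurable (\<mu> s \<Otimes>\<^sub>M \<mu> t)"
    by measurable
  obtain M where "\<And>p. \<bar>f p\<bar> \<le> M" using f by (auto simp: bounded_borel_def)
  then have int: "integrable (\<mu> s \<Otimes>\<^sub>M \<mu> t) (\<lambda>x. f (N2_mult g ((\<lambda>(g, h). N2_mult g h) x)))"
    using m by (intro ST.P.integrable_const_bound[of _ M]) auto
  have "P (s + t) f g = (\<integral>k. f (N2_mult g k) \<partial>distr (\<mu> s \<Otimes>\<^sub>M \<mu> t) borel (\<lambda>(g, h). N2_mult g h))"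
    using s t by (simp add: P_eq mu_add)
  also have "\<dots> = (\<integral>x. f (N2_mult g ((\<lambda>(g, h). N2_mult g h) x)) \<partial>(\<mu> s \<Otimes>\<^sub>M \<mu> t))"
    by (rule integral_distr) measurable
  also have "\<dots> = (\<integral>h. (\<integral>k. f (N2_mult g (N2_mult h k)) \<partial>\<mu> t) \<partial>\<mu> s)"
    using ST.integral_fst'[OF int] by simp
  also have "\<dots> = P s (P t f) g"
    using s t by (simp add: P_eq N2_mult_assoc)
  finally show ?thesis .
qed

end

section \<open>Derivatives of \<open>P t h\<close> in space\<close>

text \<open>\<open>v + comm_form v k\<close> is the velocity of \<open>N2_mult p k\<close> when
  \<open>p\<close> moves in direction \<open>v\<close>. At that point it is the value of a right
  invariant field whose vector \<open>v - comm_form v p\<close> does not depend on \<open>k\<close>,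
  so integration over \<open>k\<close> gives \<open>P t\<close> of one function.\<close>

lemma grad_right_field: "grad f (N2_mult p k) (v + comm_form v k) = RX (v - comm_form v p) f (N2_mult p k)"
  by (simp add: RX_def right_field_def N2_mult_eq comm_form.add_right comm_form.diff_left)

lemma RX_linear: "RX v f p = (\<Sum>a\<in>UNIV. v $ a * RX (axis a 1) f p)"
proof -
  have lin: "linear (\<lambda>v. RX v f p)"
    unfolding RX_def right_field_def
    by (rule linearI) (simp_all add: comm_form.add_left comm_form.scaleR_left grad_linear_simps algebra_simps
        flip: scaleR_add_right)
  have "RX v f p = RX (\<Sum>a\<in>UNIV. v $ a *\<^sub>R axis a 1) f p"
    using basis_expansion[of v] by (simp add: scalar_mult_eq_scaleR)
  then show ?thesis by (simp add: linear_sum[OF lin] linear_cmul[OF lin])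
qed

text \<open>The vector \<open>v + comm_form v k\<close> can be unbounded in \<open>k\<close>, but
  the gradient vanishes unless \<open>N2_mult p k\<close> lies in a fixed ball. Replacing
  \<open>comm_form v k\<close> by \<open>comm_form v (N2_mult p k) - comm_form v p\<close> trades
  \<open>k\<close> for that ball and for one power of \<open>norm p\<close>.\<close>

lemma test_fun_grad_bound:
  fixes h :: "('n::{finite,linorder}) N2 \<Rightarrow> real"
  assumes h: "test_fun h"
  obtains B where "B \<ge> 0" "\<And>p k v. \<bar>grad h (N2_mult p k) (v + comm_form v k)\<bar> \<le> B * norm v * (1 + norm p)"
proof -
  obtain R where R: "\<And>p. norm p > R \<Longrightarrow> h p = 0"
    using h by (auto simp: test_fun_def compactly_supported_iff)
  obtain K where K: "K > 0" "\<And>p q :: 'n N2. norm (comm_form p q) \<le> norm p * norm q * K"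
    using comm_form.pos_bounded by blast
  from test_fun_bounded_family[of "\<lambda>a. partial a h"] test_fun_partial[OF h]
  obtain M where "\<forall>a. M a \<ge> 0 \<and> (\<forall>p. \<bar>partial a h p\<bar> \<le> M a)" by blast
  then have M: "M a \<ge> 0" "\<bar>partial a h p\<bar> \<le> M a" for a p by simp_all
  define G where "G = (\<Sum>a\<in>UNIV. M a)"
  have G: "G \<ge> 0" using M by (simp add: G_def sum_nonneg)
  have grad_le: "\<bar>grad h q w\<bar> \<le> G * norm w" for q w
  proof -
    have "\<bar>grad h q w\<bar> \<le> (\<Sum>a\<in>UNIV. \<bar>w $ a * partial a h q\<bar>)"
      unfolding grad_def by (rule sum_abs)
    also have "\<dots> \<le> (\<Sum>a\<in>UNIV. norm w * M a)"
      unfolding abs_mult using M by (intro sum_mono mult_mono) (auto simp: component_le_norm_cart)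
    finally show ?thesis by (simp add: G_def sum_distrib_left mult.commute)
  qed
  have grad_0: "grad h q w = 0" if "norm q > R" for q w
  proof -
    have "open {p :: 'n N2. norm p > R}" by (intro open_Collect_less continuous_intros)
    then have "partial a h q = partial a (\<lambda>_. 0) q" for a
      by (rule partial_cong_open) (use that R in auto)
    then show ?thesis by (simp add: grad_def)
  qed
  let ?B = "G * (1 + K * \<bar>R\<bar> + K)"
  have "\<bar>grad h (N2_mult p k) (v + comm_form v k)\<bar> \<le> ?B * norm v * (1 + norm p)" for p k v
  proof (cases "norm (N2_mult p k) > R")
    case True
    then show ?thesis using grad_0 G K(1) by simp
  next
    case False
    define q where "q = N2_mult p k"
    have q: "norm q \<le> \<bar>R\<bar>" using False by (simp add: q_def)
    have "v + comm_form v k = v + (comm_form v q - comm_form v p)"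
      by (simp add: q_def N2_mult_eq comm_form.add_right)
    then have "norm (v + comm_form v k) \<le> norm v + (norm (comm_form v q) + norm (comm_form v p))"
      using norm_triangle_ineq[of v "comm_form v q - comm_form v p"]
        norm_triangle_ineq4[of "comm_form v q" "comm_form v p"] by simp
    also have "\<dots> \<le> norm v + (norm v * \<bar>R\<bar> * K + norm v * norm p * K)"
      using K q by (intro add_mono order_refl order_trans[OF K(2)] mult_right_mono mult_left_mono) auto
    also have "\<dots> = (1 + K * \<bar>R\<bar> + K * norm p) * norm v" by (simp add: algebra_simps)
    also have "\<dots> \<le> ((1 + K * \<bar>R\<bar> + K) * (1 + norm p)) * norm v"
    proof (rule mult_right_mono)
      have "0 \<le> (1 + K * \<bar>R\<bar>) * norm p" using K(1) by simp
      then show "1 + K * \<bar>R\<bar> + K * norm p \<le> (1 + K * \<bar>R\<bar> + K) * (1 + norm p)"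
        using K(1) unfolding distrib_left distrib_right by simp
    qed simp
    finally have "norm (v + comm_form v k) \<le> (1 + K * \<bar>R\<bar> + K) * (1 + norm p) * norm v" .
    then have "G * norm (v + comm_form v k) \<le> G * ((1 + K * \<bar>R\<bar> + K) * (1 + norm p) * norm v)"
      using G by (rule mult_left_mono)
    then show ?thesis using grad_le[of "N2_mult p k" "v + comm_form v k"] by (simp add: mult_ac)
  qed
  moreover have "?B \<ge> 0" using G K(1) by simp
  ultimately show ?thesis using that by blast
qed

context heat
begin

lemma P_has_derivative:
  assumes t: "t \<ge> 0" and h: "test_fun h"
  shows "(P t h has_derivative (\<lambda>v. P t (RX (v - comm_form v p) h) p)) (at p)"
proof -
  interpret prob_space "\<mu> t" using t by (rule prob)
  obtain B where B: "B \<ge> 0" "\<And>p k v. \<bar>grad h (N2_mult p k) (v + comm_form v k)\<bar> \<le> B * norm v * (1 + norm p)"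
    using test_fun_grad_bound[OF h] by blast
  have "((\<lambda>q. \<integral>k. h (N2_mult q k) \<partial>\<mu> t) has_derivative
     (\<lambda>v. \<integral>k. grad h (N2_mult p k) (v + comm_form v k) \<partial>\<mu> t)) (at p)"
  proof (rule has_derivative_integral_bounded[where B = "B * (2 + norm p)"])
    show "finite_measure (\<mu> t)" by unfold_locales
    fix q k v :: "'n N2" assume q: "q \<in> ball p 1"
    have "((\<lambda>q. N2_mult q k) has_derivative (\<lambda>v. v + comm_form v k)) (at q)"
      unfolding N2_mult_eq by (auto intro!: derivative_eq_intros comm_form.FDERIV simp: comm_form.zero_right)
    then show "((\<lambda>q. h (N2_mult q k)) has_derivative (\<lambda>v. grad h (N2_mult q k) (v + comm_form v k))) (at q)"
      by (rule has_derivative_compose) (rule smooth_has_derivative[OF test_fun_smooth[OF h]])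
    have "norm q \<le> norm p + 1"
      using q norm_triangle_ineq2[of q p] by (simp add: dist_norm norm_minus_commute)
    then have "B * norm v * (1 + norm q) \<le> B * norm v * (2 + norm p)"
      using B(1) by (intro mult_left_mono) auto
    then show "\<bar>grad h (N2_mult q k) (v + comm_form v k)\<bar> \<le> B * (2 + norm p) * norm v"
      using B(2)[of q k v] by (simp add: mult_ac)
  next
    fix q show "integrable (\<mu> t) (\<lambda>k. h (N2_mult q k))"
      by (rule integrable_shift[OF t bounded_borel_test_fun[OF h]])
  next
    fix v :: "'n N2"
    have "test_fun (RX (v - comm_form v p) h)" using h by (rule test_fun_RX)
    then show "(\<lambda>k. grad h (N2_mult p k) (v + comm_form v k)) \<in> borel_measurable (\<mu> t)"
      unfolding grad_right_field by (intro measurable_shift t smooth_measurable test_fun_smooth)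
  qed
  then show ?thesis unfolding P_eq[OF t, abs_def] grad_right_field .
qed

lemma grad_P:
  "t \<ge> 0 \<Longrightarrow> test_fun h \<Longrightarrow> grad (P t h) p v = P t (RX (v - comm_form v p) h) p"
  using grad_unique[OF P_has_derivative] by metis

lemma grad_P_sum:
  assumes "t \<ge> 0" "test_fun h"
  shows "grad (P t h) p v = (\<Sum>a\<in>UNIV. (v - comm_form v p) $ a * P t (RX (axis a 1) h) p)"
proof -
  have "RX (v - comm_form v p) h = (\<lambda>q. \<Sum>a\<in>UNIV. (v - comm_form v p) $ a * RX (axis a 1) h q)"
    by (rule ext) (rule RX_linear)
  then show ?thesis
    using assms by (simp add: grad_P P_sum P_cmult bounded_borel_mult bounded_borel_const
        bounded_borel_test_fun test_fun_RX)
qed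

text \<open>Smoothness is inherited from \<open>h\<close>, without a density of the measure: each
  partial derivative of \<open>P t h\<close> is a combination, with smooth coefficients, of
  \<open>P t\<close> of further test functions. The induction therefore runs over all test functions
  at once.\<close>

lemma smooth_P:
  assumes t: "t \<ge> 0" and h: "test_fun h"
  shows "smooth (P t h)"
proof -
  have "C_k k (P t h)" if "test_fun h" for k h
    using that
  proof (induction k arbitrary: h)
    case 0
    have "isCont (P t h) p" for p
      using P_has_derivative[OF t 0] has_derivative_continuous by blast
    then show ?case by (simp add: continuous_on_eq_continuous_at)
  next
    case (Suc k)
    have "partial a (P t h) = (\<lambda>p. \<Sum>b\<in>UNIV. (axis a 1 - comm_form (axis a 1) p) $ b * P t (RX (axis b 1) h) p)" for a
      using grad_P_sum[OF t Suc.prems] grad_axis[of "P t h"] by metis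
    moreover have "C_k k (\<lambda>p. \<Sum>b\<in>UNIV. (axis a 1 - comm_form (axis a 1) p) $ b * P t (RX (axis b 1) h) p)" for a
    proof -
      have "C_k k (\<lambda>p. (axis a 1 - comm_form (axis a 1) p) $ b * P t (RX (axis b 1) h) p)" for b
      proof (rule C_k_mult)
        have "smooth (\<lambda>p. (axis a 1 :: 'n N2) $ b - comm_form (axis a 1) p $ b)"
          by (intro smooth_diff smooth_const smooth_linear
              bounded_linear_compose[OF bounded_linear_vec_nth comm_form.bounded_linear_right])
        then show "C_k k (\<lambda>p. (axis a 1 - comm_form (axis a 1) p) $ b)" by (simp add: smooth_def)
        show "C_k k (P t (RX (axis b 1) h))" by (intro Suc.IH test_fun_RX Suc.prems)
      qed
      then show ?thesis by (rule C_k_sum)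
    qed
    moreover have "P t h differentiable at p" for p
      using P_has_derivative[OF t Suc.prems] differentiable_def by blast
    ultimately show ?case by simp
  qed
  then show ?thesis using h by (simp add: smooth_def)
qed

lemma RX_P: "t \<ge> 0 \<Longrightarrow> test_fun h \<Longrightarrow> RX v (P t h) p = P t (RX v h) p"
  by (simp add: RX_def[of v "P t h"] grad_P right_field_def comm_form.add_left)

section \<open>Time regularity and the heat equation\<close>

lemma P_uniform:
  assumes "test_fun h" "\<epsilon> > 0"
  obtains d where "d > 0"
    "\<And>s g. 0 < s \<Longrightarrow> s < d \<Longrightarrow> \<bar>(P s h g - h g) / s - sublaplacian h g\<bar> < \<epsilon>"
proof -
  have "\<forall>\<^sub>F s in at_right 0. \<forall>g\<in>UNIV. dist ((P s h g - h g) / s) (sublaplacian h g) < \<epsilon>"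
    using gen[of h] assms by (intro uniform_limitD) (auto simp: test_fun_def)
  then show ?thesis
    using that by (auto simp: eventually_at_right_field dist_real_def)
qed

text \<open>The uniform convergence to the generator gives the bound at time \<open>0\<close>; the
  semigroup law and the contraction property carry it to every \<open>t\<close> with the same
  \<open>L\<close> and \<open>d\<close>.\<close>

lemma P_small_time:
  assumes h: "test_fun h"
  obtains L d where "L \<ge> 0" "d > 0"
    "\<And>t s g. t \<ge> 0 \<Longrightarrow> 0 \<le> s \<Longrightarrow> s < d \<Longrightarrow> \<bar>P (t + s) h g - P t h g\<bar> \<le> L * s"
proof -
  obtain d where d: "d > 0" "\<And>s g. 0 < s \<Longrightarrow> s < d \<Longrightarrow> \<bar>(P s h g - h g) / s - sublaplacian h g\<bar> < 1"
    using P_uniform[OF h zero_less_one] by blast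
  obtain M where M: "M \<ge> 0" "\<And>p. \<bar>sublaplacian h p\<bar> \<le> M"
    using test_fun_bounded[OF test_fun_sublaplacian[OF h]] by blast
  have bb: "bounded_borel h" by (rule bounded_borel_test_fun[OF h])
  have "\<bar>P (t + s) h g - P t h g\<bar> \<le> (M + 1) * s" if "t \<ge> 0" "0 \<le> s" "s < d" for t s g
  proof (cases "s = 0")
    case False
    have "\<bar>P s h q - h q\<bar> \<le> (M + 1) * s" for q
    proof -
      have "\<bar>(P s h q - h q) / s\<bar> \<le> M + 1" using d(2)[of s q] M(2)[of q] that False by auto
      then show ?thesis using that False by (simp add: field_simps)
    qed
    then have "\<bar>P t (\<lambda>q. P s h q - h q) g\<bar> \<le> (M + 1) * s"
      using that by (intro P_bound bounded_borel_diff bounded_borel_P bb) auto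
    then show ?thesis using that by (simp add: P_diff P_add_time bb bounded_borel_P)
  qed simp
  then show ?thesis using that[of "M + 1" d] d(1) M(1) by auto
qed

text \<open>Continuity in space at a fixed time combines with a Lipschitz bound in time that is
  uniform in space.\<close>

lemma continuous_P:
  assumes h: "test_fun h"
  shows "continuous_on ({0..} \<times> UNIV) (\<lambda>(t, p). P t h p)"
proof -
  obtain L d where L: "L \<ge> 0" "d > 0"
    "\<And>t s g. t \<ge> 0 \<Longrightarrow> 0 \<le> s \<Longrightarrow> s < d \<Longrightarrow> \<bar>P (t + s) h g - P t h g\<bar> \<le> L * s"
    using P_small_time[OF h] by metis
  have L': "\<bar>P s h g - P t h g\<bar> \<le> L * \<bar>s - t\<bar>" if "t \<ge> 0" "s \<ge> 0" "\<bar>s - t\<bar> < d" for s t g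
    using L(3)[of t "s - t" g] L(3)[of s "t - s" g] that by (cases "s \<ge> t") auto
  have "((\<lambda>x. P (fst x) h (snd x)) \<longlongrightarrow> P t h p) (at (t, p) within {0..} \<times> UNIV)" if t: "t \<ge> 0" for t p
  proof -
    let ?F = "at (t, p) within {0..} \<times> UNIV"
    have fst: "(fst \<longlongrightarrow> t) ?F" and snd: "(snd \<longlongrightarrow> p) ?F"
      by (auto intro!: tendsto_eq_intros)
    have "isCont (P t h) p"
      using P_has_derivative[OF t h] has_derivative_continuous by blast
    then have 1: "((\<lambda>x. P t h (snd x)) \<longlongrightarrow> P t h p) ?F"
      using snd by (rule isCont_tendsto_compose)
    have 2: "((\<lambda>x. P (fst x) h (snd x) - P t h (snd x)) \<longlongrightarrow> 0) ?F"
    proof (rule Lim_null_comparison)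
      show "((\<lambda>x. L * \<bar>fst x - t\<bar>) \<longlongrightarrow> 0) ?F"
        using fst by (auto intro!: tendsto_eq_intros)
      have "\<forall>\<^sub>F x in ?F. dist (fst x) t < d" using fst L(2) by (rule tendstoD)
      moreover have "\<forall>\<^sub>F x in ?F. x \<in> {0..} \<times> UNIV" by (simp add: eventually_at_filter)
      ultimately show "\<forall>\<^sub>F x in ?F. norm (P (fst x) h (snd x) - P t h (snd x)) \<le> L * \<bar>fst x - t\<bar>"
        by eventually_elim (use L' t in \<open>auto simp: dist_real_def\<close>)
    qed
    from tendsto_add[OF 2 1] show ?thesis by simp
  qed
  then show ?thesis by (auto simp: continuous_on_def case_prod_beta')
qed

text \<open>The cutoff \<open>\<eta>\<close> equals \<open>1\<close> to fourth order at \<open>g\<close>, so multiplying by it changes neither the value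
  nor the sub-Laplacian at \<open>g\<close>; the same property bounds the mass that \<open>P s\<close> moves away from \<open>g\<close>.\<close>

lemma generator_at:
  assumes u: "smooth u" and M: "\<And>p. \<bar>u p\<bar> \<le> M"
  shows "((\<lambda>s. (P s u g - u g) / s) \<longlongrightarrow> sublaplacian u g) (at_right 0)"
proof -
  define r where "r p = (p - g) \<bullet> (p - g)" for p
  define w where "w p = 1 - r p * r p" for p
  \<comment> \<open>The factor compensates \<open>flat 0 1 = exp (- 1)\<close>, so that
    \<open>\<eta> g = 1\<close>; the function vanishes where \<open>r p\<close> is at least
    \<open>1\<close>.\<close>
  define \<eta> where "\<eta> p = exp 1 * flat 0 (w p)" for p
  have r: "smooth r"
  proof -
    have "r = (\<lambda>p. \<Sum>a\<in>UNIV. (p $ a - g $ a) * (p $ a - g $ a))"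
      by (simp add: r_def inner_vec_def fun_eq_iff)
    then show ?thesis by (auto intro!: smooth_sum smooth_mult smooth_diff smooth_nth)
  qed
  have w: "smooth w" unfolding w_def[abs_def] by (intro smooth_diff smooth_mult r smooth_const)
  have \<eta>: "smooth \<eta>" unfolding \<eta>_def[abs_def] by (intro smooth_mult smooth_const smooth_flat w)
  have rg: "r g = 0" and wg: "w g = 1" by (simp_all add: r_def w_def)
  have \<eta>g: "\<eta> g = 1" using wg by (simp add: \<eta>_def flat_def flip: exp_add)
  have supp: "\<eta> p = 0" if "norm p > norm g + 1" for p
  proof -
    have "norm (p - g) > 1" using that norm_triangle_ineq2[of p g] by simp
    then have "1 * 1 < norm (p - g) * norm (p - g)" by (intro mult_strict_mono) auto
    then have "r p > 1" by (simp add: r_def dot_square_norm power2_eq_square)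
    then have "1 * 1 < r p * r p" by (intro mult_strict_mono) auto
    then show ?thesis by (simp add: \<eta>_def flat_def w_def)
  qed
  have test: "test_fun \<eta>" using \<eta> supp by (auto simp: test_fun_def compactly_supported_iff)
  have \<eta>01: "0 \<le> \<eta> p" "\<eta> p \<le> 1" for p
  proof -
    show "0 \<le> \<eta> p" by (simp add: \<eta>_def flat_def)
    have "exp 1 * exp (- 1 / w p) \<le> 1" if "w p > 0"
    proof -
      have "w p \<le> 1" by (simp add: w_def)
      then have "- 1 / w p \<le> - 1" using that by (simp add: field_simps)
      then have "exp (- 1 / w p) \<le> exp (- 1)" by simp
      then have "exp 1 * exp (- 1 / w p) \<le> exp 1 * exp (- 1 :: real)" by (intro mult_left_mono) auto
      then show ?thesis by (simp flip: exp_add)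
    qed
    then show "\<eta> p \<le> 1" by (simp add: \<eta>_def flat_def)
  qed
  have Xr: "X i r g = 0" for i
  proof -
    have "(r has_derivative (\<lambda>v. 2 * ((g - g) \<bullet> v))) (at g)"
      unfolding r_def[abs_def] by (auto intro!: derivative_eq_intros simp: inner_commute)
    then show ?thesis unfolding X_eq_grad using grad_unique by fastforce
  qed
  have Xw: "X i w g = 0" for i
    unfolding w_def[abs_def] using r by (simp add: X_diff X_mult smooth_mult smooth_const rg)
  have Dw: "sublaplacian w g = 0"
    unfolding w_def[abs_def]
    using r by (simp add: sublaplacian_diff sublaplacian_mult smooth_mult smooth_const rg Gam_def Xr)
  have X\<eta>: "X i \<eta> g = 0" for i
    unfolding \<eta>_def[abs_def]
    using X_cmult[OF smooth_flat[OF w]] X_chain[OF w has_real_derivative_flat] Xw by simp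
  have D\<eta>: "sublaplacian \<eta> g = 0"
  proof -
    have "((\<lambda>x. - real 0 * flat (Suc 0) x + flat (0 + 2) x) has_real_derivative
        (- real 2 * flat (Suc 2) x + flat (2 + 2) x)) (at x)" for x
      using has_real_derivative_flat[of 2 x] by (simp add: numeral_2_eq_2)
    from sublaplacian_chain[OF w has_real_derivative_flat[of 0] this, of g]
    have "sublaplacian (\<lambda>q. flat 0 (w q)) g = 0" by (simp add: Dw Gam_def Xw)
    then show ?thesis unfolding \<eta>_def[abs_def] by (simp add: sublaplacian_cmult smooth_flat w)
  qed
  have tu: "test_fun (\<lambda>p. \<eta> p * u p)" using test u by (rule test_fun_mult_right)
  have bu: "bounded_borel u" using u M by (intro bounded_borelI smooth_measurable)
  have b\<eta>: "bounded_borel \<eta>" by (rule bounded_borel_test_fun[OF test])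
  have "sublaplacian (\<lambda>p. \<eta> p * u p) g = sublaplacian u g"
    by (simp add: sublaplacian_mult \<eta> u \<eta>g D\<eta> Gam_def X\<eta>)
  moreover have "((\<lambda>s. (P s (\<lambda>p. \<eta> p * u p) g - \<eta> g * u g) / s) \<longlongrightarrow> sublaplacian (\<lambda>p. \<eta> p * u p) g) (at_right 0)"
    using tu by (intro tendsto_uniform_limitI[OF gen]) (auto simp: test_fun_def)
  ultimately have main: "((\<lambda>s. (P s (\<lambda>p. \<eta> p * u p) g - u g) / s) \<longlongrightarrow> sublaplacian u g) (at_right 0)"
    by (simp add: \<eta>g)
  have "((\<lambda>s. (P s \<eta> g - \<eta> g) / s) \<longlongrightarrow> sublaplacian \<eta> g) (at_right 0)"
    using test by (intro tendsto_uniform_limitI[OF gen]) (auto simp: test_fun_def)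
  then have "((\<lambda>s. (P s \<eta> g - 1) / s) \<longlongrightarrow> 0) (at_right 0)" by (simp add: D\<eta> \<eta>g)
  then have aux: "((\<lambda>s. - M * ((P s \<eta> g - 1) / s)) \<longlongrightarrow> 0) (at_right 0)"
    by (rule tendsto_mult_right_zero)
  have "((\<lambda>s. (P s u g - P s (\<lambda>p. \<eta> p * u p) g) / s) \<longlongrightarrow> 0) (at_right 0)"
  proof (rule Lim_null_comparison[OF _ aux])
    have "norm ((P s u g - P s (\<lambda>p. \<eta> p * u p) g) / s) \<le> - M * ((P s \<eta> g - 1) / s)" if s: "s > 0" for s :: real
    proof -
      have s0: "s \<ge> 0" using s by simp
      have eq: "P s u g - P s (\<lambda>p. \<eta> p * u p) g = P s (\<lambda>p. u p - \<eta> p * u p) g"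
        using s0 bu b\<eta> by (simp add: P_diff bounded_borel_mult)
      have eq': "M * (1 - P s \<eta> g) = P s (\<lambda>p. M * (1 - \<eta> p)) g"
        using s0 b\<eta> by (simp add: P_cmult P_diff P_const bounded_borel_const)
      have le: "\<bar>u p - \<eta> p * u p\<bar> \<le> M * (1 - \<eta> p)" for p
      proof -
        have "u p - \<eta> p * u p = u p * (1 - \<eta> p)" by (simp add: algebra_simps)
        then have "\<bar>u p - \<eta> p * u p\<bar> = \<bar>u p\<bar> * (1 - \<eta> p)"
          using \<eta>01[of p] by (simp add: abs_mult)
        then show ?thesis using M[of p] \<eta>01(2)[of p] by (simp add: mult_right_mono)
      qed
      have le': "u p - \<eta> p * u p \<le> M * (1 - \<eta> p)" "- (M * (1 - \<eta> p)) \<le> u p - \<eta> p * u p" for p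
        using le[of p] by linarith+
      have "P s (\<lambda>p. u p - \<eta> p * u p) g \<le> P s (\<lambda>p. M * (1 - \<eta> p)) g"
        by (intro P_mono s0 bounded_borel_diff bounded_borel_mult bu b\<eta> bounded_borel_const le'(1))
      moreover have "P s (\<lambda>p. - (M * (1 - \<eta> p))) g \<le> P s (\<lambda>p. u p - \<eta> p * u p) g"
        by (intro P_mono s0 bounded_borel_diff bounded_borel_minus bounded_borel_mult bu b\<eta> bounded_borel_const le'(2))
      moreover have "P s (\<lambda>p. - (M * (1 - \<eta> p))) g = - P s (\<lambda>p. M * (1 - \<eta> p)) g"
        using s0 by (simp add: P_eq)
      ultimately have "\<bar>P s u g - P s (\<lambda>p. \<eta> p * u p) g\<bar> \<le> M * (1 - P s \<eta> g)"
        unfolding eq eq' by (simp add: abs_le_iff)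
      then have "\<bar>P s u g - P s (\<lambda>p. \<eta> p * u p) g\<bar> / s \<le> M * (1 - P s \<eta> g) / s"
        using s by (simp add: divide_right_mono)
      also have "\<dots> = - M * ((P s \<eta> g - 1) / s)" by (simp add: algebra_simps)
      finally show ?thesis using s by simp
    qed
    then show "\<forall>\<^sub>F s in at_right 0. norm ((P s u g - P s (\<lambda>p. \<eta> p * u p) g) / s) \<le> - M * ((P s \<eta> g - 1) / s)"
      by (auto simp: eventually_at_filter)
  qed
  from tendsto_add[OF this main] show ?thesis
    by (simp add: diff_divide_distrib)
qed

text \<open>The difference quotient at time \<open>a\<close> is \<open>P a\<close> applied to the
  one at time \<open>0\<close>, and the contraction \<open>P a\<close> does not enlarge the
  error.\<close>

lemma P_quotient_bound:
  assumes a: "a \<ge> 0" and s: "s > 0" and h: "test_fun h"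
    and le: "\<And>q. \<bar>(P s h q - h q) / s - sublaplacian h q\<bar> \<le> \<epsilon>"
  shows "\<bar>(P (a + s) h g - P a h g) / s - P a (sublaplacian h) g\<bar> \<le> \<epsilon>"
proof -
  have bh: "bounded_borel h" and bD: "bounded_borel (sublaplacian h)"
    using h test_fun_sublaplacian bounded_borel_test_fun by blast+
  have s0: "s \<ge> 0" using s by simp
  have b1: "bounded_borel (\<lambda>q. P s h q - h q)"
    by (intro bounded_borel_diff bounded_borel_P s0 bh)
  have b2: "bounded_borel (\<lambda>q. (1 / s) * (P s h q - h q))"
    by (intro bounded_borel_mult bounded_borel_const b1)
  have "P a (\<lambda>q. (1 / s) * (P s h q - h q) - sublaplacian h q) g
      = (1 / s) * (P a (P s h) g - P a h g) - P a (sublaplacian h) g"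
    by (simp only: P_diff[OF a b2 bD] P_cmult[OF a] P_diff[OF a bounded_borel_P[OF s0 bh] bh])
  then have eq: "(P (a + s) h g - P a h g) / s - P a (sublaplacian h) g
      = P a (\<lambda>q. (1 / s) * (P s h q - h q) - sublaplacian h q) g"
    by (simp add: P_add_time[OF a s0 bh])
  show ?thesis unfolding eq using le by (intro P_bound a bounded_borel_diff b2 bD) simp
qed

text \<open>Two evaluations of the right derivative of \<open>s \<mapsto> P (t + s) h g\<close> at
  \<open>0\<close>: as the generator acting on \<open>P t h\<close>, where
  \<open>generator_at\<close> replaces compact support by boundedness, and as \<open>P t\<close> of
  the generator acting on \<open>h\<close>.\<close>

lemma sublaplacian_P:
  assumes t: "t \<ge> 0" and h: "test_fun h"
  shows "sublaplacian (P t h) g = P t (sublaplacian h) g"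
proof -
  have bh: "bounded_borel h" by (rule bounded_borel_test_fun[OF h])
  obtain M where M: "\<And>p. \<bar>h p\<bar> \<le> M" using test_fun_bounded[OF h] by blast
  have "((\<lambda>s. (P s (P t h) g - P t h g) / s) \<longlongrightarrow> sublaplacian (P t h) g) (at_right 0)"
    by (rule generator_at[OF smooth_P[OF t h] P_bound[OF t bh M]])
  moreover have "((\<lambda>s. (P s (P t h) g - P t h g) / s) \<longlongrightarrow> P t (sublaplacian h) g) (at_right 0)"
  proof (rule tendstoI)
    fix \<epsilon> :: real assume "\<epsilon> > 0"
    then obtain d where d: "d > 0"
      "\<And>s q. 0 < s \<Longrightarrow> s < d \<Longrightarrow> \<bar>(P s h q - h q) / s - sublaplacian h q\<bar> < \<epsilon> / 2"
      using P_uniform[OF h, of "\<epsilon> / 2"] by auto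
    have "dist ((P s (P t h) g - P t h g) / s) (P t (sublaplacian h) g) < \<epsilon>" if s: "0 < s" "s < d" for s
    proof -
      have "\<bar>(P (t + s) h g - P t h g) / s - P t (sublaplacian h) g\<bar> \<le> \<epsilon> / 2"
        using d(2)[OF s] by (intro P_quotient_bound t s(1) h less_imp_le)
      moreover have "P s (P t h) g = P (t + s) h g"
        using P_add_time[of s t h g] s(1) t bh by (simp add: add.commute)
      ultimately show ?thesis using \<open>\<epsilon> > 0\<close> by (simp add: dist_real_def)
    qed
    then show "\<forall>\<^sub>F s in at_right 0. dist ((P s (P t h) g - P t h g) / s) (P t (sublaplacian h) g) < \<epsilon>"
      using d(1) by (auto simp: eventually_at_right_field)
  qed
  ultimately show ?thesis by (rule tendsto_unique[OF trivial_limit_at_right_real])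
qed

lemma P_deriv:
  assumes t: "t > 0" and h: "test_fun h"
  shows "((\<lambda>s. P s h g) has_real_derivative P t (sublaplacian h) g) (at t)"
  unfolding DERIV_def
proof (rule LIM_I)
  fix \<epsilon> :: real assume \<epsilon>: "\<epsilon> > 0"
  obtain d where d: "d > 0"
      "\<And>s q. 0 < s \<Longrightarrow> s < d \<Longrightarrow> \<bar>(P s h q - h q) / s - sublaplacian h q\<bar> < \<epsilon> / 2"
    using P_uniform[OF h, of "\<epsilon> / 2"] \<epsilon> by auto
  obtain L d' where L: "L \<ge> 0" "d' > 0"
    "\<And>t s g. t \<ge> 0 \<Longrightarrow> 0 \<le> s \<Longrightarrow> s < d' \<Longrightarrow> \<bar>P (t + s) (sublaplacian h) g - P t (sublaplacian h) g\<bar> \<le> L * s"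
    using P_small_time[OF test_fun_sublaplacian[OF h]] by metis
  \<comment> \<open>The entry \<open>t\<close> keeps \<open>t + r\<close> nonnegative; the last
    entry makes \<open>L * s\<close> less than half of \<epsilon>, with \<open>L + 1\<close>
    avoiding a zero denominator.\<close>
  define e where "e = Min {d, d', t, \<epsilon> / (2 * (L + 1))}"
  have e: "e > 0" "e \<le> d" "e \<le> d'" "e \<le> t" "e \<le> \<epsilon> / (2 * (L + 1))"
    using d(1) L(1,2) t \<epsilon> by (auto simp: e_def)
  have "\<bar>(P (t + r) h g - P t h g) / r - P t (sublaplacian h) g\<bar> < \<epsilon>" if r: "r \<noteq> 0" "\<bar>r\<bar> < e" for r
  proof -
    \<comment> \<open>For negative \<open>r\<close> the quotient is a forward quotient based at the
      earlier time \<open>a = t + r\<close>; the Lipschitz bound for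
      \<open>P _ (sublaplacian h)\<close> moves its limit from \<open>a\<close> to
      \<open>t\<close>.\<close>
    define a s where "a = min t (t + r)" and "s = \<bar>r\<bar>"
    have as: "a \<ge> 0" "0 < s" "s < d" "s < d'" using r e by (auto simp: a_def s_def)
    have quot: "(P (t + r) h g - P t h g) / r = (P (a + s) h g - P a h g) / s"
      by (cases "r > 0") (use r in \<open>auto simp: a_def s_def field_simps\<close>)
    have "\<bar>(P (a + s) h g - P a h g) / s - P a (sublaplacian h) g\<bar> \<le> \<epsilon> / 2"
      using d(2)[OF as(2,3)] by (intro P_quotient_bound as h less_imp_le)
    moreover have "\<bar>P a (sublaplacian h) g - P t (sublaplacian h) g\<bar> \<le> L * s"
      using L(3)[of a s g] as L(1) by (cases "r > 0") (auto simp: a_def s_def abs_minus_commute)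
    moreover have "L * s < \<epsilon> / 2"
    proof -
      have "L * s \<le> (L + 1) * s" using as by (simp add: mult_right_mono)
      also have "\<dots> < (L + 1) * (\<epsilon> / (2 * (L + 1)))"
        using r e L(1) by (intro mult_strict_left_mono) (auto simp: s_def)
      also have "\<dots> = \<epsilon> / 2" using L(1) by (simp add: field_simps)
      finally show ?thesis .
    qed
    ultimately show ?thesis unfolding quot by linarith
  qed
  then show "\<exists>s>0. \<forall>r. r \<noteq> 0 \<and> norm (r - 0) < s \<longrightarrow>
      norm ((P (t + r) h g - P t h g) / r - P t (sublaplacian h) g) < \<epsilon>"
    using e(1) by (auto intro!: exI[of _ e])
qed


section \<open>Rotation invariance is preserved by \<open>P t\<close>\<close>

lemma continuous_P':
  "test_fun h \<Longrightarrow> continuous_on ({0..T} \<times> UNIV) (\<lambda>x. P (fst x) h (snd x))"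
  using continuous_P[unfolded case_prod_beta'] by (rule continuous_on_subset) auto

lemma P_0_test: "test_fun h \<Longrightarrow> P 0 h = h"
  by (intro ext P_0 smooth_measurable test_fun_smooth)

text \<open>At a fixed point \<open>q\<close> the rotation is a right invariant derivative with
  constant vector, so its action on \<open>P s f\<close> is \<open>P s\<close> of one test function
  and the time derivative is known. The growth is quadratic in \<open>q\<close>: one factor comes
  from the rotation field, one from the passage to the right invariant frame. Applied to
  \<open>- f\<close> as well, this gives equality.\<close>

lemma rot_P_nonpos:
  assumes t: "t \<ge> 0" and f: "test_fun f" and inv: "rot_invariant f" and ij: "i < j"
  shows "rot i j (P t f) p \<le> 0"
proof -
  interpret rf: bounded_linear "rot_field i j" by (rule bounded_linear_rot_field)
  define v where "v = rot_field i j"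
  obtain B where B: "B \<ge> 0" "\<And>p k v. \<bar>grad f (N2_mult p k) (v + comm_form v k)\<bar> \<le> B * norm v * (1 + norm p)"
    using test_fun_grad_bound[OF f] by blast
  obtain K where K: "K > 0" "\<And>p. norm (v p) \<le> norm p * K"
    using rf.pos_bounded by (auto simp: v_def)
  have rot_P: "rot i j (P s h) q = P s (RX (v q - comm_form (v q) q) h) q" if "s \<ge> 0" "test_fun h" for s h q
    unfolding rot_def v_def by (rule grad_P[OF that])
  let ?D = "\<lambda>s q. P s (sublaplacian (RX (v q - comm_form (v q) q) f)) q"
  show ?thesis
  proof (rule maximum_principle[where T = t and W = "\<lambda>s. rot i j (P s f)" and D = ?D and B = "B * K * 2"])
    have "continuous_on ({0..t} \<times> UNIV) (\<lambda>x. \<Sum>a\<in>UNIV.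
        (v (snd x) - comm_form (v (snd x)) (snd x)) $ a * P (fst x) (RX (axis a 1) f) (snd x))"
      unfolding v_def
      by (intro continuous_intros continuous_P' test_fun_RX f comm_form.continuous_on rf.continuous_on)
    then show "continuous_on ({0..t} \<times> UNIV) (\<lambda>(s, p). rot i j (P s f) p)"
      by (rule continuous_on_eq) (auto simp: rot_def v_def grad_P_sum f)
  next
    fix s q assume s: "0 \<le> s" "s \<le> t"
    let ?w = "v q - comm_form (v q) q"
    have "\<bar>RX ?w f q'\<bar> \<le> B * norm (v q) * (1 + norm q)" for q'
      using B(2)[of q "N2_mult (- q) q'" "v q", unfolded grad_right_field, unfolded N2_mult_inverse] .
    then have "\<bar>P s (RX ?w f) q\<bar> \<le> B * norm (v q) * (1 + norm q)"
      by (intro P_bound s bounded_borel_test_fun test_fun_RX f)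
    also have "\<dots> \<le> B * (norm q * K) * (1 + norm q)"
      using B(1) K by (intro mult_right_mono mult_left_mono) auto
    also have "\<dots> = B * K * (norm q + (norm q)\<^sup>2)" by (simp add: algebra_simps power2_eq_square)
    also have "\<dots> \<le> B * K * (2 * weight q)"
    proof (rule mult_left_mono)
      show "norm q + (norm q)\<^sup>2 \<le> 2 * weight q"
        using zero_le_power2[of "norm q - 1/2"]
        unfolding weight_def dot_square_norm by (simp add: power2_eq_square algebra_simps)
    qed (use B(1) K(1) in auto)
    finally show "rot i j (P s f) q \<le> B * K * 2 * weight q" by (simp add: rot_P s f)
  next
    fix q show "rot i j (P 0 f) q \<le> 0"
      using inv ij by (simp add: P_0_test f rot_invariant_def)
  next
    fix s assume s: "0 < s" "s \<le> t"
    show "smooth (rot i j (P s f))" using s by (intro smooth_rot smooth_P f) auto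
    fix q
    let ?w = "v q - comm_form (v q) q"
    have "((\<lambda>s. P s (RX ?w f) q) has_real_derivative ?D s q) (at s)"
      by (intro P_deriv s test_fun_RX f)
    then show "((\<lambda>s. rot i j (P s f) q) has_real_derivative ?D s q) (at s)"
      by (rule has_field_derivative_transform_within_open[of _ _ _ "{0<..}"]) (use s in \<open>auto simp: rot_P f\<close>)
    have "sublaplacian (RX ?w f) = RX ?w (sublaplacian f)"
      by (simp add: fun_eq_iff RX_sublaplacian test_fun_smooth f)
    then have "?D s q = rot i j (P s (sublaplacian f)) q"
      using s by (simp add: rot_P test_fun_sublaplacian f)
    also have "P s (sublaplacian f) = sublaplacian (P s f)"
      using s by (simp add: fun_eq_iff sublaplacian_P f)
    also have "rot i j (sublaplacian (P s f)) q = sublaplacian (rot i j (P s f)) q"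
      using s ij by (intro rot_sublaplacian smooth_P f) auto
    finally show "?D s q \<le> sublaplacian (rot i j (P s f)) q" by simp
  qed (use t in auto)
qed

lemma P_minus: "t \<ge> 0 \<Longrightarrow> P t (\<lambda>p. - f p) g = - P t f g"
  by (simp add: P_eq)

lemma rot_invariant_P:
  assumes t: "t \<ge> 0" and f: "test_fun f" and inv: "rot_invariant f"
  shows "rot_invariant (P t f)"
  unfolding rot_invariant_def
proof (intro allI impI)
  fix i j :: 'n and p assume ij: "i < j"
  have "rot_invariant (\<lambda>p. - f p)"
    using inv by (simp add: rot_invariant_def rot_minus test_fun_smooth f)
  then have "rot i j (P t (\<lambda>p. - f p)) p \<le> 0"
    by (intro rot_P_nonpos t test_fun_minus f ij)
  moreover have "P t (\<lambda>p. - f p) = (\<lambda>p. - P t f p)" using t by (simp add: fun_eq_iff P_minus)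
  ultimately have "rot i j (P t f) p \<ge> 0" by (simp add: rot_minus smooth_P t f)
  then show "rot i j (P t f) p = 0" using rot_P_nonpos[OF t f inv ij, of p] by simp
qed

lemma Gam_P:
  assumes t: "t \<ge> 0" and f: "test_fun f" "rot_invariant f" and h: "test_fun h" "rot_invariant h"
  shows "Gam (P t f) (P t h) p = (\<Sum>i\<in>UNIV. P t (RX (e_x i) f) p * P t (RX (e_x i) h) p)"
  using Gam_rot_invariant[OF smooth_P[OF t f(1)] smooth_P[OF t h(1)] rot_invariant_P[OF t f] rot_invariant_P[OF t h]]
  by (simp add: RX_P t f h)

section \<open>Inequalities for the averages \<open>P t\<close>\<close>

text \<open>Positivity of \<open>P t\<close> on \<open>(a - l * F)\<^sup>2 / F\<close>, with the
  optimal factor \<open>l = P t a g / P t F g\<close>; the lower bound on \<open>F\<close> keeps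
  both denominators positive.\<close>

lemma P_Cauchy_Schwarz:
  assumes t: "t \<ge> 0" and b: "bounded_borel a" "bounded_borel F" "bounded_borel (\<lambda>p. a p * a p / F p)"
    and F: "\<And>p. F p \<ge> \<epsilon>" "\<epsilon> > 0"
  shows "P t a g * P t a g \<le> P t (\<lambda>p. a p * a p / F p) g * P t F g"
proof -
  have Fpos: "F p > 0" for p using F(1)[of p] F(2) by linarith
  have "P t F g \<ge> \<epsilon>" using P_mono[OF t bounded_borel_const b(2) F(1), of g] P_const[OF t] by simp
  then have PF: "P t F g > 0" using F(2) by simp
  define l where "l = P t a g / P t F g"
  have "P t (\<lambda>p. (a p * a p / F p - 2 * l * a p) + l * l * F p) g \<ge> P t (\<lambda>_. 0) g"
  proof (rule P_mono[OF t bounded_borel_const])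
    show "bounded_borel (\<lambda>p. (a p * a p / F p - 2 * l * a p) + l * l * F p)"
      by (intro bounded_borel_add bounded_borel_diff bounded_borel_mult[OF bounded_borel_const] b)
    fix p
    have "(a p * a p / F p - 2 * l * a p) + l * l * F p = (a p - l * F p)\<^sup>2 / F p"
      using Fpos[of p] by (simp add: field_simps power2_eq_square)
    then show "0 \<le> (a p * a p / F p - 2 * l * a p) + l * l * F p"
      using Fpos[of p] by simp
  qed
  moreover have "P t (\<lambda>p. (a p * a p / F p - 2 * l * a p) + l * l * F p) g
      = (P t (\<lambda>p. a p * a p / F p) g - 2 * l * P t a g) + l * l * P t F g"
    by (simp only: P_add[OF t bounded_borel_diff[OF b(3) bounded_borel_mult[OF bounded_borel_const b(1)]]
          bounded_borel_mult[OF bounded_borel_const b(2)]]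
        P_diff[OF t b(3) bounded_borel_mult[OF bounded_borel_const b(1)]] P_cmult[OF t])
  ultimately have "0 \<le> (P t (\<lambda>p. a p * a p / F p) g - 2 * l * P t a g) + l * l * P t F g"
    using P_const[OF t] by simp
  also have "\<dots> = P t (\<lambda>p. a p * a p / F p) g - P t a g * P t a g / P t F g"
    using PF by (simp add: l_def field_simps)
  finally show ?thesis using PF by (simp add: field_simps)
qed

lemma P_nonneg: "t \<ge> 0 \<Longrightarrow> (\<And>p. f p \<ge> 0) \<Longrightarrow> P t f g \<ge> 0"
  by (simp add: P_eq)

end

lemma ge_minus_one_x_ln_x: "x * ln x \<ge> - 1" if "x > 0" for x :: real
proof -
  have "ln (1 / x) \<le> 1 / x - 1" using that by (intro ln_le_minus_one) simp
  then have "x * - ln x \<le> x * (1 / x - 1)" using that by (intro mult_left_mono) (auto simp: ln_div)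
  then show ?thesis using that by (simp add: algebra_simps)
qed

lemma sublaplacian_const_add_mult:
  "smooth f \<Longrightarrow> smooth h \<Longrightarrow> sublaplacian (\<lambda>p. (c + f p) * h p) p
    = (c + f p) * sublaplacian h p + h p * sublaplacian f p + 2 * Gam f h p"
  by (subst sublaplacian_mult) (auto simp: sublaplacian_add Gam_def X_add smooth_const)

section \<open>Logarithmic Sobolev and isoperimetric inequalities\<close>

context heat
begin

text \<open>The comparison function is \<open>P s (\<phi> f) - \<phi> (P s f) - s * P s h1\<close>.
  Its heat operator is the \<Gamma> of \<open>P s f\<close> times the second derivative of \<phi> at
  \<open>P s f\<close>, minus \<open>P s h1\<close>. Cauchy-Schwarz with weight
  \<open>f + \<epsilon>\<close>, applied to each right invariant derivative, shows that this is not
  positive.\<close>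

lemma log_sobolev_regularised:
  assumes t: "t \<ge> 0" and f: "test_fun f" "rot_invariant f" and pos: "\<And>p. f p \<ge> 0" and \<epsilon>: "\<epsilon> > 0"
  shows "P t (\<lambda>p. (f p + \<epsilon>) * ln (f p + \<epsilon>)) g - (P t f g + \<epsilon>) * ln (P t f g + \<epsilon>)
    \<le> t * P t (\<lambda>p. Gam f f p / (f p + \<epsilon>)) g"
proof -
  \<comment> \<open>Subtracting \<open>\<epsilon> * ln \<epsilon>\<close> gives
    \<open>\<phi> 0 = 0\<close>, so that \<phi> of \<open>f\<close> is again compactly
    supported.\<close>
  define \<phi> where "\<phi> x = (x + \<epsilon>) * ln (x + \<epsilon>) - \<epsilon> * ln \<epsilon>" for x
  define h0 where "h0 p = \<phi> (f p)" for p
  define h1 where "h1 p = Gam f f p / (f p + \<epsilon>)" for p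
  have sf: "smooth f" using f(1) by (rule test_fun_smooth)
  have fpos: "f p + \<epsilon> > 0" for p using pos[of p] \<epsilon> by linarith
  have h0: "test_fun h0"
  proof -
    have "smooth h0" unfolding h0_def[abs_def] \<phi>_def
      by (intro smooth_diff smooth_mult smooth_add smooth_const smooth_ln sf fpos)
    moreover obtain R where "\<And>p. norm p > R \<Longrightarrow> f p = 0"
      using f(1) by (auto simp: test_fun_def compactly_supported_iff)
    then have "\<forall>p. norm p > R \<longrightarrow> h0 p = 0" by (simp add: h0_def \<phi>_def)
    ultimately show ?thesis unfolding test_fun_def compactly_supported_iff by blast
  qed
  have h1: "test_fun h1"
  proof -
    have "test_fun (\<lambda>p. Gam f f p * inverse (f p + \<epsilon>))"
      by (intro test_fun_mult_right test_fun_Gam f(1) sf smooth_inverse smooth_add smooth_const)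
        (use fpos in \<open>metis less_irrefl\<close>)
    then show ?thesis by (simp add: h1_def[abs_def] divide_inverse)
  qed
  have h1_nonneg: "h1 p \<ge> 0" for p using fpos[of p] Gam_nonneg[of f p] by (simp add: h1_def)
  have u: "P s f p + \<epsilon> > 0" if "s \<ge> 0" for s p
    using P_nonneg[of s f p] that pos \<epsilon> by (simp add: add_nonneg_pos)
  have \<phi>1: "(\<phi> has_real_derivative ln (x + \<epsilon>) + 1) (at x)" if "x + \<epsilon> > 0" for x
    unfolding \<phi>_def using that by (auto intro!: derivative_eq_intros)
  have \<phi>2: "((\<lambda>x. ln (x + \<epsilon>) + 1) has_real_derivative 1 / (x + \<epsilon>)) (at x)" if "x + \<epsilon> > 0" for x
    using that by (auto intro!: derivative_eq_intros)
  obtain M where M: "\<And>p. \<bar>h0 p\<bar> \<le> M" using test_fun_bounded[OF h0] by blast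
  let ?W = "\<lambda>s p. P s h0 p - \<phi> (P s f p) - s * P s h1 p"
  let ?D = "\<lambda>s p. P s (sublaplacian h0) p - (ln (P s f p + \<epsilon>) + 1) * P s (sublaplacian f) p
      - (s * P s (sublaplacian h1) p + P s h1 p)"
  have "?W t g \<le> 0"
  proof (rule maximum_principle[where T = t and W = ?W and D = ?D and B = "\<bar>M\<bar> + 1 + \<bar>\<epsilon> * ln \<epsilon>\<bar>"])
    have "P (fst x) f (snd x) + \<epsilon> \<noteq> 0" if "x \<in> {0..t} \<times> UNIV" for x
      using u[of "fst x" "snd x"] that by auto
    then show "continuous_on ({0..t} \<times> UNIV) (\<lambda>(s, p). ?W s p)"
      unfolding case_prod_beta' \<phi>_def by (intro continuous_intros continuous_P' f h0 h1) auto
  next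
    fix s p assume s: "0 \<le> s" "s \<le> t"
    have "P s h0 p \<le> M" using P_bound[OF s(1) bounded_borel_test_fun[OF h0] M, of p] by simp
    moreover have "\<phi> (P s f p) \<ge> - 1 - \<epsilon> * ln \<epsilon>"
      using ge_minus_one_x_ln_x[OF u[OF s(1), of p]] by (simp add: \<phi>_def)
    moreover have "s * P s h1 p \<ge> 0" using s P_nonneg[of s h1 p] h1_nonneg by simp
    ultimately have "?W s p \<le> \<bar>M\<bar> + 1 + \<bar>\<epsilon> * ln \<epsilon>\<bar>" by linarith
    also have "\<dots> * 1 \<le> (\<bar>M\<bar> + 1 + \<bar>\<epsilon> * ln \<epsilon>\<bar>) * weight p"
      by (intro mult_left_mono weight_ge_1) auto
    finally show "?W s p \<le> (\<bar>M\<bar> + 1 + \<bar>\<epsilon> * ln \<epsilon>\<bar>) * weight p" by simp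
  next
    fix p show "?W 0 p \<le> 0" by (simp add: P_0_test f h0 h0_def)
  next
    fix s assume s: "0 < s" "s \<le> t"
    then have s0: "s \<ge> 0" by simp
    have smu: "smooth (P s f)" by (rule smooth_P[OF s0 f(1)])
    have sm\<phi>: "smooth (\<lambda>p. \<phi> (P s f p))" unfolding \<phi>_def
      by (intro smooth_diff smooth_mult smooth_add smooth_const smooth_ln smu u s0)
    show "smooth (?W s)"
      by (intro smooth_diff smooth_mult smooth_const smooth_P s0 h0 h1 sm\<phi>)
    fix p
    show "((\<lambda>s. ?W s p) has_real_derivative ?D s p) (at s)"
      by (rule derivative_eq_intros DERIV_chain2[OF \<phi>1] P_deriv s f h0 h1 u s0 refl)+ simp
    have "sublaplacian (\<lambda>p. \<phi> (P s f p)) p =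
        (ln (P s f p + \<epsilon>) + 1) * sublaplacian (P s f) p + 1 / (P s f p + \<epsilon>) * Gam (P s f) (P s f) p"
      by (rule sublaplacian_chain[OF smu \<phi>1[OF u[OF s0]] \<phi>2[OF u[OF s0]]])
    moreover have "sublaplacian (?W s) p = sublaplacian (P s h0) p
        - sublaplacian (\<lambda>p. \<phi> (P s f p)) p - s * sublaplacian (P s h1) p"
      by (simp add: sublaplacian_diff sublaplacian_cmult smooth_diff smooth_mult smooth_const smooth_P s0 h0 h1 sm\<phi>)
    moreover have "Gam (P s f) (P s f) p \<le> P s h1 p * (P s f p + \<epsilon>)"
    proof -
      have tRX: "test_fun (RX (e_x i) f)" for i by (rule test_fun_RX[OF f(1)])
      have sq: "test_fun (\<lambda>p. RX (e_x i) f p * RX (e_x i) f p / (f p + \<epsilon>))" for i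
        unfolding divide_inverse
        by (intro test_fun_mult_right tRX smooth_inverse smooth_add smooth_const sf test_fun_smooth)
          (use fpos in \<open>metis less_irrefl\<close>)
      have bF: "bounded_borel (\<lambda>p. f p + \<epsilon>)"
        by (intro bounded_borel_add bounded_borel_const bounded_borel_test_fun f)
      have "Gam (P s f) (P s f) p = (\<Sum>i\<in>UNIV. P s (RX (e_x i) f) p * P s (RX (e_x i) f) p)"
        by (rule Gam_P[OF s0 f f])
      also have "\<dots> \<le> (\<Sum>i\<in>UNIV. P s (\<lambda>p. RX (e_x i) f p * RX (e_x i) f p / (f p + \<epsilon>)) p * P s (\<lambda>p. f p + \<epsilon>) p)"
        by (intro sum_mono P_Cauchy_Schwarz[of s _ _ \<epsilon>] s0 bF bounded_borel_test_fun tRX sq) (use pos \<epsilon> in auto)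
      also have "\<dots> = P s (\<lambda>p. \<Sum>i\<in>UNIV. RX (e_x i) f p * RX (e_x i) f p / (f p + \<epsilon>)) p * P s (\<lambda>p. f p + \<epsilon>) p"
        by (simp add: P_sum s0 bounded_borel_test_fun sq sum_distrib_right)
      also have "P s (\<lambda>p. f p + \<epsilon>) p = P s f p + \<epsilon>"
        by (simp add: P_add s0 bounded_borel_test_fun f bounded_borel_const P_const)
      also have "(\<lambda>p. \<Sum>i\<in>UNIV. RX (e_x i) f p * RX (e_x i) f p / (f p + \<epsilon>)) = h1"
        by (simp add: h1_def fun_eq_iff Gam_rot_invariant_diag[OF f(2)] sum_divide_distrib)
      finally show ?thesis .
    qed
    then have "1 / (P s f p + \<epsilon>) * Gam (P s f) (P s f) p \<le> P s h1 p"
      using u[OF s0, of p] by (simp add: field_simps)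
    ultimately show "?D s p \<le> sublaplacian (?W s) p"
      by (simp add: sublaplacian_P s0 h0 h1 f)
  qed (use t in auto)
  moreover have "P t h0 g = P t (\<lambda>p. (f p + \<epsilon>) * ln (f p + \<epsilon>)) g - \<epsilon> * ln \<epsilon>"
  proof -
    have "(\<lambda>p. (f p + \<epsilon>) * ln (f p + \<epsilon>)) = (\<lambda>p. h0 p + \<epsilon> * ln \<epsilon>)" by (simp add: h0_def \<phi>_def)
    then show ?thesis by (simp add: P_add P_const t bounded_borel_test_fun h0 bounded_borel_const)
  qed
  ultimately show ?thesis by (simp add: \<phi>_def h1_def[abs_def])
qed

text \<open>Under \<open>d/ds - \<Delta>\<close>, the square of \<open>c + P s f\<close> yields
  \<open>- 2 * \<Gamma>\<close>, while \<open>2 * s * \<Gamma>\<close> yields at most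
  \<open>2 * \<Gamma>\<close>, because \<Gamma> is a sum of squares of solutions. Their sum thus
  stays below \<open>P s\<close> of the square of \<open>c + f\<close>, which is at most
  \<open>1\<close>. The constant \<open>c\<close> admits bounded functions that are constant, not
  zero, near infinity.\<close>

lemma reverse_poincare:
  assumes t: "t \<ge> 0" and f: "test_fun f" "rot_invariant f" and bound: "\<And>p. \<bar>c + f p\<bar> \<le> 1"
  shows "2 * t * Gam (P t f) (P t f) g \<le> 1"
proof -
  \<comment> \<open>The square of \<open>c + f\<close> minus its value \<open>c * c\<close> at
    infinity: the part that is a test function.\<close>
  define h where "h p = (2 * c + f p) * f p" for p
  define a where "a i = RX (e_x i) f" for i
  have sf: "smooth f" using f(1) by (rule test_fun_smooth)
  have h: "test_fun h" unfolding h_def[abs_def] by (intro test_fun_mult_left smooth_add smooth_const sf f)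
  have a: "test_fun (a i)" for i unfolding a_def by (intro test_fun_RX f)
  have Gam_u: "Gam (P s f) (P s f) p = (\<Sum>i\<in>UNIV. P s (a i) p * P s (a i) p)" if "s \<ge> 0" for s p
    using Gam_P[OF that f f] by (simp add: a_def)
  have sq: "P s (\<lambda>p. (c + f p) * (c + f p)) p = c * c + P s h p" if "s \<ge> 0" for s p
  proof -
    have "(\<lambda>p. (c + f p) * (c + f p)) = (\<lambda>p. c * c + h p)" by (simp add: h_def algebra_simps)
    then show ?thesis by (simp add: P_add P_const that bounded_borel_test_fun h bounded_borel_const)
  qed
  have bcf: "bounded_borel (\<lambda>p. c + f p)"
    by (intro bounded_borel_add bounded_borel_const bounded_borel_test_fun f)
  have cu: "\<bar>c + P s f p\<bar> \<le> 1" if "s \<ge> 0" for s p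
    using P_bound[OF that bcf bound, of p] by (simp add: P_add P_const that bounded_borel_test_fun f bounded_borel_const)
  from test_fun_bounded_family[OF a]
  obtain A where A': "\<forall>i. A i \<ge> 0 \<and> (\<forall>p. \<bar>a i p\<bar> \<le> A i)" ..
  then have A: "A i \<ge> 0" "\<bar>a i p\<bar> \<le> A i" for i p by simp_all
  let ?W = "\<lambda>s p. 2 * s * (\<Sum>i\<in>UNIV. P s (a i) p * P s (a i) p) + (c + P s f p) * (c + P s f p) - (c * c + P s h p)"
  let ?D = "\<lambda>s p. 2 * (\<Sum>i\<in>UNIV. P s (a i) p * P s (a i) p)
     + 2 * s * (\<Sum>i\<in>UNIV. 2 * (P s (a i) p * P s (sublaplacian (a i)) p))
     + 2 * (c + P s f p) * P s (sublaplacian f) p - P s (sublaplacian h) p"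
  let ?B = "2 * t * (\<Sum>i\<in>UNIV. A i * A i) + 1"
  have "?W t g \<le> 0"
  proof (rule maximum_principle[where T = t and W = ?W and D = ?D and B = ?B])
    show "continuous_on ({0..t} \<times> UNIV) (\<lambda>(s, p). ?W s p)"
      unfolding case_prod_beta' by (intro continuous_intros continuous_P' f h a)
  next
    fix s p assume s: "0 \<le> s" "s \<le> t"
    have sqa: "P s (a i) p * P s (a i) p \<le> A i * A i" for i
    proof -
      have "\<bar>P s (a i) p\<bar> \<le> A i"
        using A by (intro P_bound s bounded_borel_test_fun a)
      then have "\<bar>P s (a i) p\<bar> * \<bar>P s (a i) p\<bar> \<le> A i * A i"
        using A(1) by (intro mult_mono) auto
      then show ?thesis by simp
    qed
    have "2 * s * (\<Sum>i\<in>UNIV. P s (a i) p * P s (a i) p) \<le> 2 * t * (\<Sum>i\<in>UNIV. A i * A i)"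
      by (rule mult_mono) (use s in \<open>auto intro: sum_mono sum_nonneg sqa\<close>)
    moreover have "(c + P s f p) * (c + P s f p) \<le> 1"
      using cu[OF s(1), of p] by (simp add: abs_square_le_1 flip: power2_eq_square)
    moreover have "c * c + P s h p \<ge> 0"
      unfolding sq[OF s(1), symmetric] by (rule P_nonneg[OF s(1)]) simp
    ultimately have "?W s p \<le> ?B * 1" unfolding mult_1_right by linarith
    also have "\<dots> \<le> ?B * weight p"
      using A t by (intro mult_left_mono weight_ge_1 add_nonneg_nonneg mult_nonneg_nonneg sum_nonneg) auto
    finally show "?W s p \<le> ?B * weight p" .
  next
    fix p show "?W 0 p \<le> 0" by (simp add: P_0_test f h h_def algebra_simps)
  next
    fix s assume s: "0 < s" "s \<le> t"
    then have s0: "s \<ge> 0" by simp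
    note sm = smooth_P[OF s0 f(1)] smooth_P[OF s0 h] smooth_P[OF s0 a]
    show "smooth (?W s)"
      by (intro smooth_diff smooth_add smooth_mult smooth_sum smooth_const sm)
    fix p
    show "((\<lambda>s. ?W s p) has_real_derivative ?D s p) (at s)"
      by (rule derivative_eq_intros P_deriv s f h a refl)+ (simp add: algebra_simps)
    have "sublaplacian (\<lambda>p. P s (a i) p * P s (a i) p) p
       = 2 * (P s (a i) p * P s (sublaplacian (a i)) p) + 2 * Gam (P s (a i)) (P s (a i)) p" for i
      by (simp add: sublaplacian_mult sm sublaplacian_P s0 a)
    then have "sublaplacian (\<lambda>p. \<Sum>i\<in>UNIV. P s (a i) p * P s (a i) p) p
      = (\<Sum>i\<in>UNIV. 2 * (P s (a i) p * P s (sublaplacian (a i)) p)) + (\<Sum>i\<in>UNIV. 2 * Gam (P s (a i)) (P s (a i)) p)"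
      by (simp add: sublaplacian_sum smooth_mult sm sum.distrib)
    moreover have "sublaplacian (\<lambda>p. (c + P s f p) * (c + P s f p)) p
      = 2 * (c + P s f p) * P s (sublaplacian f) p + 2 * Gam (P s f) (P s f) p"
    proof -
      have "X i (\<lambda>p. c + P s f p) q = X i (P s f) q" for i q by (subst X_add) (auto intro: sm)
      then show ?thesis
        by (subst sublaplacian_mult) (auto intro!: sm simp: sublaplacian_add sm sublaplacian_P s0 f Gam_def smooth_const)
    qed
    moreover have "sublaplacian (?W s) p = 2 * s * sublaplacian (\<lambda>p. \<Sum>i\<in>UNIV. P s (a i) p * P s (a i) p) p
       + sublaplacian (\<lambda>p. (c + P s f p) * (c + P s f p)) p - sublaplacian (P s h) p"
      by (simp add: sublaplacian_diff sublaplacian_add sublaplacian_cmult smooth_add smooth_mult smooth_sum smooth_const sm)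
    moreover have "(\<Sum>i\<in>UNIV. 2 * Gam (P s (a i)) (P s (a i)) p) \<ge> 0"
      by (intro sum_nonneg mult_nonneg_nonneg Gam_nonneg) auto
    then have "2 * s * (\<Sum>i\<in>UNIV. 2 * Gam (P s (a i)) (P s (a i)) p) \<ge> 0" using s0 by simp
    ultimately show "?D s p \<le> sublaplacian (?W s) p"
      by (simp only: Gam_u[OF s0] sublaplacian_P[OF s0 h] distrib_left)
  qed (use t in auto)
  moreover have "c * c + P t h g \<le> 1"
  proof -
    have "P t (\<lambda>p. (c + f p) * (c + f p)) g \<le> P t (\<lambda>_. 1) g"
      using bound by (intro P_mono t bounded_borel_mult bcf bounded_borel_const)
        (simp add: abs_square_le_1 flip: power2_eq_square)
    then show ?thesis by (simp add: sq[OF t] P_const[OF t])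
  qed
  moreover have "(c + P t f g) * (c + P t f g) \<ge> 0" by simp
  ultimately show ?thesis unfolding Gam_u[OF t] by linarith
qed

text \<open>The heat operator of the covariance is \<open>2 * Gam (P s h) (P s f)\<close>. The
  reverse Poincare bound for \<open>h\<close> makes it at most \<open>sqrt 2 / sqrt s\<close> times
  the average of the regularised gradient of \<open>f\<close>, and \<open>sqrt 2 / sqrt s\<close> is
  the time derivative of \<open>2 * sqrt 2 * sqrt s\<close>.\<close>

lemma covariance_bound:
  assumes t: "t \<ge> 0" and f: "test_fun f" "rot_invariant f" and h: "test_fun h" "rot_invariant h"
    and bound: "\<And>p. \<bar>c + h p\<bar> \<le> 1" and \<epsilon>: "\<epsilon> > 0"
  shows "P t (\<lambda>p. (c + h p) * f p) g - (c + P t h g) * P t f g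
    \<le> 2 * sqrt 2 * sqrt t * P t (\<lambda>p. sqrt (Gam f f p + \<epsilon>\<^sup>2)) g"
proof -
  define k where "k p = (c + h p) * f p" for p
  \<comment> \<open>The shift by \<epsilon> squared makes the root smooth where the gradient
    vanishes; subtracting \<epsilon> restores compact support.\<close>
  define G where "G p = sqrt (Gam f f p + \<epsilon>\<^sup>2) - \<epsilon>" for p
  have sf: "smooth f" and sh: "smooth h" using f h by (auto intro: test_fun_smooth)
  have k: "test_fun k" unfolding k_def[abs_def] by (intro test_fun_mult_left smooth_add smooth_const sh f)
  have G: "test_fun G"
  proof -
    have "Gam f f p + \<epsilon>\<^sup>2 > 0" for p using Gam_nonneg[of f p] \<epsilon> by (simp add: add_nonneg_pos)
    then have "smooth G" unfolding G_def[abs_def]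
      by (intro smooth_diff smooth_const smooth_sqrt smooth_add smooth_Gam sf)
    moreover obtain R where "\<And>p. norm p > R \<Longrightarrow> Gam f f p = 0"
      using test_fun_Gam[OF f(1) sf] by (auto simp: test_fun_def compactly_supported_iff)
    then have "\<forall>p. norm p > R \<longrightarrow> G p = 0" using \<epsilon> by (simp add: G_def)
    ultimately show ?thesis unfolding test_fun_def compactly_supported_iff by blast
  qed
  have bch: "bounded_borel (\<lambda>p. c + h p)"
    by (intro bounded_borel_add bounded_borel_const bounded_borel_test_fun h)
  have cv: "\<bar>c + P s h p\<bar> \<le> 1" if "s \<ge> 0" for s p
    using P_bound[OF that bch bound, of p] by (simp add: P_add P_const that bounded_borel_test_fun h bounded_borel_const)
  have PG: "P s G p + \<epsilon> = P s (\<lambda>p. sqrt (Gam f f p + \<epsilon>\<^sup>2)) p" if "s \<ge> 0" for s p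
  proof -
    have "(\<lambda>p. sqrt (Gam f f p + \<epsilon>\<^sup>2)) = (\<lambda>p. G p + \<epsilon>)" by (simp add: G_def)
    then show ?thesis by (simp add: P_add P_const that bounded_borel_test_fun G bounded_borel_const)
  qed
  obtain Mk where Mk: "Mk \<ge> 0" "\<And>p. \<bar>k p\<bar> \<le> Mk" using test_fun_bounded[OF k] by blast
  obtain Mf where Mf: "Mf \<ge> 0" "\<And>p. \<bar>f p\<bar> \<le> Mf" using test_fun_bounded[OF f(1)] by blast
  let ?K = "2 * sqrt 2 :: real"
  let ?W = "\<lambda>s p. P s k p - (c + P s h p) * P s f p - ?K * sqrt s * (P s G p + \<epsilon>)"
  let ?D = "\<lambda>s p. P s (sublaplacian k) p
     - ((c + P s h p) * P s (sublaplacian f) p + P s (sublaplacian h) p * P s f p)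
     - (?K * sqrt s * P s (sublaplacian G) p + ?K * (inverse (sqrt s) / 2) * (P s G p + \<epsilon>))"
  have "?W t g \<le> 0"
  proof (rule maximum_principle[where T = t and W = ?W and D = ?D and B = "Mk + Mf"])
    show "continuous_on ({0..t} \<times> UNIV) (\<lambda>(s, p). ?W s p)"
      unfolding case_prod_beta' by (intro continuous_intros continuous_P' f h k G)
  next
    fix s p assume s: "0 \<le> s" "s \<le> t"
    have "P s k p \<le> Mk" using P_bound[OF s(1) bounded_borel_test_fun[OF k] Mk(2), of p] by simp
    moreover have "\<bar>(c + P s h p) * P s f p\<bar> \<le> 1 * Mf"
      unfolding abs_mult using cv[OF s(1)] P_bound[OF s(1) bounded_borel_test_fun[OF f(1)] Mf(2)]
      by (intro mult_mono) auto
    then have "- ((c + P s h p) * P s f p) \<le> Mf" by (simp only: abs_le_iff mult_1)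
    moreover have "?K * sqrt s * (P s G p + \<epsilon>) \<ge> 0"
      unfolding PG[OF s(1)] using s Gam_nonneg[of f] by (intro mult_nonneg_nonneg P_nonneg) auto
    ultimately have "?W s p \<le> (Mk + Mf) * 1" unfolding mult_1_right by linarith
    also have "\<dots> \<le> (Mk + Mf) * weight p"
      using Mk Mf by (intro mult_left_mono weight_ge_1) auto
    finally show "?W s p \<le> (Mk + Mf) * weight p" .
  next
    fix p show "?W 0 p \<le> 0" by (simp add: P_0_test f h k k_def)
  next
    fix s assume s: "0 < s" "s \<le> t"
    then have s0: "s \<ge> 0" by simp
    note sm = smooth_P[OF s0 f(1)] smooth_P[OF s0 h(1)] smooth_P[OF s0 k] smooth_P[OF s0 G]
    show "smooth (?W s)"
      by (intro smooth_diff smooth_add smooth_mult smooth_const sm)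
    fix p
    show "((\<lambda>s. ?W s p) has_real_derivative ?D s p) (at s)"
      by (rule derivative_eq_intros P_deriv s f h k G DERIV_real_sqrt refl)+ (simp add: algebra_simps)
    have "sublaplacian (?W s) p = sublaplacian (P s k) p
        - ((c + P s h p) * sublaplacian (P s f) p + P s f p * sublaplacian (P s h) p + 2 * Gam (P s h) (P s f) p)
        - ?K * sqrt s * sublaplacian (P s G) p"
      by (simp add: sublaplacian_diff sublaplacian_add sublaplacian_cmult sublaplacian_const_add_mult
          smooth_add smooth_mult smooth_diff smooth_const sm)
    moreover have "2 * Gam (P s h) (P s f) p \<le> ?K * (inverse (sqrt s) / 2) * (P s G p + \<epsilon>)"
    proof -
      define b where "b i = P s (RX (e_x i) h) p" for i
      have bb: "bounded_borel (\<lambda>q. sqrt (Gam f f q + \<epsilon>\<^sup>2))"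
      proof -
        have "bounded_borel (\<lambda>q. G q + \<epsilon>)" by (intro bounded_borel_add bounded_borel_const bounded_borel_test_fun G)
        then show ?thesis by (simp add: G_def)
      qed
      have "Gam (P s h) (P s h) p = (\<Sum>i\<in>UNIV. (b i)\<^sup>2)"
        using Gam_P[OF s0 h h] by (simp add: b_def power2_eq_square)
      then have b2: "(\<Sum>i\<in>UNIV. (b i)\<^sup>2) \<le> 1 / (2 * s)"
        using reverse_poincare[OF s0 h bound, of p] s by (simp add: field_simps)
      \<comment> \<open>The numbers \<open>b i\<close> are frozen at \<open>p\<close>, so the sum
        can be moved inside \<open>P s\<close> and Cauchy-Schwarz used pointwise in
        \<open>q\<close>.\<close>
      have "Gam (P s h) (P s f) p = P s (\<lambda>q. \<Sum>i\<in>UNIV. b i * RX (e_x i) f q) p"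
        using Gam_P[OF s0 h f] by (simp add: b_def P_sum P_cmult s0 bounded_borel_mult bounded_borel_const
            bounded_borel_test_fun test_fun_RX f)
      also have "\<dots> \<le> P s (\<lambda>q. sqrt (1 / (2 * s)) * sqrt (Gam f f q + \<epsilon>\<^sup>2)) p"
      proof (rule P_mono[OF s0])
        show "bounded_borel (\<lambda>q. \<Sum>i\<in>UNIV. b i * RX (e_x i) f q)"
          by (intro bounded_borel_test_fun test_fun_sum test_fun_mult_left smooth_const test_fun_RX f)
        show "bounded_borel (\<lambda>q. sqrt (1 / (2 * s)) * sqrt (Gam f f q + \<epsilon>\<^sup>2))"
          by (intro bounded_borel_mult bounded_borel_const bb)
        fix q
        have "(\<Sum>i\<in>UNIV. b i * RX (e_x i) f q)\<^sup>2 \<le> (\<Sum>i\<in>UNIV. (b i)\<^sup>2) * (\<Sum>i\<in>UNIV. (RX (e_x i) f q)\<^sup>2)"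
          by (rule Cauchy_Schwarz_ineq_sum)
        also have "(\<Sum>i\<in>UNIV. (RX (e_x i) f q)\<^sup>2) = Gam f f q"
          by (simp add: Gam_rot_invariant_diag[OF f(2)] power2_eq_square)
        also have "(\<Sum>i\<in>UNIV. (b i)\<^sup>2) * Gam f f q \<le> 1 / (2 * s) * (Gam f f q + \<epsilon>\<^sup>2)"
          using b2 Gam_nonneg[of f q] s by (intro mult_mono) auto
        finally show "(\<Sum>i\<in>UNIV. b i * RX (e_x i) f q) \<le> sqrt (1 / (2 * s)) * sqrt (Gam f f q + \<epsilon>\<^sup>2)"
          unfolding real_sqrt_mult[symmetric] by (rule real_le_rsqrt)
      qed
      also have "\<dots> = sqrt (1 / (2 * s)) * (P s G p + \<epsilon>)" by (simp add: P_cmult PG s0)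
      also have "sqrt (1 / (2 * s)) = sqrt 2 * inverse (sqrt s) / 2"
        using s by (simp add: real_sqrt_divide real_sqrt_mult field_simps)
      finally show ?thesis by simp
    qed
    ultimately show "?D s p \<le> sublaplacian (?W s) p"
      by (simp add: sublaplacian_P s0 f h k G mult.commute)
  qed (use t in auto)
  then show ?thesis by (simp add: PG[OF t] k_def[abs_def])
qed

end

section \<open>Removing the regularisation\<close>

text \<open>Glaeser's inequality: Taylor's formula along the integral line bounds \<open>f\<close>
  above by a quadratic with leading coefficient \<open>M / 2\<close>, and \<open>x\<close> is where
  this quadratic is least; nonnegativity of \<open>f\<close> there gives the claim.\<close>

lemma X_square_le:
  assumes f: "smooth f" and pos: "\<And>p. f p \<ge> 0" and M: "\<And>p. \<bar>X i (X i f) p\<bar> \<le> M" "M > 0"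
  shows "X i f p * X i f p \<le> 2 * M * f p"
proof -
  define v where "v = left_field i p"
  define d where "d m s = (X i ^^ m) f (p + s *\<^sub>R v)" for m and s :: real
  have sm: "smooth ((X i ^^ m) f)" for m by (induction m) (auto intro: f smooth_X)
  define x where "x = - X i f p / M"
  have "\<exists>t. \<bar>t\<bar> \<le> \<bar>x\<bar> \<and> d 0 x = (\<Sum>m<2. d m 0 / fact m * x ^ m) + d 2 t / fact 2 * x ^ 2"
  proof (rule Maclaurin_all_le)
    show "\<forall>m x. (d m has_real_derivative d (Suc m) x) (at x)"
      using DERIV_left_line[OF sm] by (simp add: d_def[abs_def] v_def)
  qed simp
  then obtain t where "d 0 x = (\<Sum>m<2. d m 0 / fact m * x ^ m) + d 2 t / fact 2 * x ^ 2" by blast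
  then have eq: "f (p + x *\<^sub>R v) = f p + X i f p * x + X i (X i f) (p + t *\<^sub>R v) / 2 * x\<^sup>2"
    by (simp add: d_def numeral_2_eq_2)
  have "X i (X i f) (p + t *\<^sub>R v) / 2 * x\<^sup>2 \<le> M / 2 * x\<^sup>2"
    using M(1)[of "p + t *\<^sub>R v"] by (intro mult_right_mono) (auto simp: abs_le_iff)
  then have "0 \<le> f p + X i f p * x + M / 2 * x\<^sup>2"
    using pos[of "p + x *\<^sub>R v"] eq by linarith
  also have "\<dots> = f p - X i f p * X i f p / (2 * M)"
    using M(2) by (simp add: x_def field_simps power2_eq_square)
  finally show ?thesis using M(2) by (simp add: field_simps)
qed

text \<open>Makes \<open>Gam f f p / f p\<close> a bounded function although \<open>f\<close> has
  zeros, and forces \<Gamma> to vanish at those zeros.\<close>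

lemma Gam_le:
  assumes f: "test_fun f" and pos: "\<And>p. f p \<ge> 0"
  shows "\<exists>C\<ge>0. \<forall>p. Gam f f p \<le> C * f p"
proof -
  from test_fun_bounded_family[of "\<lambda>i. X i (X i f)"]
  obtain M where M': "\<forall>i. M i \<ge> 0 \<and> (\<forall>p. \<bar>X i (X i f) p\<bar> \<le> M i)"
    using test_fun_X[OF test_fun_X[OF f]] by blast
  then have M: "M i \<ge> 0" "\<bar>X i (X i f) p\<bar> \<le> M i" for i p by simp_all
  \<comment> \<open>\<open>M i + 1\<close> because \<open>X_square_le\<close> asks for a strictly
    positive bound.\<close>
  have "X i f p * X i f p \<le> 2 * (M i + 1) * f p" for i p
    by (rule X_square_le[OF test_fun_smooth[OF f] pos]) (use M[of i] in \<open>auto simp: add_increasing2 add_nonneg_pos\<close>)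
  then have "Gam f f p \<le> (\<Sum>i\<in>UNIV. 2 * (M i + 1)) * f p" for p
    unfolding Gam_def sum_distrib_right by (intro sum_mono)
  moreover have "(\<Sum>i\<in>UNIV. 2 * (M i + 1)) \<ge> 0" using M by (intro sum_nonneg) simp
  ultimately show ?thesis by blast
qed

text \<open>At \<open>x = 0\<close> the limit \<open>x * ln x\<close> is \<open>0\<close>, in
  accordance with the usual convention, and the statement is that \<open>ln n / n\<close> tends to
  \<open>0\<close>.\<close>

lemma tendsto_x_ln_x_shift:
  assumes "x \<ge> 0"
  shows "(\<lambda>n. (x + inverse (real (Suc n))) * ln (x + inverse (real (Suc n)))) \<longlonglongrightarrow> x * ln x"
proof (cases "x = 0")
  case True
  have "(\<lambda>n. ln (real (Suc n)) / real (Suc n)) \<longlonglongrightarrow> 0"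
    using LIMSEQ_Suc[OF lim_ln_over_n] .
  then have "(\<lambda>n. - (ln (real (Suc n)) / real (Suc n))) \<longlonglongrightarrow> - 0" by (rule tendsto_minus)
  then show ?thesis using True by (simp add: ln_inverse divide_inverse mult.commute)
next
  case False
  have "(\<lambda>n. (x + inverse (real (Suc n))) * ln (x + inverse (real (Suc n)))) \<longlonglongrightarrow> (x + 0) * ln (x + 0)"
    using False assms by (intro tendsto_intros LIMSEQ_inverse_real_of_nat) auto
  then show ?thesis by simp
qed

lemma abs_x_ln_x_le:
  fixes x :: real
  assumes "0 \<le> x" "x \<le> M"
  shows "\<bar>x * ln x\<bar> \<le> 1 + M\<^sup>2"
proof (cases "x = 0")
  case False
  then have x: "x > 0" using assms by simp
  have "x * ln x \<le> x * x" using x ln_le_minus_one[OF x] by (intro mult_left_mono) auto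
  also have "\<dots> \<le> M\<^sup>2" unfolding power2_eq_square using assms by (intro mult_mono) auto
  finally show ?thesis using ge_minus_one_x_ln_x[OF x] zero_le_power2[of M] by linarith
qed simp

context heat
begin

text \<open>The left-hand side passes to the limit by dominated convergence and continuity of
  \<open>x * ln x\<close>. The right-hand side is compared directly: dividing by
  \<open>f + \<epsilon> n\<close> gives at most the quotient by \<open>f\<close>.\<close>

lemma log_sobolev:
  assumes t: "t \<ge> 0" and f: "test_fun f" "rot_invariant f" and pos: "\<And>p. f p \<ge> 0"
  shows "P t (\<lambda>p. f p * ln (f p)) g - P t f g * ln (P t f g) \<le> t * P t (\<lambda>p. Gam f f p / f p) g"
proof -
  define \<epsilon> where "\<epsilon> n = inverse (real (Suc n))" for n
  have \<epsilon>: "\<epsilon> n > 0" "\<epsilon> n \<le> 1" for n by (auto simp: \<epsilon>_def field_simps)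
  obtain M where M: "M \<ge> 0" "\<And>p. \<bar>f p\<bar> \<le> M" using test_fun_bounded[OF f(1)] by blast
  have [measurable]: "f \<in> borel_measurable borel" "Gam f f \<in> borel_measurable borel"
    using test_fun_smooth[OF f(1)] by (auto intro!: smooth_measurable smooth_Gam)
  interpret prob_space "\<mu> t" using t by (rule prob)
  have lim: "(\<lambda>n. P t (\<lambda>p. (f p + \<epsilon> n) * ln (f p + \<epsilon> n)) g) \<longlonglongrightarrow> P t (\<lambda>p. f p * ln (f p)) g"
    unfolding P_eq[OF t]
  proof (rule integral_dominated_convergence[where w = "\<lambda>_. 1 + (M + 1)\<^sup>2"])
    show "(\<lambda>h. f (N2_mult g h) * ln (f (N2_mult g h))) \<in> borel_measurable (\<mu> t)"
      by (rule measurable_shift[OF t]) measurable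
    show "(\<lambda>h. (f (N2_mult g h) + \<epsilon> n) * ln (f (N2_mult g h) + \<epsilon> n)) \<in> borel_measurable (\<mu> t)" for n
      by (rule measurable_shift[OF t, where f = "\<lambda>p. (f p + \<epsilon> n) * ln (f p + \<epsilon> n)"]) measurable
    show "AE h in \<mu> t. (\<lambda>n. (f (N2_mult g h) + \<epsilon> n) * ln (f (N2_mult g h) + \<epsilon> n))
        \<longlonglongrightarrow> f (N2_mult g h) * ln (f (N2_mult g h))"
      unfolding \<epsilon>_def by (intro AE_I2 tendsto_x_ln_x_shift pos)
    show "AE h in \<mu> t. norm ((f (N2_mult g h) + \<epsilon> n) * ln (f (N2_mult g h) + \<epsilon> n)) \<le> 1 + (M + 1)\<^sup>2" for n
    proof (rule AE_I2)
      fix h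
      have "f (N2_mult g h) \<le> M" by (rule abs_le_D1[OF M(2)])
      then show "norm ((f (N2_mult g h) + \<epsilon> n) * ln (f (N2_mult g h) + \<epsilon> n)) \<le> 1 + (M + 1)\<^sup>2"
        unfolding real_norm_def using pos[of "N2_mult g h"] \<epsilon>[of n]
        by (intro abs_x_ln_x_le) linarith+
    qed
  qed simp
  have lim': "(\<lambda>n. (P t f g + \<epsilon> n) * ln (P t f g + \<epsilon> n)) \<longlonglongrightarrow> P t f g * ln (P t f g)"
    unfolding \<epsilon>_def using P_nonneg[of t f g] pos t by (intro tendsto_x_ln_x_shift) auto
  obtain C where C: "C \<ge> 0" "\<And>p. Gam f f p \<le> C * f p" using Gam_le[OF f(1) pos] by auto
  have bnd: "bounded_borel (\<lambda>p. Gam f f p / f p)"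
  proof (rule bounded_borelI[of _ C])
    fix p show "\<bar>Gam f f p / f p\<bar> \<le> C"
      using C pos[of p] Gam_nonneg[of f p] by (cases "f p = 0") (auto simp: field_simps)
  qed measurable
  have le: "P t (\<lambda>p. Gam f f p / (f p + \<epsilon> n)) g \<le> P t (\<lambda>p. Gam f f p / f p) g" for n
  proof -
    have quot: "Gam f f p / (f p + \<epsilon> n) \<le> Gam f f p / f p" for p
    proof (cases "f p = 0")
      case True
      \<comment> \<open>At a zero of \<open>f\<close> the quotient \<open>Gam f f p / f p\<close> is
        \<open>0\<close> in HOL; \<open>Gam_le\<close> ensures that the regularised quotient is
        \<open>0\<close> as well.\<close>
      then have "Gam f f p = 0" using C(2)[of p] Gam_nonneg[of f p] by simp
      then show ?thesis by simp
    next
      case False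
      then show ?thesis using pos[of p] \<epsilon>(1)[of n] Gam_nonneg[of f p] by (intro divide_left_mono) auto
    qed
    obtain D where D: "\<And>p. \<bar>Gam f f p / f p\<bar> \<le> D" using bnd by (auto simp: bounded_borel_def)
    have nn: "0 \<le> Gam f f p / (f p + \<epsilon> n)" for p
      using pos[of p] \<epsilon>(1)[of n] Gam_nonneg[of f p] by (intro divide_nonneg_nonneg) auto
    have "bounded_borel (\<lambda>p. Gam f f p / (f p + \<epsilon> n))"
    proof (rule bounded_borelI[of _ D])
      fix p show "\<bar>Gam f f p / (f p + \<epsilon> n)\<bar> \<le> D" using nn[of p] quot[of p] D[of p] by linarith
    qed measurable
    then show ?thesis by (intro P_mono t bnd quot)
  qed
  show ?thesis
  proof (rule LIMSEQ_le_const2[OF tendsto_diff[OF lim lim']], intro exI allI impI)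
    fix n
    have "P t (\<lambda>p. (f p + \<epsilon> n) * ln (f p + \<epsilon> n)) g - (P t f g + \<epsilon> n) * ln (P t f g + \<epsilon> n)
      \<le> t * P t (\<lambda>p. Gam f f p / (f p + \<epsilon> n)) g"
      by (rule log_sobolev_regularised[OF t f pos \<epsilon>(1)])
    also have "\<dots> \<le> t * P t (\<lambda>p. Gam f f p / f p) g" using t le by (rule mult_left_mono[rotated])
    finally show "P t (\<lambda>p. (f p + \<epsilon> n) * ln (f p + \<epsilon> n)) g - (P t f g + \<epsilon> n) * ln (P t f g + \<epsilon> n)
      \<le> t * P t (\<lambda>p. Gam f f p / f p) g" .
  qed
qed

lemma bounded_borel_sqrt_Gam:
  assumes f: "test_fun f"
  shows "bounded_borel (\<lambda>p. sqrt (Gam f f p + c))"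
proof -
  have [measurable]: "Gam f f \<in> borel_measurable borel"
    using test_fun_smooth[OF f] by (auto intro!: smooth_measurable smooth_Gam)
  obtain M where M: "\<And>p. \<bar>Gam f f p\<bar> \<le> M" using test_fun_bounded[OF test_fun_Gam[OF f test_fun_smooth[OF f]]] by blast
  show ?thesis
  proof (rule bounded_borelI[of _ "sqrt (M + \<bar>c\<bar>)"])
    fix p
    have "\<bar>Gam f f p + c\<bar> \<le> M + \<bar>c\<bar>" using M[of p] by linarith
    then show "\<bar>sqrt (Gam f f p + c)\<bar> \<le> sqrt (M + \<bar>c\<bar>)" by (simp flip: real_sqrt_abs2 add: real_sqrt_abs)
  qed measurable
qed

lemma isoperimetric:
  assumes t: "t \<ge> 0" and f: "test_fun f" "rot_invariant f"
  shows "P t (\<lambda>p. \<bar>f p - P t f g\<bar>) g \<le> 4 * sqrt t * P t (\<lambda>p. sqrt (Gam f f p)) g"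
proof -
  define m where "m = P t f g"
  define S where "S = P t (\<lambda>p. sqrt (Gam f f p)) g"
  have sf: "smooth f" using f(1) by (rule test_fun_smooth)
  have bf: "bounded_borel f" by (rule bounded_borel_test_fun[OF f(1)])
  have bS: "bounded_borel (\<lambda>p. sqrt (Gam f f p))" using bounded_borel_sqrt_Gam[OF f(1), of 0] by simp
  have babs: "bounded_borel (\<lambda>p. \<bar>f p - m\<bar>)"
    by (intro bounded_borel_abs bounded_borel_diff bf bounded_borel_const)
  have S: "S \<ge> 0" unfolding S_def by (intro P_nonneg t) (simp add: Gam_nonneg)
  have main: "P t (\<lambda>p. \<bar>f p - m\<bar>) g \<le> \<epsilon> + 2 * sqrt 2 * sqrt t * (S + \<epsilon>)" if \<epsilon>: "\<epsilon> > 0" for \<epsilon>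
  proof -
    \<comment> \<open>A smooth sign: bounded by \<open>1\<close>, with \<open>x * \<psi> x\<close>
      at least \<open>\<bar>x\<bar> - \<epsilon>\<close>.\<close>
    define \<psi> where "\<psi> x = x / sqrt (x\<^sup>2 + \<epsilon>\<^sup>2)" for x
    \<comment> \<open>The value of \<open>\<psi> (f p - m)\<close> outside the support of
      \<open>f\<close>; subtracting it makes \<open>h\<close> compactly supported.\<close>
    define c where "c = \<psi> (- m)"
    define h where "h p = \<psi> (f p - m) - c" for p
    have pos: "x\<^sup>2 + \<epsilon>\<^sup>2 > 0" for x :: real using \<epsilon> by (simp add: add_nonneg_pos)
    have sqrt_ge: "sqrt (x\<^sup>2 + \<epsilon>\<^sup>2) \<ge> \<bar>x\<bar>" for x
      using real_sqrt_le_mono[of "x\<^sup>2" "x\<^sup>2 + \<epsilon>\<^sup>2"] by simp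
    have sqrt_pos: "sqrt (x\<^sup>2 + \<epsilon>\<^sup>2) > 0" for x using pos[of x] by simp
    have \<psi>_bound: "\<bar>\<psi> x\<bar> \<le> 1" for x
      using sqrt_ge[of x] sqrt_pos[of x] by (simp add: \<psi>_def)
    \<comment> \<open>For \<open>\<bar>x\<bar> > \<epsilon>\<close>, the root is at most
      \<open>\<bar>x\<bar> + \<epsilon>\<close>, and multiplying by
      \<open>\<bar>x\<bar> - \<epsilon>\<close> gives a difference of squares below
      \<open>x\<^sup>2\<close>.\<close>
    have \<psi>_ge: "\<psi> x * x \<ge> \<bar>x\<bar> - \<epsilon>" for x
    proof -
      let ?s = "sqrt (x\<^sup>2 + \<epsilon>\<^sup>2)"
      have "?s \<le> \<bar>x\<bar> + \<epsilon>" using \<epsilon> sqrt_sum_squares_le_sum_abs[of x \<epsilon>] by simp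
      then have "(\<bar>x\<bar> - \<epsilon>) * ?s \<le> x\<^sup>2"
      proof (cases "\<bar>x\<bar> \<le> \<epsilon>")
        case True
        then have "(\<bar>x\<bar> - \<epsilon>) * ?s \<le> 0" using sqrt_pos[of x] by (intro mult_nonpos_nonneg) auto
        then show ?thesis using zero_le_power2[of x] by linarith
      next
        case False
        assume "?s \<le> \<bar>x\<bar> + \<epsilon>"
        then have "(\<bar>x\<bar> - \<epsilon>) * ?s \<le> (\<bar>x\<bar> - \<epsilon>) * (\<bar>x\<bar> + \<epsilon>)" using False by (intro mult_left_mono) auto
        also have "\<dots> = x\<^sup>2 - \<epsilon>\<^sup>2" by (simp add: algebra_simps power2_eq_square)
        finally show ?thesis using zero_le_power2[of \<epsilon>] by linarith
      qed
      then have "\<bar>x\<bar> - \<epsilon> \<le> x\<^sup>2 / ?s" by (simp only: pos_le_divide_eq[OF sqrt_pos])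
      then show ?thesis by (simp only: \<psi>_def times_divide_eq_left power2_eq_square)
    qed
    have \<psi>_deriv: "\<exists>d. (\<psi> has_real_derivative d) (at x)" for x
    proof -
      have "((\<lambda>x. x\<^sup>2 + \<epsilon>\<^sup>2) has_real_derivative 2 * x) (at x)"
        by (auto intro!: derivative_eq_intros)
      from DERIV_chain2[where f = sqrt and g = "\<lambda>x. x\<^sup>2 + \<epsilon>\<^sup>2", OF DERIV_real_sqrt[OF pos] this]
      have "((\<lambda>x. sqrt (x\<^sup>2 + \<epsilon>\<^sup>2)) has_real_derivative inverse (sqrt (x\<^sup>2 + \<epsilon>\<^sup>2)) / 2 * (2 * x)) (at x)" .
      from DERIV_divide[OF DERIV_ident this less_imp_neq[OF sqrt_pos, symmetric]] show ?thesis
        unfolding \<psi>_def by (rule exI)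
    qed
    have sh: "smooth h"
    proof -
      have "smooth (\<lambda>p. \<psi> (f p - m))"
        unfolding \<psi>_def using sqrt_pos
        by (intro smooth_divide smooth_sqrt smooth_add smooth_power smooth_diff smooth_const sf pos) (metis less_irrefl)
      then show ?thesis unfolding h_def[abs_def] by (intro smooth_diff smooth_const)
    qed
    have th: "test_fun h"
    proof -
      obtain R where "\<And>p. norm p > R \<Longrightarrow> f p = 0"
        using f(1) by (auto simp: test_fun_def compactly_supported_iff)
      then have "\<forall>p. norm p > R \<longrightarrow> h p = 0" by (simp add: h_def c_def)
      then show ?thesis using sh unfolding test_fun_def compactly_supported_iff by blast
    qed
    have inv: "rot_invariant h"
      unfolding rot_invariant_def
    proof (intro allI impI)
      fix i j :: 'n and p assume ij: "i < j"
      obtain d where d: "(\<psi> has_real_derivative d) (at (f p - m))" using \<psi>_deriv by blast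
      have "((\<lambda>x. x - m) has_real_derivative 1) (at (f p))"
        by (auto intro!: derivative_eq_intros)
      from DERIV_diff[OF DERIV_chain2[where f = \<psi> and g = "\<lambda>x. x - m", OF d this] DERIV_const[of c]]
      have "((\<lambda>x. \<psi> (x - m) - c) has_real_derivative d) (at (f p))" by simp
      from grad_chain(2)[OF smooth_differentiable[OF sf] this]
      have "rot i j h p = d * rot i j f p" by (simp add: rot_def h_def[abs_def])
      then show "rot i j h p = 0" using f(2) ij by (simp add: rot_invariant_def)
    qed
    have ch: "c + h p = \<psi> (f p - m)" for p by (simp add: h_def)
    have b\<psi>: "bounded_borel (\<lambda>p. \<psi> (f p - m))"
    proof -
      have "bounded_borel (\<lambda>p. c + h p)"
        by (intro bounded_borel_add bounded_borel_const bounded_borel_test_fun th)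
      then show ?thesis by (simp add: ch)
    qed
    have cP: "c + P t h g = P t (\<lambda>p. \<psi> (f p - m)) g"
      by (simp add: P_add P_const t bounded_borel_test_fun th bounded_borel_const flip: ch)
    \<comment> \<open>Since \<open>m\<close> is the average of \<open>f\<close>, the average of
      \<open>\<psi> (f - m) * (f - m)\<close> is the covariance of \<open>\<psi> (f - m)\<close> and
      \<open>f\<close>.\<close>
    have "P t (\<lambda>p. \<bar>f p - m\<bar> - \<epsilon>) g \<le> P t (\<lambda>p. \<psi> (f p - m) * f p - m * \<psi> (f p - m)) g"
    proof (rule P_mono[OF t])
      show "bounded_borel (\<lambda>p. \<bar>f p - m\<bar> - \<epsilon>)" by (rule bounded_borel_diff[OF babs bounded_borel_const])
      show "bounded_borel (\<lambda>p. \<psi> (f p - m) * f p - m * \<psi> (f p - m))"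
        by (intro bounded_borel_diff bounded_borel_mult b\<psi> bf bounded_borel_const)
      show "\<bar>f p - m\<bar> - \<epsilon> \<le> \<psi> (f p - m) * f p - m * \<psi> (f p - m)" for p
        using \<psi>_ge[of "f p - m"] by (simp add: left_diff_distrib mult.commute)
    qed
    also have "\<dots> = P t (\<lambda>p. (c + h p) * f p) g - (c + P t h g) * P t f g"
      by (simp add: P_diff P_cmult t bounded_borel_mult b\<psi> bf bounded_borel_const ch cP m_def[symmetric])
    also have "\<dots> \<le> 2 * sqrt 2 * sqrt t * P t (\<lambda>p. sqrt (Gam f f p + \<epsilon>\<^sup>2)) g"
      using \<psi>_bound by (intro covariance_bound t f th inv \<epsilon>) (simp add: ch)
    also have "\<dots> \<le> 2 * sqrt 2 * sqrt t * (S + \<epsilon>)"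
    proof (rule mult_left_mono)
      have "P t (\<lambda>p. sqrt (Gam f f p + \<epsilon>\<^sup>2)) g \<le> P t (\<lambda>p. sqrt (Gam f f p) + \<epsilon>) g"
      proof (rule P_mono[OF t bounded_borel_sqrt_Gam[OF f(1)]])
        show "bounded_borel (\<lambda>p. sqrt (Gam f f p) + \<epsilon>)"
          by (intro bounded_borel_add bS bounded_borel_const)
        fix p
        show "sqrt (Gam f f p + \<epsilon>\<^sup>2) \<le> sqrt (Gam f f p) + \<epsilon>"
          using sqrt_add_le_add_sqrt[of "Gam f f p" "\<epsilon>\<^sup>2"] Gam_nonneg[of f p] \<epsilon> by simp
      qed
      then show "P t (\<lambda>p. sqrt (Gam f f p + \<epsilon>\<^sup>2)) g \<le> S + \<epsilon>"
        by (simp add: P_add P_const t bS bounded_borel_const S_def)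
    qed (use t in simp)
    finally have "P t (\<lambda>p. \<bar>f p - m\<bar> - \<epsilon>) g \<le> 2 * sqrt 2 * sqrt t * (S + \<epsilon>)" .
    moreover have "P t (\<lambda>p. \<bar>f p - m\<bar> - \<epsilon>) g = P t (\<lambda>p. \<bar>f p - m\<bar>) g - \<epsilon>"
      by (simp add: P_diff P_const t babs bounded_borel_const)
    ultimately show ?thesis by linarith
  qed
  have "P t (\<lambda>p. \<bar>f p - m\<bar>) g \<le> 2 * sqrt 2 * sqrt t * S"
  proof (rule field_le_epsilon)
    fix e :: real assume e: "e > 0"
    \<comment> \<open>The total coefficient of \<epsilon> in \<open>main\<close>, so that
      \<open>d = e / k\<close> produces exactly the error \<open>e\<close>.\<close>
    define k where "k = 1 + 2 * sqrt 2 * sqrt t"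
    have k: "k > 0" using t by (simp add: k_def add_pos_nonneg)
    define d where "d = e / k"
    have d: "d > 0" "k * d = e" using e k by (simp_all add: d_def)
    have "P t (\<lambda>p. \<bar>f p - m\<bar>) g \<le> d + 2 * sqrt 2 * sqrt t * (S + d)" by (rule main[OF d(1)])
    also have "\<dots> = 2 * sqrt 2 * sqrt t * S + k * d" by (simp add: k_def algebra_simps)
    finally show "P t (\<lambda>p. \<bar>f p - m\<bar>) g \<le> 2 * sqrt 2 * sqrt t * S + e" by (simp only: d(2))
  qed
  also have "\<dots> \<le> 4 * sqrt t * S"
  proof -
    \<comment> \<open>The argument gives the constant \<open>2 * sqrt 2\<close>, which is rounded up
      to \<open>4\<close>.\<close>
    have "sqrt 2 \<le> 2" using real_sqrt_le_mono[of 2 4] by simp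
    then have "(2 * sqrt 2) * (sqrt t * S) \<le> 4 * (sqrt t * S)"
      using S t by (intro mult_right_mono) auto
    then show ?thesis by (simp only: mult.assoc)
  qed
  finally show ?thesis by (simp add: m_def S_def)
qed

end

theorem theorem4p5:
  fixes P :: "real \<Rightarrow> (('n::{finite,linorder}) N2 \<Rightarrow> real) \<Rightarrow> 'n N2 \<Rightarrow> real"
    and f :: "'n N2 \<Rightarrow> real" and t :: real and g :: "'n N2"
  assumes "heat_semigroup P"
    and "smooth f" and "compactly_supported f" and "radial f"
    and "t \<ge> 0"
  shows "Gamma_two f g \<ge> 0 \<and>
    ((\<forall>p. f p \<ge> 0) \<longrightarrow>
       P t (\<lambda>p. f p * ln (f p)) g - P t f g * ln (P t f g)
         \<le> t * P t (\<lambda>p. carre_du_champ f f p / f p) g) \<and>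
    P t (\<lambda>p. \<bar>f p - P t f g\<bar>) g
      \<le> 4 * sqrt t * P t (\<lambda>p. sqrt (carre_du_champ f f p)) g"
proof -
  obtain \<mu> where "heat P \<mu>"
    using assms(1) unfolding heat_semigroup_def heat_def by blast
  then interpret heat P \<mu> .
  have f: "test_fun f" "rot_invariant f"
    using assms(2-4) by (auto simp: test_fun_def intro: radial_imp_rot_invariant)
  show ?thesis
    unfolding carre_du_champ_eq[OF assms(2) assms(2)]
    by (intro conjI impI Gamma_two_nonneg log_sobolev isoperimetric assms f) simp
qed

end
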